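(* Let $h(y)=e^{y^2/2}(2y^2+1)$ for $y\in\mathbb{R}$, and define polynomials $$Q_n(y)=2n(2y^2+1)H_{n-1}(y)-(4y^3+6y)H_n(y),\qquad n\ge0,$$ where $H_n$ are the Hermite polynomials. Then the set of polynomials $\{1\}\cup\{Q_n\}_{n\ge0}$ is a complete orthogonal set in the space $L_2(\mathbb{R},\nu(\mathrm{d}y))$, where $$\nu(\mathrm{d}y):=h^{-2}(y)\,\mathrm{d}y=\frac{e^{-y^2}}{(2y^2+1)^2}\,\mathrm{d}y.$$ Moreover, let $\widetilde Y$ be the Brownian motion on $\mathbb{R}$ killed at rate $$\tilde c(y)=\frac{y^2}{2}+\frac{8y^2(2y^2+3)}{(2y^2+1)^2}.$$ Then the transition probability density (with respect to Lebesgue measure) of $\widetilde Y$ has the spectral representation $$p^{\widetilde Y}_t(x,y)=\frac{1}{\sqrt\pi}\,\frac{e^{-\frac12(x^2+y^2)}}{(2x^2+1)(2y^2+1)}\left[2e^{-\frac52t}+\sum_{n\ge0}e^{-(n+11/2)t}\,\frac{Q_n(x)Q_n(y)}{2^{n+1}\,n!\,(n+3)}\right]$$ for $t>0$ and $x,y\in\mathbb{R}$.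
   Context: $H_n$ are the physicists' Hermite polynomials, $H_n(y)=(-1)^ne^{y^2}\frac{\mathrm{d}^n}{\mathrm{d}y^n}e^{-y^2}$ (orthogonal with respect to $e^{-y^2}\mathrm{d}y$, with $H_n'=2nH_{n-1}$); for $n=0$ the term $2n(2y^2+1)H_{n-1}(y)$ is zero. Equivalently $Q_n=h f_n'-h'f_n$ with $f_n(y)=e^{-y^2/2}H_n(y)$. "Brownian motion killed at rate $\tilde c$" is the diffusion with infinitesimal generator $\frac12\partial_y^2-\tilde c(y)$ on $\mathbb{R}$, i.e. $\mathbb{E}_x[f(\widetilde Y_t)]=\mathbb{E}_x\bigl[e^{-\int_0^t\tilde c(W_s)\mathrm{d}s}f(W_t)\bigr]$ with $W$ a standard Brownian motion. (This $\widetilde Y$ is the Darboux transform, with seed function $h$, of the Brownian motion on $\mathbb{R}$ killed at rate $y^2/2$.) *)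

theory Defs
  imports "HOL-Probability.Probability" "HOL-Computational_Algebra.Polynomial"
begin

definition hermite :: "nat \<Rightarrow> real \<Rightarrow> real" where
  "hermite n y = (-1) ^ n * exp (y\<^sup>2) * (deriv ^^ n) (\<lambda>z. exp (- z\<^sup>2)) y"

definition seed :: "real \<Rightarrow> real" where
  "seed y = exp (y\<^sup>2 / 2) * (2 * y\<^sup>2 + 1)"

(* For n = 0 the index n - 1 truncates to 0, but the factor n makes the term vanish. *)
definition Q :: "nat \<Rightarrow> real \<Rightarrow> real" where
  "Q n y = 2 * real n * (2 * y\<^sup>2 + 1) * hermite (n - 1) y - (4 * y ^ 3 + 6 * y) * hermite n y"

definition nu :: "real measure" where
  "nu = density lborel (\<lambda>y. ennreal (1 / (seed y)\<^sup>2))"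

definition ctilde :: "real \<Rightarrow> real" where
  "ctilde y = y\<^sup>2 / 2 + 8 * y\<^sup>2 * (2 * y\<^sup>2 + 3) / (2 * y\<^sup>2 + 1)\<^sup>2"


definition square_integrable :: "'a measure \<Rightarrow> ('a \<Rightarrow> real) \<Rightarrow> bool" where
  "square_integrable M f \<longleftrightarrow> f \<in> borel_measurable M \<and> integrable M (\<lambda>x. (f x)\<^sup>2)"

definition L2_orthogonal_set :: "'a measure \<Rightarrow> ('a \<Rightarrow> real) set \<Rightarrow> bool" where
  "L2_orthogonal_set M S \<longleftrightarrow>
     (\<forall>f\<in>S. square_integrable M f \<and> (\<integral>x. (f x)\<^sup>2 \<partial>M) \<noteq> 0) \<and>
     (\<forall>f\<in>S. \<forall>g\<in>S. f \<noteq> g \<longrightarrow> (\<integral>x. f x * g x \<partial>M) = 0)"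

(* Complete (total): finite linear combinations of members of S are dense in real L2(M). *)
definition L2_complete_set :: "'a measure \<Rightarrow> ('a \<Rightarrow> real) set \<Rightarrow> bool" where
  "L2_complete_set M S \<longleftrightarrow>
     (\<forall>f. square_integrable M f \<longrightarrow>
       (\<forall>\<epsilon>>0. \<exists>T a. finite T \<and> T \<subseteq> S \<and>
          sqrt (\<integral>x. (f x - (\<Sum>g\<in>T. a g * g x))\<^sup>2 \<partial>M) < \<epsilon>))"


(* Standard Brownian motion with time set [0,\<infinity>); the values of W at negative times are irrelevant.
   Every path is continuous, so that path functionals are measurable without completing M. *)
definition brownian_motion :: "'a measure \<Rightarrow> (real \<Rightarrow> 'a \<Rightarrow> real) \<Rightarrow> bool" where
  "brownian_motion M W \<longleftrightarrow>
     prob_space M \<and>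
     (\<forall>t\<ge>0. W t \<in> borel_measurable M) \<and>
     (AE \<omega> in M. W 0 \<omega> = 0) \<and>
     (\<forall>\<omega>\<in>space M. continuous_on {0..} (\<lambda>t. W t \<omega>)) \<and>
     (\<forall>s t. 0 \<le> s \<and> s < t \<longrightarrow>
        distributed M lborel (\<lambda>\<omega>. W t \<omega> - W s \<omega>) (normal_density 0 (sqrt (t - s)))) \<and>
     (\<forall>n (r :: nat \<Rightarrow> real). 0 \<le> r 0 \<and> (\<forall>i<n. r i \<le> r (Suc i)) \<longrightarrow>
        prob_space.indep_vars M (\<lambda>_. borel) (\<lambda>i \<omega>. W (r (Suc i)) \<omega> - W (r i) \<omega>) {..<n})"

(* E_x[f(Y_t)] for the Brownian motion Y killed at rate c and started at x (with f = 0 at the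
   cemetery), where the Brownian motion started at x is x + W. *)
definition killed_expectation ::
    "'a measure \<Rightarrow> (real \<Rightarrow> 'a \<Rightarrow> real) \<Rightarrow> (real \<Rightarrow> real) \<Rightarrow> real \<Rightarrow> real \<Rightarrow> (real \<Rightarrow> real) \<Rightarrow> real" where
  "killed_expectation M W c x t f =
     (\<integral>\<omega>. exp (- (LINT s:{0..t}|lborel. c (x + W s \<omega>))) * f (x + W t \<omega>) \<partial>M)"

(* Continuity in y selects one version of the density, which Y alone determines only up to
   Lebesgue null sets, and so gives its values at individual points a meaning. *)
definition killed_transition_density ::
    "'a measure \<Rightarrow> (real \<Rightarrow> 'a \<Rightarrow> real) \<Rightarrow> (real \<Rightarrow> real) \<Rightarrow> (real \<Rightarrow> real \<Rightarrow> real \<Rightarrow> real) \<Rightarrow> bool" where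
  "killed_transition_density M W c p \<longleftrightarrow>
     (\<forall>t>0. \<forall>x.
        (\<forall>y. 0 \<le> p t x y) \<and> continuous_on UNIV (p t x) \<and> integrable lborel (p t x) \<and>
        (\<forall>f. f \<in> borel_measurable borel \<and> bounded (range f) \<longrightarrow>
           killed_expectation M W c x t f = (\<integral>y. f y * p t x y \<partial>lborel)))"

end

theory Submission
  imports Defs
begin

text \<open>
  Write \<open>d = 2y\<^sup>2 + 1\<close>, \<open>f\<^sub>n = e\<^bsup>-y\<^sup>2/2\<^esup> H\<^sub>n\<close> and \<open>w = h'/h\<close>. The functions \<open>1/h\<close> and \<open>Q\<^sub>n/h = f\<^sub>n' - w f\<^sub>n\<close> are
  eigenfunctions of the generator \<open>\<partial>\<^sup>2/2 - ctilde\<close> with eigenvalues \<open>-5/2\<close> and \<open>-(n + 11/2)\<close>, so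
  orthogonality is the Wronskian identity. The linear span of \<open>1\<close> and the \<open>Q\<^sub>n\<close> contains \<open>d\<^sup>2 s\<close> for every
  polynomial \<open>s\<close>; a function orthogonal to the span therefore has vanishing moments against a
  Gaussian weight and is zero, which gives completeness.

  For the transition density, one Trotter step of length \<open>\<delta>\<close> reproduces \<open>e\<^bsup>-\<lambda>\<delta>\<^esup> \<phi>\<close> on an eigenfunction \<open>\<phi>\<close> up to
  a uniform error of order \<open>\<delta>\<^bsup>3/2\<^esup>\<close>, and the step operators are contractions, so the killed semigroup
  acts on \<open>\<phi>\<close> as \<open>e\<^bsup>-\<lambda>t\<^esup>\<close>. The law of the killed process has a density by Radon-Nikodym; this density and
  the spectral series have the same integrals against all eigenfunctions, hence agree.
\<close>

section \<open>Hermite polynomials and Gaussian rational functions\<close>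

text \<open>The expectation that defines the killed process depends on the whole path, while an
  eigenfunction carries only local, differential information. Time discretisation bridges the two:
  left-endpoint Riemann sums turn the path functional into iterated Gaussian integrals, and the
  generator enters through a Taylor expansion of one step. The unbounded rate \<open>ctilde\<close>
  does no harm there, because the eigenfunctions decay like Gaussians and stay bounded after
  multiplication by \<open>ctilde\<close> twice. The density furnished by Radon-Nikodym is only
  known to be integrable, not square integrable, so completeness in L2 cannot identify it. The
  uniqueness argument is therefore run under a hypothesis that covers both situations: integrability
  against Gaussian rational functions times arbitrary exponentials. Equality almost everywhere
  becomes equality everywhere by continuity of the series, which is also how the series is seen to
  be nonnegative.\<close>

primrec hpoly :: "nat \<Rightarrow> real poly" where
  "hpoly 0 = 1"
| "hpoly (Suc n) = [:0, 2:] * hpoly n - pderiv (hpoly n)"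

text \<open>Differentiating p e^(-z^2) gives (p' - 2 z p) e^(-z^2); the recursion of
  \<open>hpoly\<close> is this step with its sign moved into (-1)^n.\<close>

lemma deriv_funpow_gaussian:
  "(deriv ^^ n) (\<lambda>z::real. exp (- z\<^sup>2)) = (\<lambda>z. (-1) ^ n * poly (hpoly n) z * exp (- z\<^sup>2))"
proof (induction n)
  case (Suc n)
  have "((\<lambda>z. (-1) ^ n * poly (hpoly n) z * exp (- z\<^sup>2)) has_real_derivative
      (-1) ^ Suc n * poly (hpoly (Suc n)) z * exp (- z\<^sup>2)) (at z)" for z :: real
    by (auto intro!: derivative_eq_intros simp: algebra_simps)
  then show ?case
    by (auto simp: Suc.IH intro!: ext DERIV_imp_deriv)
qed simp

lemma hermite_poly: "hermite n y = poly (hpoly n) y"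
  unfolding hermite_def deriv_funpow_gaussian
  by (simp add: mult.assoc [symmetric] power_mult_distrib [symmetric] exp_add [symmetric])
    (simp add: mult.assoc exp_add [symmetric] mult.left_commute)

text \<open>The induction differentiates the recursion and uses the hypothesis twice, once under a
  further derivative; what remains is again the recursion for \<open>hpoly (Suc n)\<close>.\<close>

lemma pderiv_hpoly_Suc: "pderiv (hpoly (Suc n)) = smult (2 * real (Suc n)) (hpoly n)"
proof (induction n)
  case 0
  show ?case by (simp add: pderiv_pCons)
next
  case (Suc n)
  have *: "pderiv (hpoly n) = [:0, 2:] * hpoly n - hpoly (Suc n)"
    by simp
  have "pderiv (hpoly (Suc (Suc n))) =
      [:0, 2:] * pderiv (hpoly (Suc n)) + smult 2 (hpoly (Suc n)) - pderiv (pderiv (hpoly (Suc n)))"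
    by (subst hpoly.simps(2)) (simp add: pderiv_diff pderiv_mult pderiv_pCons pderiv_smult del: hpoly.simps)
  also have "\<dots> = smult (2 * real (Suc n)) ([:0, 2:] * hpoly n - pderiv (hpoly n)) + smult 2 (hpoly (Suc n))"
    unfolding Suc.IH by (simp add: pderiv_smult smult_diff_right del: hpoly.simps of_nat_Suc)
  also have "\<dots> = smult (2 * real (Suc (Suc n))) (hpoly (Suc n))"
    unfolding hpoly.simps(2)[symmetric] smult_add_left[symmetric]
    by (rule arg_cong2[where f=smult]) simp_all
  finally show ?case .
qed

lemma pderiv_hpoly: "pderiv (hpoly n) = smult (2 * real n) (hpoly (n - 1))"
  by (cases n) (simp_all add: pderiv_hpoly_Suc del: hpoly.simps(2))

definition seed_poly :: "real \<Rightarrow> real" where "seed_poly y = 2 * y\<^sup>2 + 1"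

lemma seed_poly_pos: "0 < seed_poly y" and seed_poly_ge_1: "1 \<le> seed_poly y"
  by (simp_all add: seed_poly_def add_nonneg_pos)

lemma seed_poly_nz [simp]: "seed_poly y \<noteq> 0"
  using seed_poly_pos[of y] by simp

lemma DERIV_seed_poly: "(seed_poly has_real_derivative 4 * y) (at y)"
  unfolding seed_poly_def by (auto intro!: derivative_eq_intros)

text \<open>A class closed under sums, products (the rates \<open>a\<close> add), derivatives and
  multiplication by \<open>ctilde\<close>, whose members with positive rate are bounded, integrable
  and vanish at infinity. The eigenfunctions and their derivatives all lie in it, so integration by
  parts needs no separate estimates.\<close>

definition gaussian_rational :: "real \<Rightarrow> (real \<Rightarrow> real) \<Rightarrow> bool" where
  "gaussian_rational a f \<longleftrightarrow> (\<exists>q k. \<forall>y. f y = poly q y * exp (- a * y\<^sup>2) / seed_poly y ^ k)"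

lemma gaussian_rationalI:
  "(\<And>y. f y = poly q y * exp (- a * y\<^sup>2) / seed_poly y ^ k) \<Longrightarrow> gaussian_rational a f"
  unfolding gaussian_rational_def by blast

lemma gaussian_rational_add:
  assumes "gaussian_rational a f" "gaussian_rational a g"
  shows "gaussian_rational a (\<lambda>y. f y + g y)"
proof -
  obtain q k r l where f: "\<And>y. f y = poly q y * exp (- a * y\<^sup>2) / seed_poly y ^ k"
    and g: "\<And>y. g y = poly r y * exp (- a * y\<^sup>2) / seed_poly y ^ l"
    using assms unfolding gaussian_rational_def by blast
  have d: "poly [:1, 0, 2:] y = seed_poly y" for y
    by (simp add: seed_poly_def power2_eq_square)
  show ?thesis
    by (rule gaussian_rationalI[of _ "q * [:1, 0, 2:] ^ l + r * [:1, 0, 2:] ^ k" _ "k + l"])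
      (simp add: f g d poly_power field_simps power_add del: poly_pCons)
qed

lemma gaussian_rational_mult:
  assumes "gaussian_rational a f" "gaussian_rational b g"
  shows "gaussian_rational (a + b) (\<lambda>y. f y * g y)"
proof -
  obtain q k r l where f: "\<And>y. f y = poly q y * exp (- a * y\<^sup>2) / seed_poly y ^ k"
    and g: "\<And>y. g y = poly r y * exp (- b * y\<^sup>2) / seed_poly y ^ l"
    using assms unfolding gaussian_rational_def by blast
  show ?thesis
    by (rule gaussian_rationalI[of _ "q * r" _ "k + l"])
      (simp add: f g power_add algebra_simps exp_add[symmetric] exp_diff)
qed

lemma gaussian_rational_rational: "gaussian_rational 0 (\<lambda>y. poly q y / seed_poly y ^ k)"
  by (rule gaussian_rationalI[of _ q _ k]) simp

lemma gaussian_rational_mult_rational: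
  "gaussian_rational a f \<Longrightarrow> gaussian_rational a (\<lambda>y. poly q y / seed_poly y ^ k * f y)"
  using gaussian_rational_mult[OF gaussian_rational_rational] by simp

lemma gaussian_rational_cmult:
  "gaussian_rational a f \<Longrightarrow> gaussian_rational a (\<lambda>y. c * f y)"
  using gaussian_rational_mult_rational[of a f "[:c:]" 0] by simp

lemma gaussian_rational_diff:
  assumes "gaussian_rational a f" "gaussian_rational a g"
  shows "gaussian_rational a (\<lambda>y. f y - g y)"
  using gaussian_rational_add[OF assms(1) gaussian_rational_cmult[OF assms(2), of "-1"]] by simp

lemma gaussian_rational_has_derivative:
  assumes "gaussian_rational a f"
  obtains f' where "gaussian_rational a f'" "\<And>y. (f has_real_derivative f' y) (at y)"
proof -
  obtain q k where f: "\<And>y. f y = poly q y * exp (- a * y\<^sup>2) / seed_poly y ^ k"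
    using assms unfolding gaussian_rational_def by blast
  \<comment> \<open>The quotient rule over the denominator \<open>seed_poly y ^ Suc k\<close>: the
    exponential contributes the factor -2 a y, and the derivative 4 y of \<open>seed_poly\<close>
    contributes 4 k y.\<close>
  define r where "r = (pderiv q - [:0, 2 * a:] * q) * [:1, 0, 2:] - [:0, 4 * real k:] * q"
  have d: "poly [:1, 0, 2:] y = seed_poly y" for y
    by (simp add: seed_poly_def power2_eq_square)
  have r: "poly r y = (poly (pderiv q) y - 2 * a * y * poly q y) * seed_poly y - 4 * real k * y * poly q y" for y
    unfolding r_def poly_diff poly_mult d by (simp add: algebra_simps)
  show ?thesis
  proof
    show "gaussian_rational a (\<lambda>y. poly r y * exp (- a * y\<^sup>2) / seed_poly y ^ Suc k)"
      by (rule gaussian_rationalI[of _ r _ "Suc k"]) simp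
    show "(f has_real_derivative poly r y * exp (- a * y\<^sup>2) / seed_poly y ^ Suc k) (at y)" for y
    proof -
      have "((\<lambda>y. poly q y * exp (- a * y\<^sup>2) / seed_poly y ^ k) has_real_derivative
        ((poly (pderiv q) y * exp (- a * y\<^sup>2) + exp (- a * y\<^sup>2) * (- a * (2 * y)) * poly q y) * seed_poly y ^ k
          - (poly q y * exp (- a * y\<^sup>2)) * (real k * (4 * y) * seed_poly y ^ (k - 1))) / (seed_poly y ^ k * seed_poly y ^ k)) (at y)"
        by (auto intro!: derivative_eq_intros DERIV_seed_poly)
      also have "((poly (pderiv q) y * exp (- a * y\<^sup>2) + exp (- a * y\<^sup>2) * (- a * (2 * y)) * poly q y) * seed_poly y ^ k
          - (poly q y * exp (- a * y\<^sup>2)) * (real k * (4 * y) * seed_poly y ^ (k - 1))) / (seed_poly y ^ k * seed_poly y ^ k)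
         = poly r y * exp (- a * y\<^sup>2) / seed_poly y ^ Suc k"
        unfolding r by (cases k) (simp_all add: field_simps)
      finally show ?thesis
        by (subst f[abs_def]) simp
    qed
  qed
qed

lemma power_le_fact_exp:
  fixes x :: real assumes "0 \<le> x" shows "x ^ n \<le> fact n * exp x"
proof -
  have "(\<Sum>j\<in>{n}. inverse (fact j) * x ^ j) \<le> (\<Sum>j. inverse (fact j) * x ^ j)"
    using assms by (intro sum_le_suminf summable_exp) auto
  then show ?thesis by (simp add: exp_def field_simps)
qed

lemma abs_poly_le_exp:
  obtains C where "0 \<le> C" "\<And>y::real. \<bar>poly q y\<bar> \<le> C * exp \<bar>y\<bar>"
proof
  let ?C = "\<Sum>i\<le>degree q. \<bar>coeff q i\<bar> * fact i"
  show "0 \<le> ?C" by (intro sum_nonneg) simp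
  fix y :: real
  have "\<bar>poly q y\<bar> \<le> (\<Sum>i\<le>degree q. \<bar>coeff q i\<bar> * \<bar>y\<bar> ^ i)"
    unfolding poly_altdef by (rule order_trans[OF sum_abs]) (simp add: abs_mult power_abs)
  also have "\<dots> \<le> (\<Sum>i\<le>degree q. \<bar>coeff q i\<bar> * (fact i * exp \<bar>y\<bar>))"
    by (intro sum_mono mult_left_mono power_le_fact_exp) simp_all
  finally show "\<bar>poly q y\<bar> \<le> ?C * exp \<bar>y\<bar>"
    by (simp add: sum_distrib_left mult_ac)
qed

text \<open>Completing the square: half of the Gaussian exponent is given up to absorb the linear
  exponential.\<close>

lemma exp_abs_gaussian_le:
  fixes a b y :: real assumes "0 < a"
  shows "exp (b * \<bar>y\<bar>) * exp (- a * y\<^sup>2) \<le> exp (b\<^sup>2 / (2 * a)) * exp (- (a / 2) * y\<^sup>2)"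
proof -
  have "0 \<le> (a * \<bar>y\<bar> - b)\<^sup>2 / (2 * a)"
    using assms by simp
  also have "(a * \<bar>y\<bar> - b)\<^sup>2 / (2 * a) = a / 2 * y\<^sup>2 - b * \<bar>y\<bar> + b\<^sup>2 / (2 * a)"
    using assms by (simp add: power2_diff power_mult_distrib field_simps power2_eq_square)
  finally show ?thesis
    by (simp add: exp_add[symmetric] algebra_simps)
qed

lemma integrable_gaussian:
  fixes a :: real assumes "0 < a"
  shows "integrable lborel (\<lambda>y. exp (- a * y\<^sup>2))"
proof -
  have *: "sqrt (2 * pi * (sqrt (1 / (2 * a)))\<^sup>2) * normal_density 0 (sqrt (1 / (2 * a))) y = exp (- a * y\<^sup>2)" for y
    using assms by (simp add: normal_density_def field_simps)
  have "integrable lborel (\<lambda>y. sqrt (2 * pi * (sqrt (1 / (2 * a)))\<^sup>2) * normal_density 0 (sqrt (1 / (2 * a))) y)"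
    using assms by (intro integrable_mult_right integrable_normal_density) simp
  then show ?thesis unfolding * .
qed

lemma gaussian_rational_continuous:
  assumes "gaussian_rational a f" shows "continuous_on A f"
proof -
  obtain f' where "\<And>y. (f has_real_derivative f' y) (at y)"
    using gaussian_rational_has_derivative[OF assms] by metis
  then have "isCont f y" for y by (rule DERIV_isCont)
  then show ?thesis by (simp add: continuous_at_imp_continuous_on)
qed

lemma gaussian_rational_measurable:
  "gaussian_rational a f \<Longrightarrow> f \<in> borel_measurable borel"
  by (rule borel_measurable_continuous_onI[OF gaussian_rational_continuous])

text \<open>One estimate for several uses: \<open>b = 0\<close> gives boundedness,
  \<open>b = 1\<close> decay, and arbitrary \<open>b\<close> the exponential integrability from
  which moments determine a function. The denominator is dropped because \<open>seed_poly\<close> is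
  at least 1.\<close>

lemma gaussian_rational_le:
  assumes "gaussian_rational a f" "0 < a"
  obtains C where "0 \<le> C" "\<And>y. \<bar>f y\<bar> * exp (b * \<bar>y\<bar>) \<le> C * exp (- (a / 2) * y\<^sup>2)"
proof -
  obtain q k where f: "\<And>y. f y = poly q y * exp (- a * y\<^sup>2) / seed_poly y ^ k"
    using assms unfolding gaussian_rational_def by blast
  obtain C where C: "0 \<le> C" "\<And>y::real. \<bar>poly q y\<bar> \<le> C * exp \<bar>y\<bar>"
    using abs_poly_le_exp[of q] by blast
  show ?thesis
  proof
    \<comment> \<open>In \<open>1 + b\<close> the summand 1 pays for the polynomial, which is at
      most a multiple of e^|y|.\<close>
    show "0 \<le> C * exp ((1 + b)\<^sup>2 / (2 * a))" using C by simp
    fix y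
    have "\<bar>f y\<bar> \<le> \<bar>poly q y\<bar> * exp (- a * y\<^sup>2)"
      using one_le_power[OF seed_poly_ge_1[of y], of k] mult_left_mono[of 1 "seed_poly y ^ k" "\<bar>poly q y\<bar> * exp (- a * y\<^sup>2)"]
      by (simp add: f abs_mult divide_le_eq)
    then have "\<bar>f y\<bar> * exp (b * \<bar>y\<bar>) \<le> (C * exp \<bar>y\<bar>) * exp (- a * y\<^sup>2) * exp (b * \<bar>y\<bar>)"
      by (intro mult_right_mono order_trans[OF _ mult_right_mono[OF C(2)]]) simp_all
    also have "\<dots> = C * (exp ((1 + b) * \<bar>y\<bar>) * exp (- a * y\<^sup>2))"
      by (simp add: algebra_simps exp_add exp_diff)
    also have "\<dots> \<le> C * (exp ((1 + b)\<^sup>2 / (2 * a)) * exp (- (a / 2) * y\<^sup>2))"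
      by (intro mult_left_mono exp_abs_gaussian_le assms C)
    finally show "\<bar>f y\<bar> * exp (b * \<bar>y\<bar>) \<le> C * exp ((1 + b)\<^sup>2 / (2 * a)) * exp (- (a / 2) * y\<^sup>2)"
      by simp
  qed
qed

lemma gaussian_rational_bounded:
  assumes "gaussian_rational a f" "0 < a"
  obtains B where "0 \<le> B" "\<And>y. \<bar>f y\<bar> \<le> B"
proof -
  obtain C where C: "0 \<le> C" "\<And>y. \<bar>f y\<bar> * exp (0 * \<bar>y\<bar>) \<le> C * exp (- (a / 2) * y\<^sup>2)"
    using gaussian_rational_le[OF assms] by blast
  have "C * exp (- (a / 2) * y\<^sup>2) \<le> C" for y
    using C(1) assms(2) by (intro mult_left_le) auto
  with C that[of C] show ?thesis
    by (simp) (meson order_trans)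
qed

lemma gaussian_rational_integrable_exp:
  assumes "gaussian_rational a f" "0 < a"
  shows "integrable lborel (\<lambda>y. f y * exp (b * \<bar>y\<bar>))"
proof -
  obtain C where C: "0 \<le> C" "\<And>y. \<bar>f y\<bar> * exp (b * \<bar>y\<bar>) \<le> C * exp (- (a / 2) * y\<^sup>2)"
    using gaussian_rational_le[OF assms] by blast
  note [measurable] = gaussian_rational_measurable[OF assms(1)]
  show ?thesis
    by (rule Bochner_Integration.integrable_bound[OF integrable_mult_right[OF integrable_gaussian[of "a / 2"], of C]])
      (use assms C in \<open>auto simp: abs_mult\<close>)
qed

lemma gaussian_rational_integrable:
  assumes "gaussian_rational a f" "0 < a"
  shows "integrable lborel f"
  using gaussian_rational_integrable_exp[OF assms, of 0] by simp

text \<open>Limits along the integers suffice, since integrals over the line are approached through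
  the intervals [-n, n].\<close>

lemma gaussian_rational_tendsto_0:
  assumes "gaussian_rational a f" "0 < a"
  shows "(\<lambda>n. f (real n)) \<longlonglongrightarrow> 0" "(\<lambda>n. f (- real n)) \<longlonglongrightarrow> 0"
proof -
  obtain C where C: "0 \<le> C" "\<And>y. \<bar>f y\<bar> * exp (1 * \<bar>y\<bar>) \<le> C * exp (- (a / 2) * y\<^sup>2)"
    using gaussian_rational_le[OF assms] by blast
  have *: "\<bar>f y\<bar> \<le> C * exp (- \<bar>y\<bar>)" for y
  proof -
    have "C * exp (- (a / 2) * y\<^sup>2) \<le> C"
      using C(1) assms(2) by (intro mult_left_le) auto
    with C(2)[of y] have "\<bar>f y\<bar> * exp \<bar>y\<bar> \<le> C" by simp
    then show ?thesis by (simp add: exp_minus field_simps)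
  qed
  have "(\<lambda>n. C * exp (- real n)) \<longlonglongrightarrow> C * 0"
    by (intro tendsto_mult tendsto_const filterlim_compose[OF exp_at_bot]
      filterlim_compose[OF filterlim_uminus_at_bot_at_top] filterlim_real_sequentially)
  then have lim: "(\<lambda>n. C * exp (- real n)) \<longlonglongrightarrow> 0" by simp
  show "(\<lambda>n. f (real n)) \<longlonglongrightarrow> 0"
    by (rule Lim_null_comparison[OF _ lim]) (use *[of "real _"] in auto)
  show "(\<lambda>n. f (- real n)) \<longlonglongrightarrow> 0"
    by (rule Lim_null_comparison[OF _ lim]) (use *[of "- real _"] in auto)
qed

text \<open>Every integration by parts below takes this form: an antiderivative inside the class is
  exhibited, and its boundary values vanish at both ends.\<close>

lemma gaussian_rational_integral_derivative:
  assumes "gaussian_rational a F" "gaussian_rational a f" "0 < a"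
    and F: "\<And>y. (F has_real_derivative f y) (at y)"
  shows "(\<integral>y. f y \<partial>lborel) = 0"
proof -
  have cont: "continuous_on A f" for A
    using gaussian_rational_continuous[OF assms(2)] .
  note [measurable] = gaussian_rational_measurable[OF assms(2)]
  have "(\<lambda>n. \<integral>y. indicator {- real n..real n} y *\<^sub>R f y \<partial>lborel) \<longlonglongrightarrow> (\<integral>y. f y \<partial>lborel)"
  proof (rule integral_dominated_convergence[where w="\<lambda>y. \<bar>f y\<bar>"])
    show "integrable lborel (\<lambda>y. \<bar>f y\<bar>)"
      using gaussian_rational_integrable[OF assms(2,3)] by simp
    show "AE y in lborel. (\<lambda>n. indicator {- real n..real n} y *\<^sub>R f y) \<longlonglongrightarrow> f y"
    proof (rule AE_I2)
      fix y :: real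
      obtain N :: nat where N: "\<bar>y\<bar> \<le> real N" using real_arch_simple by blast
      have "eventually (\<lambda>n. indicator {- real n..real n} y *\<^sub>R f y = f y) sequentially"
        using eventually_ge_at_top[of N]
      proof eventually_elim
        case (elim n)
        then have "\<bar>y\<bar> \<le> real n" using N by linarith
        then show ?case by (simp add: indicator_def abs_le_iff)
      qed
      then show "(\<lambda>n. indicator {- real n..real n} y *\<^sub>R f y) \<longlonglongrightarrow> f y"
        by (rule tendsto_eventually)
    qed
  qed (auto split: split_indicator)
  moreover have "(\<integral>y. indicator {- real n..real n} y *\<^sub>R f y \<partial>lborel) = F (real n) - F (- real n)" for n
    by (rule integral_FTC_Icc)
      (auto intro!: cont F[unfolded has_real_derivative_iff_has_vector_derivative, THEN has_vector_derivative_at_within])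
  ultimately have "(\<lambda>n. F (real n) - F (- real n)) \<longlonglongrightarrow> (\<integral>y. f y \<partial>lborel)"
    by simp
  moreover have "(\<lambda>n. F (real n) - F (- real n)) \<longlonglongrightarrow> 0 - 0"
    by (intro tendsto_diff gaussian_rational_tendsto_0[OF assms(1,3)])
  ultimately show ?thesis
    using LIMSEQ_unique by fastforce
qed

text \<open>F(x) is the integral of f over the half line left of x. This is the source of pointwise
  bounds on eigenfunctions.\<close>

lemma gaussian_rational_le_integral_derivative:
  assumes "gaussian_rational a F" "gaussian_rational a f" "0 < a"
    and F: "\<And>y. (F has_real_derivative f y) (at y)"
  shows "F x \<le> (\<integral>y. \<bar>f y\<bar> \<partial>lborel)"
proof -
  have cont: "continuous_on A f" for A
    using gaussian_rational_continuous[OF assms(2)] .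
  have int: "integrable lborel (\<lambda>y. \<bar>f y\<bar>)"
    using gaussian_rational_integrable[OF assms(2,3)] by simp
  have "(\<lambda>n. F x - F (- real n)) \<longlonglongrightarrow> F x - 0"
    by (intro tendsto_diff tendsto_const gaussian_rational_tendsto_0[OF assms(1,3)])
  moreover obtain N :: nat where N: "- x \<le> real N" using real_arch_simple by blast
  have "F x - F (- real n) \<le> (\<integral>y. \<bar>f y\<bar> \<partial>lborel)" if "N \<le> n" for n
  proof -
    have "- real n \<le> x" using N that by linarith
    then have *: "has_bochner_integral lborel (\<lambda>y. indicator {- real n..x} y *\<^sub>R f y) (F x - F (- real n))"
      by (rule has_bochner_integral_FTC_Icc)
        (auto intro!: cont F[unfolded has_real_derivative_iff_has_vector_derivative, THEN has_vector_derivative_at_within])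
    have "(\<integral>y. indicator {- real n..x} y *\<^sub>R f y \<partial>lborel) \<le> (\<integral>y. \<bar>f y\<bar> \<partial>lborel)"
      using * by (intro integral_mono int) (auto simp: has_bochner_integral_iff split: split_indicator)
    with * show ?thesis by (simp add: has_bochner_integral_iff)
  qed
  ultimately show ?thesis
    by (intro LIMSEQ_le_const2[of "\<lambda>n. F x - F (- real n)"]) auto
qed

section \<open>Eigenfunctions of the Darboux transform\<close>

definition hermite_fun :: "nat \<Rightarrow> real \<Rightarrow> real" where
  "hermite_fun n y = exp (- (1 / 2) * y\<^sup>2) * poly (hpoly n) y"

definition log_seed' :: "real \<Rightarrow> real" where
  "log_seed' y = y + 4 * y / seed_poly y"

text \<open>The cubic is d' + 2 y d for d = 2 y^2 + 1. It arises from h f' - h' f with h = e^(y^2/2)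
  d and f = e^(-y^2/2) H, where the exponentials cancel and each contributes one y d.\<close>

fun base_poly :: "nat \<Rightarrow> real poly" where
  "base_poly 0 = 1"
| "base_poly (Suc n) = [:1, 0, 2:] * pderiv (hpoly n) - [:0, 6, 0, 4:] * hpoly n"

text \<open>Index \<open>0\<close> is the ground state \<open>1/h\<close>, index \<open>n + 1\<close> is \<open>Q\<^sub>n/h\<close>.\<close>
definition eigfun :: "nat \<Rightarrow> real \<Rightarrow> real" where
  "eigfun k y = poly (base_poly k) y / seed y"

text \<open>
  The oscillator energies of \<open>h\<close> and \<open>f\<^sub>n\<close> are \<open>-5/2\<close> and \<open>n + 1/2\<close>; the gap is twice their difference.
  The killing rate is the Darboux potential \<open>y\<^sup>2/2 - (log h)''\<close> raised by \<open>5\<close>, which explains \<open>eigval\<close>.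
\<close>
fun gap :: "nat \<Rightarrow> real" where
  "gap 0 = 0"
| "gap (Suc n) = 2 * real n + 6"

definition eigval :: "nat \<Rightarrow> real" where
  "eigval k = (gap k + 5) / 2"

text \<open>Squared L2 norms of \<open>eigfun\<close>. For positive index this is the squared norm
  2^n n! sqrt(pi) of the oscillator function times the energy gap, as usual for a Darboux
  transform.\<close>

fun norm2 :: "nat \<Rightarrow> real" where
  "norm2 0 = sqrt pi / 2"
| "norm2 (Suc n) = gap (Suc n) * (2 ^ n * fact n * sqrt pi)"

lemma poly_seed_poly: "poly [:1, 0, 2:] y = seed_poly y"
  by (simp add: seed_poly_def power2_eq_square)

lemma seed_altdef: "seed y = exp (y\<^sup>2 / 2) * seed_poly y"
  by (simp add: seed_def seed_poly_def)

lemma seed_pos: "0 < seed y"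
  by (simp add: seed_altdef seed_poly_pos)

lemma Q_poly: "Q n y = poly (base_poly (Suc n)) y"
  unfolding Q_def hermite_poly base_poly.simps poly_diff poly_mult pderiv_hpoly poly_smult poly_seed_poly
  by (simp add: seed_poly_def algebra_simps power3_eq_cube)

lemma gap_nonneg: "0 \<le> gap k"
  by (cases k) auto

lemma eigval_pos: "0 < eigval k"
  using gap_nonneg[of k] by (simp add: eigval_def)

lemma eigval_inject: "eigval j = eigval k \<longleftrightarrow> j = k"
  by (cases j; cases k) (auto simp: eigval_def)

lemma norm2_pos: "0 < norm2 k"
  by (cases k) (auto intro!: mult_pos_pos)

lemma eigfun_altdef: "eigfun k y = poly (base_poly k) y * exp (- (1 / 2) * y\<^sup>2) / seed_poly y"
  by (simp add: eigfun_def seed_altdef exp_minus field_simps)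

lemma gaussian_rational_eigfun: "gaussian_rational (1 / 2) (eigfun k)"
  by (rule gaussian_rationalI[of _ "base_poly k" _ 1]) (simp add: eigfun_altdef)

lemma gaussian_rational_hermite_fun: "gaussian_rational (1 / 2) (hermite_fun n)"
  by (rule gaussian_rationalI[of _ "hpoly n" _ 0]) (simp add: hermite_fun_def)

lemma log_seed'_rational: "log_seed' y = poly [:0, 5, 0, 2:] y / seed_poly y ^ 1"
proof -
  have "poly [:0, 5, 0, 2:] y = y * seed_poly y + 4 * y"
    by (simp add: seed_poly_def algebra_simps power2_eq_square)
  then show ?thesis
    by (simp add: log_seed'_def add_divide_distrib)
qed

text \<open>With w = h'/h and h'' = (y^2 + 5) h one has (log h)'' = y^2 + 5 - w^2, so the Darboux
  potential y^2/2 - (log h)'' raised by 5 is w^2 - y^2/2.\<close>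

lemma ctilde_log_seed': "ctilde y = (log_seed' y)\<^sup>2 - y\<^sup>2 / 2"
proof -
  have "ctilde y = y\<^sup>2 / 2 + 8 * y\<^sup>2 * (seed_poly y + 2) / (seed_poly y)\<^sup>2"
    by (simp add: ctilde_def seed_poly_def)
  also have "\<dots> = (log_seed' y)\<^sup>2 - y\<^sup>2 / 2"
    by (simp add: log_seed'_def field_simps power2_eq_square)
  finally show ?thesis .
qed

lemma ctilde_rational: "ctilde y = poly [:0, 0, 49 / 2, 0, 18, 0, 2:] y / seed_poly y ^ 2"
proof -
  have "poly [:0, 0, 49 / 2, 0, 18, 0, 2:] y = y\<^sup>2 / 2 * (seed_poly y)\<^sup>2 + 8 * y\<^sup>2 * (2 * y\<^sup>2 + 3)"
    by (simp add: seed_poly_def algebra_simps power2_eq_square)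
  then show ?thesis
    by (simp add: ctilde_def add_divide_distrib seed_poly_def[symmetric])
qed

lemma ctilde_nonneg: "0 \<le> ctilde y"
  by (simp add: ctilde_def)

lemma continuous_on_ctilde: "continuous_on A ctilde"
proof -
  have "isCont (\<lambda>y. poly [:0, 0, 49 / 2, 0, 18, 0, 2:] y / seed_poly y ^ 2) y" for y
    by (intro continuous_intros DERIV_isCont[OF DERIV_seed_poly]) auto
  then show ?thesis
    unfolding ctilde_rational[abs_def] by (intro continuous_at_imp_continuous_on ballI)
qed

text \<open>The Riccati form of h'' = (y^2 + 5) h, which says that h is a formal oscillator
  eigenfunction of energy -5/2.\<close>

lemma DERIV_log_seed': "(log_seed' has_real_derivative y\<^sup>2 + 5 - (log_seed' y)\<^sup>2) (at y)"
proof -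
  have "((\<lambda>y. y + 4 * y / seed_poly y) has_real_derivative 1 + (4 * seed_poly y - 4 * y * (4 * y)) / (seed_poly y * seed_poly y)) (at y)"
    by (auto intro!: derivative_eq_intros DERIV_seed_poly)
  moreover have "1 + (4 * seed_poly y - 4 * y * (4 * y)) / (seed_poly y * seed_poly y) = y\<^sup>2 + 5 - (log_seed' y)\<^sup>2"
  proof -
    \<comment> \<open>In terms of the reciprocal \<open>u\<close> the claim is a polynomial identity
      modulo the relations \<open>seed_poly y * u = 1\<close> and 2 y^2 u = 1 - u.\<close>
    define u where "u = 1 / seed_poly y"
    have u: "seed_poly y * u = 1" by (simp add: u_def)
    have "2 * (y * y) * u = (seed_poly y - 1) * u"
      by (simp add: seed_poly_def power2_eq_square)
    then have "2 * (y * y) * u = 1 - u"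
      by (simp add: left_diff_distrib u)
    then have "y * y + 5 - (y + 4 * y * u) * (y + 4 * y * u) = 1 + (4 * seed_poly y - 4 * y * (4 * y)) * (u * u)"
      using u by algebra
    then show ?thesis
      by (simp add: log_seed'_def u_def power2_eq_square)
  qed
  ultimately show ?thesis
    unfolding log_seed'_def[abs_def, symmetric] by (simp only:)
qed

text \<open>Hermite's differential equation, from H_n' = 2 n H_{n-1} and the recursion.\<close>

lemma pderiv_pderiv_hpoly:
  "poly (pderiv (pderiv (hpoly n))) y = 2 * y * poly (pderiv (hpoly n)) y - 2 * real n * poly (hpoly n) y"
proof (cases n)
  case (Suc m)
  have "pderiv (hpoly m) = [:0, 2:] * hpoly m - hpoly (Suc m)"
    by simp
  from arg_cong[OF this, of "\<lambda>p. poly p y"]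
  have *: "poly (pderiv (hpoly m)) y = 2 * y * poly (hpoly m) y - poly (hpoly (Suc m)) y"
    by (simp del: hpoly.simps)
  show ?thesis
    unfolding Suc pderiv_hpoly_Suc pderiv_smult poly_smult * by (simp only: algebra_simps)
qed simp

text \<open>This is f_n' - w f_n = Q_n/h, the Darboux transform itself, in the form of a derivative
  rule for f_n.\<close>

lemma DERIV_hermite_fun:
  "(hermite_fun n has_real_derivative eigfun (Suc n) y + log_seed' y * hermite_fun n y) (at y)"
proof -
  have "(hermite_fun n has_real_derivative exp (- (1 / 2) * y\<^sup>2) *
      (poly (pderiv (hpoly n)) y - y * poly (hpoly n) y)) (at y)"
    unfolding hermite_fun_def[abs_def]
    by (auto intro!: derivative_eq_intros simp: algebra_simps)
  moreover have "poly (base_poly (Suc n)) y + (y * seed_poly y + 4 * y) * poly (hpoly n) y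
      = seed_poly y * (poly (pderiv (hpoly n)) y - y * poly (hpoly n) y)"
    unfolding base_poly.simps poly_diff poly_mult poly_seed_poly
    by (simp add: seed_poly_def algebra_simps power2_eq_square)
  then have "exp (- (1 / 2) * y\<^sup>2) * (poly (pderiv (hpoly n)) y - y * poly (hpoly n) y) =
      exp (- (1 / 2) * y\<^sup>2) * (poly (base_poly (Suc n)) y + (y * seed_poly y + 4 * y) * poly (hpoly n) y) / seed_poly y"
    by simp
  then have "exp (- (1 / 2) * y\<^sup>2) * (poly (pderiv (hpoly n)) y - y * poly (hpoly n) y) =
      eigfun (Suc n) y + log_seed' y * hermite_fun n y"
    by (simp add: eigfun_altdef hermite_fun_def log_seed'_def field_simps del: base_poly.simps)
  ultimately show ?thesis by simp
qed

text \<open>For \<open>k = 0\<close> the truncated index \<open>k - 1\<close> is harmless because \<open>gap 0 = 0\<close>.\<close>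
definition eigfun' :: "nat \<Rightarrow> real \<Rightarrow> real" where
  "eigfun' k y = - log_seed' y * eigfun k y - gap k * hermite_fun (k - 1) y"

text \<open>Since f_n'' = (y^2 - 2 n - 1) f_n and w' + w^2 = y^2 + 5, the function u = f_n' - w f_n
  satisfies u' + w u = f_n'' - (w' + w^2) f_n = -(2 n + 6) f_n. The ground state 1/h solves u' = -w
  u. With the rule for f_n' this yields a first-order system, which replaces second-order
  computations.\<close>

lemma DERIV_eigfun: "(eigfun k has_real_derivative eigfun' k y) (at y)"
proof (cases k)
  case 0
  have "((\<lambda>y. exp (- (1 / 2) * y\<^sup>2) / seed_poly y) has_real_derivative
      (exp (- (1 / 2) * y\<^sup>2) * (- y) * seed_poly y - exp (- (1 / 2) * y\<^sup>2) * (4 * y)) / (seed_poly y * seed_poly y)) (at y)"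
    by (auto intro!: derivative_eq_intros DERIV_seed_poly)
  then show ?thesis
    unfolding 0 eigfun_altdef[abs_def] eigfun'_def log_seed'_def
    by (simp, elim DERIV_cong) (simp add: field_simps)
next
  case (Suc n)
  define E H H1 H2 where "E = exp (- (1 / 2) * y\<^sup>2)" and "H = poly (hpoly n) y"
    and "H1 = poly (pderiv (hpoly n)) y" and "H2 = poly (pderiv (pderiv (hpoly n))) y"
  have H2: "H2 = 2 * y * H1 - 2 * real n * H"
    unfolding H2_def H1_def H_def by (rule pderiv_pderiv_hpoly)
  \<comment> \<open>Two expressions for the derivative of \<open>hermite_fun n\<close> must agree.
    This writes the eigenfunction without a quotient, ready to be differentiated.\<close>
  have eig: "eigfun (Suc n) = (\<lambda>y. exp (- (1 / 2) * y\<^sup>2) *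
      (poly (pderiv (hpoly n)) y - y * poly (hpoly n) y) - log_seed' y * hermite_fun n y)"
  proof
    fix y
    have "(hermite_fun n has_real_derivative exp (- (1 / 2) * y\<^sup>2) *
        (poly (pderiv (hpoly n)) y - y * poly (hpoly n) y)) (at y)"
      unfolding hermite_fun_def[abs_def]
      by (auto intro!: derivative_eq_intros simp: algebra_simps)
    from DERIV_unique[OF this DERIV_hermite_fun]
    show "eigfun (Suc n) y = exp (- (1 / 2) * y\<^sup>2) *
      (poly (pderiv (hpoly n)) y - y * poly (hpoly n) y) - log_seed' y * hermite_fun n y"
      by simp
  qed
  have "((\<lambda>y. exp (- (1 / 2) * y\<^sup>2) *
      (poly (pderiv (hpoly n)) y - y * poly (hpoly n) y) - log_seed' y * hermite_fun n y) has_real_derivative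
     E * (H2 - H - 2 * y * H1 + y\<^sup>2 * H) -
     ((y\<^sup>2 + 5 - (log_seed' y)\<^sup>2) * hermite_fun n y
       + log_seed' y * (eigfun (Suc n) y + log_seed' y * hermite_fun n y))) (at y)"
    unfolding E_def H_def H1_def H2_def
    by (auto intro!: derivative_eq_intros DERIV_log_seed' DERIV_hermite_fun simp: algebra_simps power2_eq_square)
  moreover have "hermite_fun n y = E * H"
    by (simp add: hermite_fun_def E_def H_def)
  ultimately show ?thesis
    unfolding Suc by (subst eig, simp add: eigfun'_def H2 algebra_simps power2_eq_square)
qed

text \<open>The first-order system is differentiated once more; the Riccati equation for w turns the
  terms in w into \<open>ctilde\<close>.\<close>

lemma DERIV_eigfun':
  "(eigfun' k has_real_derivative 2 * (ctilde y - eigval k) * eigfun k y) (at y)"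
proof -
  have "(eigfun' k has_real_derivative
     - (y\<^sup>2 + 5 - (log_seed' y)\<^sup>2) * eigfun k y - log_seed' y * eigfun' k y
      - gap k * (eigfun (Suc (k - 1)) y + log_seed' y * hermite_fun (k - 1) y)) (at y)"
    unfolding eigfun'_def[of k, abs_def]
    by (auto intro!: derivative_eq_intros DERIV_log_seed' DERIV_eigfun DERIV_hermite_fun
        simp: algebra_simps eigfun'_def)
  moreover have *: "gap k * eigfun (Suc (k - 1)) y = gap k * eigfun k y"
    by (cases k) auto
  have "- (y\<^sup>2 + 5 - (log_seed' y)\<^sup>2) * eigfun k y - log_seed' y * eigfun' k y
      - gap k * (eigfun (Suc (k - 1)) y + log_seed' y * hermite_fun (k - 1) y) =
      2 * (ctilde y - eigval k) * eigfun k y"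
    unfolding distrib_left * by (simp add: eigfun'_def ctilde_log_seed' eigval_def field_simps power2_eq_square)
  ultimately show ?thesis
    by simp
qed

lemma gaussian_rational_eigfun': "gaussian_rational (1 / 2) (eigfun' k)"
proof -
  have "gaussian_rational (1 / 2) (\<lambda>y. (-1) * (poly [:0, 5, 0, 2:] y / seed_poly y ^ 1 * eigfun k y) -
      gap k * hermite_fun (k - 1) y)"
    by (intro gaussian_rational_diff gaussian_rational_cmult gaussian_rational_mult_rational
        gaussian_rational_eigfun gaussian_rational_hermite_fun)
  then show ?thesis
    unfolding eigfun'_def[abs_def] log_seed'_rational by simp
qed

lemma gaussian_rational_ctilde_mult:
  "gaussian_rational a f \<Longrightarrow> gaussian_rational a (\<lambda>y. ctilde y * f y)"
  unfolding ctilde_rational by (rule gaussian_rational_mult_rational)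

lemma gaussian_rational_mult_half:
  "gaussian_rational (1 / 2) f \<Longrightarrow> gaussian_rational (1 / 2) g \<Longrightarrow> gaussian_rational 1 (\<lambda>y. f y * g y)"
  using gaussian_rational_mult[of "1 / 2" f "1 / 2" g] by simp

lemma gaussian_rational_eigfun'':
  "gaussian_rational (1 / 2) (\<lambda>y. 2 * (ctilde y - eigval k) * eigfun k y)"
  using gaussian_rational_diff[OF gaussian_rational_cmult[OF gaussian_rational_ctilde_mult[OF gaussian_rational_eigfun], of 2]
      gaussian_rational_cmult[OF gaussian_rational_eigfun, of "2 * eigval k"], of k k]
  by (simp add: algebra_simps)

section \<open>Orthogonality, norms and pointwise bounds of the eigenfunctions\<close>

lemma integrable_eigfun_mult: "integrable lborel (\<lambda>y. eigfun j y * eigfun k y)"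
  by (intro gaussian_rational_integrable[OF gaussian_rational_mult_half] gaussian_rational_eigfun) simp

lemma integral_eigfun_orthogonal:
  assumes "j \<noteq> k" shows "(\<integral>y. eigfun j y * eigfun k y \<partial>lborel) = 0"
proof -
  have "(\<integral>y. 2 * (eigval k - eigval j) * (eigfun j y * eigfun k y) \<partial>lborel) = 0"
  proof (rule gaussian_rational_integral_derivative[of 1])
    show "((\<lambda>y. eigfun' j y * eigfun k y - eigfun j y * eigfun' k y) has_real_derivative
        2 * (eigval k - eigval j) * (eigfun j y * eigfun k y)) (at y)" for y
      by (auto intro!: derivative_eq_intros DERIV_eigfun DERIV_eigfun' simp: algebra_simps)
  qed (intro gaussian_rational_diff gaussian_rational_cmult gaussian_rational_mult_half
      gaussian_rational_eigfun gaussian_rational_eigfun' | simp)+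
  then show ?thesis
    using assms by (simp add: eigval_inject)
qed

lemma integral_gaussian: "(\<integral>y. exp (- y\<^sup>2) \<partial>(lborel :: real measure)) = sqrt pi"
proof -
  have "(\<integral>y. sqrt pi * normal_density 0 (sqrt (1 / 2)) y \<partial>lborel) = sqrt pi"
    by simp
  also have "(\<lambda>y::real. sqrt pi * normal_density 0 (sqrt (1 / 2)) y) = (\<lambda>y. exp (- y\<^sup>2))"
    by (simp add: normal_density_def fun_eq_iff)
  finally show ?thesis .
qed

text \<open>The product f_{n+1} f_n has derivative 2 (n + 1) f_n^2 - f_{n+1}^2, whose integral
  vanishes; so each squared norm is 2 (n + 1) times the previous one.\<close>

lemma integral_hermite_fun_sq: "(\<integral>y. (hermite_fun n y)\<^sup>2 \<partial>lborel) = 2 ^ n * fact n * sqrt pi"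
proof (induction n)
  case 0
  show ?case
    using integral_gaussian by (simp add: hermite_fun_def exp_double[symmetric] power2_eq_square exp_add[symmetric])
next
  case (Suc n)
  let ?h = hermite_fun
  have int: "integrable lborel (\<lambda>y. (?h k y)\<^sup>2)" for k
    unfolding power2_eq_square
    by (intro gaussian_rational_integrable[OF gaussian_rational_mult_half] gaussian_rational_hermite_fun) simp
  have "(\<integral>y. 2 * real (Suc n) * (?h n y)\<^sup>2 - (?h (Suc n) y)\<^sup>2 \<partial>lborel) = 0"
  proof (rule gaussian_rational_integral_derivative[of 1])
    fix y :: real
    have *: "poly (hpoly (Suc n)) y = 2 * y * poly (hpoly n) y - poly (pderiv (hpoly n)) y"
      by (simp add: algebra_simps)
    have E: "exp (- (1 / 2) * y\<^sup>2) * exp (- (1 / 2) * y\<^sup>2) = exp (- y\<^sup>2)" for y :: real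
      by (simp add: exp_add[symmetric])
    have "((\<lambda>y. poly (hpoly (Suc n)) y * poly (hpoly n) y * exp (- y\<^sup>2)) has_real_derivative
        (2 * real (Suc n) * (poly (hpoly n) y)\<^sup>2 - (poly (hpoly (Suc n)) y)\<^sup>2) * exp (- y\<^sup>2)) (at y)"
    proof -
      have "((\<lambda>y. poly (hpoly (Suc n)) y * poly (hpoly n) y * exp (- y\<^sup>2)) has_real_derivative
        (poly (pderiv (hpoly (Suc n))) y * poly (hpoly n) y + poly (hpoly (Suc n)) y *
          (poly (pderiv (hpoly n)) y - 2 * y * poly (hpoly n) y)) * exp (- y\<^sup>2)) (at y)"
        by (auto intro!: derivative_eq_intros simp: algebra_simps simp del: hpoly.simps)
      also have "poly (pderiv (hpoly n)) y - 2 * y * poly (hpoly n) y = - poly (hpoly (Suc n)) y"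
        unfolding * by simp
      finally show ?thesis
        unfolding pderiv_hpoly_Suc by (simp add: power2_eq_square algebra_simps del: hpoly.simps)
    qed
    moreover have "(\<lambda>y. poly (hpoly (Suc n)) y * poly (hpoly n) y * exp (- y\<^sup>2)) = (\<lambda>y. ?h (Suc n) y * ?h n y)"
      unfolding hermite_fun_def E[symmetric] by (simp add: mult_ac del: hpoly.simps)
    moreover have "(2 * real (Suc n) * (poly (hpoly n) y)\<^sup>2 - (poly (hpoly (Suc n)) y)\<^sup>2) * exp (- y\<^sup>2) =
        2 * real (Suc n) * (?h n y)\<^sup>2 - (?h (Suc n) y)\<^sup>2"
      unfolding hermite_fun_def E[symmetric] by (simp add: power2_eq_square algebra_simps del: hpoly.simps)
    ultimately show "((\<lambda>y. ?h (Suc n) y * ?h n y) has_real_derivative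
        2 * real (Suc n) * (?h n y)\<^sup>2 - (?h (Suc n) y)\<^sup>2) (at y)"
      by simp
  qed (unfold power2_eq_square, (intro gaussian_rational_diff gaussian_rational_cmult
      gaussian_rational_mult_half gaussian_rational_hermite_fun | simp)+)
  then have "(\<integral>y. (?h (Suc n) y)\<^sup>2 \<partial>lborel) = 2 * real (Suc n) * (\<integral>y. (?h n y)\<^sup>2 \<partial>lborel)"
    using int by simp
  then show ?case
    unfolding Suc.IH by simp
qed

text \<open>For the ground state, y e^(-y^2)/d is an antiderivative of 2/h^2 - e^(-y^2). For the
  others, writing u for Q_n/h, the first-order system gives (f_n u)' = u^2 - gap f_n^2, as the terms
  in w cancel.\<close>

lemma integral_eigfun_sq: "(\<integral>y. (eigfun k y)\<^sup>2 \<partial>lborel) = norm2 k"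
proof (cases k)
  case 0
  have E: "exp (- y\<^sup>2) = exp (- (1 / 2) * y\<^sup>2) * exp (- (1 / 2) * y\<^sup>2)" for y :: real
    by (simp add: exp_add[symmetric])
  have "(\<integral>y. 2 * (eigfun 0 y)\<^sup>2 - exp (- y\<^sup>2) \<partial>lborel) = 0"
  proof (rule gaussian_rational_integral_derivative[of 1])
    show "gaussian_rational 1 (\<lambda>y. y * exp (- y\<^sup>2) / seed_poly y)"
      by (rule gaussian_rationalI[of _ "[:0, 1:]" _ 1]) simp
    have "gaussian_rational 1 (\<lambda>y. exp (- y\<^sup>2))"
      by (rule gaussian_rationalI[of _ "1" _ 0]) simp
    then show "gaussian_rational 1 (\<lambda>y. 2 * (eigfun 0 y)\<^sup>2 - exp (- y\<^sup>2))"
      unfolding power2_eq_square[of "eigfun 0 _"]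
      by (intro gaussian_rational_diff gaussian_rational_cmult gaussian_rational_mult_half gaussian_rational_eigfun)
    fix y :: real
    have "((\<lambda>y. y * exp (- y\<^sup>2) / seed_poly y) has_real_derivative
        ((exp (- y\<^sup>2) + y * (exp (- y\<^sup>2) * (- (2 * y)))) * seed_poly y - y * exp (- y\<^sup>2) * (4 * y)) / (seed_poly y * seed_poly y)) (at y)"
      by (auto intro!: derivative_eq_intros DERIV_seed_poly)
    also have "((exp (- y\<^sup>2) + y * (exp (- y\<^sup>2) * (- (2 * y)))) * seed_poly y - y * exp (- y\<^sup>2) * (4 * y)) / (seed_poly y * seed_poly y)
        = exp (- y\<^sup>2) * (seed_poly y - 2 * y\<^sup>2 * seed_poly y - 4 * y\<^sup>2) / (seed_poly y * seed_poly y)"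
      by (simp add: power2_eq_square algebra_simps)
    also have "seed_poly y - 2 * y\<^sup>2 * seed_poly y - 4 * y\<^sup>2 = 2 - seed_poly y * seed_poly y"
      by (simp add: seed_poly_def algebra_simps)
    also have "exp (- y\<^sup>2) * (2 - seed_poly y * seed_poly y) / (seed_poly y * seed_poly y) = 2 * (eigfun 0 y)\<^sup>2 - exp (- y\<^sup>2)"
      unfolding E by (simp add: eigfun_altdef power2_eq_square field_simps)
    finally show "((\<lambda>y. y * exp (- y\<^sup>2) / seed_poly y) has_real_derivative 2 * (eigfun 0 y)\<^sup>2 - exp (- y\<^sup>2)) (at y)" .
  qed simp
  moreover have "integrable lborel (\<lambda>y. (eigfun 0 y)\<^sup>2)"
    using integrable_eigfun_mult[of 0 0] by (simp add: power2_eq_square)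
  ultimately show ?thesis
    using integrable_gaussian[of 1] integral_gaussian by (simp add: 0)
next
  case (Suc n)
  have "(\<integral>y. (eigfun (Suc n) y)\<^sup>2 - gap (Suc n) * (hermite_fun n y)\<^sup>2 \<partial>lborel) = 0"
  proof (rule gaussian_rational_integral_derivative[of 1])
    show "((\<lambda>y. hermite_fun n y * eigfun (Suc n) y) has_real_derivative
        (eigfun (Suc n) y)\<^sup>2 - gap (Suc n) * (hermite_fun n y)\<^sup>2) (at y)" for y
      by (auto intro!: derivative_eq_intros DERIV_eigfun DERIV_hermite_fun
          simp: algebra_simps eigfun'_def power2_eq_square simp del: gap.simps)
  qed (unfold power2_eq_square, (intro gaussian_rational_diff gaussian_rational_cmult
      gaussian_rational_mult_half gaussian_rational_hermite_fun gaussian_rational_eigfun | simp)+)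
  moreover have "integrable lborel (\<lambda>y. (hermite_fun n y)\<^sup>2)"
    unfolding power2_eq_square
    by (intro gaussian_rational_integrable[OF gaussian_rational_mult_half] gaussian_rational_hermite_fun) simp
  ultimately show ?thesis
    using integrable_eigfun_mult[of k k] by (simp add: Suc power2_eq_square[of "eigfun _ _"] integral_hermite_fun_sq)
qed

text \<open>
  Integrating \<open>(\<phi>\<^sup>2)' = 2\<phi>\<phi>'\<close> bounds \<open>\<phi>\<^sup>2\<close> by \<open>\<integral> \<phi>\<^sup>2 + \<phi>'\<^sup>2\<close>, and \<open>\<integral> \<phi>'\<^sup>2\<close> is at most \<open>2 eigval\<close> times \<open>\<integral> \<phi>\<^sup>2\<close> because the
  potential is nonnegative. This replaces pointwise estimates of Hermite polynomials.
\<close>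
lemma eigfun_sq_le: "(eigfun k x)\<^sup>2 \<le> (1 + 2 * eigval k) * norm2 k"
proof -
  note gr = gaussian_rational_mult_half gaussian_rational_eigfun gaussian_rational_eigfun'
  have int0: "integrable lborel (\<lambda>y. (eigfun k y)\<^sup>2)"
    using integrable_eigfun_mult[of k k] by (simp add: power2_eq_square)
  have int1: "integrable lborel (\<lambda>y. (eigfun' k y)\<^sup>2)"
    unfolding power2_eq_square by (intro gaussian_rational_integrable[of 1] gr) simp
  have int2: "integrable lborel (\<lambda>y. ctilde y * (eigfun k y)\<^sup>2)"
    unfolding power2_eq_square
    by (intro gaussian_rational_integrable[of 1] gaussian_rational_ctilde_mult gr) simp
  have "(\<integral>y. (eigfun' k y)\<^sup>2 + 2 * (ctilde y * (eigfun k y)\<^sup>2) - 2 * eigval k * (eigfun k y)\<^sup>2 \<partial>lborel) = 0"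
  proof (rule gaussian_rational_integral_derivative[of 1])
    show "((\<lambda>y. eigfun k y * eigfun' k y) has_real_derivative
        (eigfun' k y)\<^sup>2 + 2 * (ctilde y * (eigfun k y)\<^sup>2) - 2 * eigval k * (eigfun k y)\<^sup>2) (at y)" for y
      by (auto intro!: derivative_eq_intros DERIV_eigfun DERIV_eigfun' simp: algebra_simps power2_eq_square)
  qed (unfold power2_eq_square, (intro gaussian_rational_diff gaussian_rational_add gaussian_rational_cmult
      gaussian_rational_ctilde_mult gr | simp)+)
  then have "(\<integral>y. (eigfun' k y)\<^sup>2 \<partial>lborel) + 2 * (\<integral>y. ctilde y * (eigfun k y)\<^sup>2 \<partial>lborel) = 2 * eigval k * norm2 k"
    using int0 int1 int2 by (simp add: integral_eigfun_sq)
  moreover have "0 \<le> (\<integral>y. ctilde y * (eigfun k y)\<^sup>2 \<partial>lborel)"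
    by (intro Bochner_Integration.integral_nonneg) (simp add: ctilde_nonneg)
  ultimately have int1_le: "(\<integral>y. (eigfun' k y)\<^sup>2 \<partial>lborel) \<le> 2 * eigval k * norm2 k"
    by linarith
  have "(eigfun k x)\<^sup>2 \<le> (\<integral>y. \<bar>2 * (eigfun k y * eigfun' k y)\<bar> \<partial>lborel)"
  proof (rule gaussian_rational_le_integral_derivative[where a=1 and F="\<lambda>y. (eigfun k y)\<^sup>2"])
    show "((\<lambda>y. (eigfun k y)\<^sup>2) has_real_derivative 2 * (eigfun k y * eigfun' k y)) (at y)" for y
      by (auto intro!: derivative_eq_intros DERIV_eigfun)
  qed (unfold power2_eq_square, (intro gaussian_rational_cmult gr | simp)+)
  also have "\<dots> \<le> (\<integral>y. (eigfun k y)\<^sup>2 + (eigfun' k y)\<^sup>2 \<partial>lborel)"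
  proof (intro integral_mono)
    show "integrable lborel (\<lambda>y. \<bar>2 * (eigfun k y * eigfun' k y)\<bar>)"
      by (intro integrable_abs integrable_mult_right gaussian_rational_integrable[of 1] gr) simp
    show "\<bar>2 * (eigfun k y * eigfun' k y)\<bar> \<le> (eigfun k y)\<^sup>2 + (eigfun' k y)\<^sup>2" for y
      using sum_squares_bound[of "\<bar>eigfun k y\<bar>" "\<bar>eigfun' k y\<bar>"] by (simp add: abs_mult)
  qed (use int0 int1 in auto)
  also have "\<dots> \<le> (1 + 2 * eigval k) * norm2 k"
    using int0 int1 int1_le by (simp add: integral_eigfun_sq algebra_simps)
  finally show ?thesis .
qed

section \<open>Completeness\<close>

text \<open>The moments determine the Fourier transform of \<open>g\<close>, and Levy's theorem applies to its two signed parts.\<close>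
lemma AE_eq_0_if_moments_eq_0:
  fixes g :: "real \<Rightarrow> real"
  assumes int_exp: "\<And>b. integrable lborel (\<lambda>y. g y * exp (b * \<bar>y\<bar>))"
    and moments: "\<And>n. (\<integral>y. g y * y ^ n \<partial>lborel) = 0"
  shows "AE y in lborel. g y = 0"
proof -
  have int: "integrable lborel g"
    using int_exp[of 0] by simp
  then have meas [measurable]: "g \<in> borel_measurable borel"
    by (auto dest: borel_measurable_integrable)
  have int_pow: "integrable lborel (\<lambda>y. g y * y ^ n)" for n
  proof (rule Bochner_Integration.integrable_bound[OF integrable_mult_left[OF int_exp[of 1], of "fact n"]])
    have "\<bar>y\<bar> ^ n \<le> fact n * exp \<bar>y\<bar>" for y :: real
      by (rule power_le_fact_exp) simp
    from mult_left_mono[OF this abs_ge_zero[of "g _"]]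
    show "AE y in lborel. norm (g y * y ^ n) \<le> norm (g y * exp (1 * \<bar>y\<bar>) * fact n)"
      by (intro AE_I2) (simp add: abs_mult power_abs mult_ac)
  qed simp
  have fourier: "(\<integral>y. complex_of_real (g y) * iexp (s * y) \<partial>lborel) = 0" for s
  proof -
    let ?z = "\<lambda>y. \<i> * complex_of_real (s * y)"
    \<comment> \<open>Partial sums of the exponential series reduce the Fourier integral to moments;
      \<open>int_exp\<close> with exponent |s| supplies the dominating function.\<close>
    let ?S = "\<lambda>N y. complex_of_real (g y) * (\<Sum>n<N. ?z y ^ n /\<^sub>R fact n)"
    have S: "?S N y = (\<Sum>n<N. (\<i> * s) ^ n / fact n * complex_of_real (g y * y ^ n))" for N y
      by (simp add: sum_distrib_left power_mult_distrib scaleR_conv_of_real field_simps)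
    have "(\<lambda>N. \<integral>y. ?S N y \<partial>lborel) \<longlonglongrightarrow> (\<integral>y. complex_of_real (g y) * iexp (s * y) \<partial>lborel)"
    proof (rule integral_dominated_convergence[where w="\<lambda>y. \<bar>g y\<bar> * exp (\<bar>s\<bar> * \<bar>y\<bar>)"])
      show "integrable lborel (\<lambda>y. \<bar>g y\<bar> * exp (\<bar>s\<bar> * \<bar>y\<bar>))"
        using integrable_abs[OF int_exp[of "\<bar>s\<bar>"]] by (simp add: abs_mult)
      show "AE y in lborel. (\<lambda>N. ?S N y) \<longlonglongrightarrow> complex_of_real (g y) * iexp (s * y)"
        using exp_converges[of "?z _"] by (intro AE_I2 tendsto_mult tendsto_const) (simp add: sums_def)
      show "AE y in lborel. norm (?S N y) \<le> \<bar>g y\<bar> * exp (\<bar>s\<bar> * \<bar>y\<bar>)" for N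
      proof (rule AE_I2)
        fix y
        have "norm (\<Sum>n<N. ?z y ^ n /\<^sub>R fact n) \<le> (\<Sum>n<N. \<bar>s * y\<bar> ^ n /\<^sub>R fact n)"
          by (rule order_trans[OF norm_sum]) (simp add: norm_mult norm_power abs_mult)
        also have "\<dots> \<le> (\<Sum>n. \<bar>s * y\<bar> ^ n /\<^sub>R fact n)"
          by (intro sum_le_suminf summable_exp_generic) auto
        also have "\<dots> = exp (\<bar>s\<bar> * \<bar>y\<bar>)"
          by (simp add: exp_def abs_mult)
        finally show "norm (?S N y) \<le> \<bar>g y\<bar> * exp (\<bar>s\<bar> * \<bar>y\<bar>)"
          unfolding norm_mult norm_of_real by (intro mult_left_mono) simp_all
      qed
    qed simp_all
    moreover have "(\<integral>y. ?S N y \<partial>lborel) = 0" for N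
      unfolding S
      by (subst Bochner_Integration.integral_sum)
        (simp_all add: int_pow moments integrable_mult_right del: of_real_mult of_real_power)
    ultimately show ?thesis
      by (simp add: LIMSEQ_const_iff)
  qed
  define gp gm where "gp y = max 0 (g y)" and "gm y = max 0 (- g y)" for y
  have [measurable]: "gp \<in> borel_measurable borel" "gm \<in> borel_measurable borel"
    unfolding gp_def gm_def by measurable
  have gpm: "g y = gp y - gm y" "0 \<le> gp y" "0 \<le> gm y" for y
    by (auto simp: gp_def gm_def)
  have ip: "integrable lborel gp" and im: "integrable lborel gm"
    using int unfolding gp_def[abs_def] gm_def[abs_def] by (auto intro!: integrable_max)
  define m where "m = (\<integral>y. gp y \<partial>lborel)"
  have "(\<integral>y. g y \<partial>lborel) = 0"
    using moments[of 0] by simp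
  then have m2: "(\<integral>y. gm y \<partial>lborel) = m"
    unfolding gpm(1)[abs_def] m_def using ip im by simp
  \<comment> \<open>\<open>m\<close> is the common mass of the positive and negative parts. If it is
    positive, both can be normalised to probability measures, as Levy's uniqueness theorem
    requires.\<close>
  show ?thesis
  proof (cases "m = 0")
    case True
    have "AE y in lborel. gp y = 0" "AE y in lborel. gm y = 0"
      using integral_nonneg_eq_0_iff_AE[OF ip] integral_nonneg_eq_0_iff_AE[OF im] True m2 gpm
      by (auto simp: m_def)
    then show ?thesis by eventually_elim (simp add: gpm)
  next
    case False
    have "0 \<le> m" unfolding m_def by (intro Bochner_Integration.integral_nonneg gpm)
    with False have m: "0 < m" by simp
    define M1 M2 where "M1 = density lborel (\<lambda>y. ennreal (gp y / m))"
      and "M2 = density lborel (\<lambda>y. ennreal (gm y / m))"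
    have dist: "real_distribution (density lborel (\<lambda>y. ennreal (k y / m)))"
      if "integrable lborel k" "\<And>y. 0 \<le> k y" "(\<integral>y. k y \<partial>lborel) = m" for k :: "real \<Rightarrow> real"
    proof -
      have [measurable]: "k \<in> borel_measurable borel"
        using that(1) by (auto dest: borel_measurable_integrable)
      have "(\<integral>\<^sup>+y. ennreal (k y / m) \<partial>lborel) = 1"
        using that m by (subst nn_integral_eq_integral) auto
      then have "prob_space (density lborel (\<lambda>y. ennreal (k y / m)))"
        by (intro prob_spaceI) (simp add: emeasure_density)
      then show ?thesis
        by (simp add: real_distribution_def real_distribution_axioms_def)
    qed
    have "char M1 s = char M2 s" for s
    proof -
      have ch: "char (density lborel (\<lambda>y. ennreal (k y / m))) s =
          (\<integral>y. complex_of_real (k y) * iexp (s * y) \<partial>lborel) / m"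
        if "integrable lborel k" "\<And>y. 0 \<le> k y" for k :: "real \<Rightarrow> real"
      proof -
        have [measurable]: "k \<in> borel_measurable borel"
          using that(1) by (auto dest: borel_measurable_integrable)
        show ?thesis
          unfolding char_def using that m
          by (subst integral_density) (auto simp: scaleR_conv_of_real simp flip: integral_divide_zero)
      qed
      have ie: "integrable lborel (\<lambda>y. complex_of_real (k y) * iexp (s * y))"
        if "integrable lborel k" for k :: "real \<Rightarrow> real"
      proof -
        have [measurable]: "k \<in> borel_measurable borel"
          using that by (auto dest: borel_measurable_integrable)
        show ?thesis
          by (rule Bochner_Integration.integrable_bound[OF that]) (auto simp: norm_mult)
      qed
      have "(\<integral>y. complex_of_real (gp y) * iexp (s * y) - complex_of_real (gm y) * iexp (s * y) \<partial>lborel) = 0"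
        using fourier[of s] unfolding gpm(1) by (simp add: left_diff_distrib)
      then show ?thesis
        unfolding M1_def M2_def using ie[OF ip] ie[OF im]
        by (simp add: ch[OF ip gpm(2)] ch[OF im gpm(3)])
    qed
    then have "M1 = M2"
      unfolding M1_def M2_def
      by (intro Levy_uniqueness dist ip im m2 gpm m_def[symmetric] ext) auto
    then have "AE y in lborel. ennreal (gp y / m) = ennreal (gm y / m)"
      unfolding M1_def M2_def by (subst (asm) sigma_finite_measure.density_unique_iff[OF sigma_finite_lborel]) auto
    then show ?thesis
    proof eventually_elim
      case (elim y)
      then have "gp y / m = gm y / m"
        using m gpm(2,3)[of y] by (simp add: ennreal_inj)
      then show ?case
        using m gpm(1)[of y] by simp
    qed
  qed
qed

section \<open>Square-integrable functions and the Riesz-Fischer argument\<close>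

lemma abs_mult_le_sum_squares: "\<bar>a * b\<bar> \<le> a\<^sup>2 + (b :: real)\<^sup>2"
proof -
  have "2 * \<bar>a\<bar> * \<bar>b\<bar> \<le> \<bar>a\<bar>\<^sup>2 + \<bar>b\<bar>\<^sup>2"
    by (rule sum_squares_bound)
  moreover have "0 \<le> \<bar>a\<bar> * \<bar>b\<bar>"
    by simp
  ultimately have "\<bar>a\<bar> * \<bar>b\<bar> \<le> \<bar>a\<bar>\<^sup>2 + \<bar>b\<bar>\<^sup>2"
    by linarith
  then show ?thesis
    by (simp only: abs_mult power2_abs)
qed

lemma square_integrable_mult:
  assumes "square_integrable M f" "square_integrable M g"
  shows "integrable M (\<lambda>x. f x * g x)"
proof (rule Bochner_Integration.integrable_bound)
  show "integrable M (\<lambda>x. (f x)\<^sup>2 + (g x)\<^sup>2)"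
    using assms by (auto simp: square_integrable_def)
  show "(\<lambda>x. f x * g x) \<in> borel_measurable M"
    using assms by (auto simp: square_integrable_def)
  show "AE x in M. norm (f x * g x) \<le> norm ((f x)\<^sup>2 + (g x)\<^sup>2)"
    using abs_mult_le_sum_squares by (intro AE_I2) simp
qed

lemma square_integrable_cmult:
  "square_integrable M f \<Longrightarrow> square_integrable M (\<lambda>x. c * f x)"
  by (auto simp: square_integrable_def power_mult_distrib)

lemma square_integrable_add:
  assumes "square_integrable M f" "square_integrable M g"
  shows "square_integrable M (\<lambda>x. f x + g x)"
  using assms square_integrable_mult[OF assms]
  by (auto simp: square_integrable_def power2_sum mult.assoc)

lemma square_integrable_diff:
  assumes "square_integrable M f" "square_integrable M g"
  shows "square_integrable M (\<lambda>x. f x - g x)"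
  using square_integrable_add[OF assms(1) square_integrable_cmult[OF assms(2), of "-1"]] by simp

lemma square_integrable_sum:
  "(\<And>i. i \<in> A \<Longrightarrow> square_integrable M (f i)) \<Longrightarrow> square_integrable M (\<lambda>x. \<Sum>i\<in>A. f i x)"
proof (induction A rule: infinite_finite_induct)
  case (insert i A)
  then show ?case by (simp add: square_integrable_add)
qed (simp_all add: square_integrable_def)

lemma summable_subseq_tail_le:
  fixes c :: "nat \<Rightarrow> real"
  assumes "summable c" "\<And>k. 0 < (b k :: real)"
  obtains r where "mono r" "\<And>k. k \<le> r k" "\<And>k. \<bar>\<Sum>n\<in>{r k..<r (Suc k)}. c n\<bar> \<le> b k"
proof -
  have "\<forall>k. \<exists>N. \<forall>m\<ge>N. \<forall>n. norm (sum c {m..<n}) < b k"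
    using assms unfolding summable_Cauchy by blast
  then obtain N where N: "\<And>k m n. N k \<le> m \<Longrightarrow> norm (sum c {m..<n}) < b k"
    by metis
  \<comment> \<open>Adding up all Cauchy thresholds makes \<open>r\<close> monotone and at least the
    current threshold; the summand \<open>k\<close> makes it exceed every bound.\<close>
  define r where "r k = k + (\<Sum>j\<le>k. N j)" for k
  show ?thesis
  proof
    show "mono r"
      unfolding r_def mono_def by (auto intro!: add_mono sum_mono2)
    show "k \<le> r k" for k by (simp add: r_def)
    have "N k \<le> (\<Sum>j\<le>k. N j)" for k
      by (rule member_le_sum) auto
    then have "N k \<le> r k" for k
      by (simp add: r_def trans_le_add2)
    from N[OF this] show "\<bar>\<Sum>n\<in>{r k..<r (Suc k)}. c n\<bar> \<le> b k" for k
      by (simp add: less_imp_le)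
  qed
qed

lemma AE_summable_if_integrals_summable:
  fixes f :: "nat \<Rightarrow> 'a \<Rightarrow> real"
  assumes "\<And>k. integrable M (f k)" "\<And>k x. 0 \<le> f k x" "summable (\<lambda>k. \<integral>x. f k x \<partial>M)"
  shows "AE x in M. summable (\<lambda>k. f k x)" "integrable M (\<lambda>x. \<Sum>k. f k x)"
proof -
  note [measurable] = borel_measurable_integrable[OF assms(1)]
  have "(\<integral>\<^sup>+x. (\<Sum>k. ennreal (f k x)) \<partial>M) = (\<Sum>k. ennreal (\<integral>x. f k x \<partial>M))"
    using assms by (simp add: nn_integral_suminf nn_integral_eq_integral)
  also have "\<dots> \<noteq> \<infinity>"
    using assms by (simp add: suminf_ennreal2 integral_nonneg)
  finally have "AE x in M. (\<Sum>k. ennreal (f k x)) \<noteq> \<infinity>"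
    by (intro nn_integral_PInf_AE) auto
  then show *: "AE x in M. summable (\<lambda>k. f k x)"
    by eventually_elim (auto intro!: summable_suminf_not_top assms(2))
  show "integrable M (\<lambda>x. \<Sum>k. f k x)"
    using * assms by (intro integrable_suminf) auto
qed

text \<open>Cauchy-Schwarz with weights 2^(-k) and 2^k; the factor 2 is a generous bound for the
  geometric sum 4/3. The weight 4^k makes the right side control all partial sums of blocks at
  once.\<close>

lemma sum_squared_le_weighted:
  fixes v :: "nat \<Rightarrow> real"
  shows "(\<Sum>k<K. v k)\<^sup>2 \<le> 2 * (\<Sum>k<K. 4 ^ k * (v k)\<^sup>2)"
proof -
  have pow: "((1 / 2 :: real) ^ k)\<^sup>2 = (1 / 4) ^ k" "(2 ^ k :: real)\<^sup>2 = 4 ^ k" for k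
    by (simp_all only: power2_eq_square power_mult_distrib[symmetric]) simp_all
  have "(1 / 2) ^ k * (2 ^ k * v k) = v k" for k
    by (simp add: power_one_over)
  then have "(\<Sum>k<K. v k)\<^sup>2 = (\<Sum>k<K. (1 / 2) ^ k * (2 ^ k * v k))\<^sup>2"
    by (simp only:)
  also have "\<dots> \<le> (\<Sum>k<K. ((1 / 2) ^ k)\<^sup>2) * (\<Sum>k<K. (2 ^ k * v k)\<^sup>2)"
    by (rule Cauchy_Schwarz_ineq_sum)
  also have "\<dots> = (\<Sum>k<K. (1 / 4) ^ k) * (\<Sum>k<K. 4 ^ k * (v k)\<^sup>2)"
    unfolding power_mult_distrib pow ..
  also have "\<dots> \<le> 2 * (\<Sum>k<K. 4 ^ k * (v k)\<^sup>2)"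
  proof (rule mult_right_mono)
    have "(\<Sum>k<K. (1 / 4 :: real) ^ k) \<le> (\<Sum>k. (1 / 4) ^ k)"
      by (rule sum_le_suminf) (auto intro!: summable_geometric)
    also have "\<dots> \<le> 2"
      by (subst suminf_geometric) auto
    finally show "(\<Sum>k<K. (1 / 4 :: real) ^ k) \<le> 2" .
  qed (simp add: sum_nonneg)
  finally show ?thesis .
qed

text \<open>
  Riesz-Fischer by hand: along a subsequence the Fourier partial sums of \<open>f\<close> converge almost everywhere
  with a square-integrable bound \<open>G\<close>, and \<open>f\<close> minus their limit \<open>g\<close> is orthogonal to every \<open>u n\<close>.
\<close>
lemma orthonormal_sequence_approximates:
  fixes u :: "nat \<Rightarrow> 'a \<Rightarrow> real"
  assumes sq: "\<And>n. square_integrable M (u n)"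
    and orth: "\<And>m n. (\<integral>x. u m x * u n x \<partial>M) = (if m = n then 1 else 0)"
    and total: "\<And>g. square_integrable M g \<Longrightarrow> (\<And>n. (\<integral>x. g x * u n x \<partial>M) = 0) \<Longrightarrow> (\<integral>x. (g x)\<^sup>2 \<partial>M) = 0"
    and f: "square_integrable M f" and "0 < \<epsilon>"
  obtains c N where "(\<integral>x. (f x - (\<Sum>n<N. c n * u n x))\<^sup>2 \<partial>M) < \<epsilon>"
proof -
  define c where "c n = (\<integral>x. f x * u n x \<partial>M)" for n
  define S where "S A x = (\<Sum>n\<in>A. c n * u n x)" for A x
  have S_sq: "square_integrable M (S A)" for A
    unfolding S_def[abs_def] by (intro square_integrable_sum square_integrable_cmult sq)
  note [measurable] = S_sq[unfolded square_integrable_def, THEN conjunct1]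
    f[unfolded square_integrable_def, THEN conjunct1] sq[unfolded square_integrable_def, THEN conjunct1]
  have S_u: "(\<integral>x. S A x * u n x \<partial>M) = (if n \<in> A then c n else 0)" if "finite A" for A n
  proof -
    have "(\<integral>x. S A x * u n x \<partial>M) = (\<integral>x. (\<Sum>m\<in>A. c m * (u m x * u n x)) \<partial>M)"
      by (simp add: S_def sum_distrib_right mult.assoc)
    also have "\<dots> = (\<Sum>m\<in>A. c m * (if m = n then 1 else 0))"
      by (subst Bochner_Integration.integral_sum)
        (simp_all add: square_integrable_mult[OF sq sq] orth)
    finally show ?thesis
      using that by (simp add: sum.delta' if_distrib cong: if_cong)
  qed
  have S_g: "(\<integral>x. g x * S A x \<partial>M) = (\<Sum>n\<in>A. c n * (\<integral>x. g x * u n x \<partial>M))"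
    if "square_integrable M g" for g A
  proof -
    have "(\<integral>x. g x * S A x \<partial>M) = (\<integral>x. (\<Sum>n\<in>A. c n * (g x * u n x)) \<partial>M)"
      by (simp add: S_def sum_distrib_left mult_ac)
    also have "\<dots> = (\<Sum>n\<in>A. c n * (\<integral>x. g x * u n x \<partial>M))"
      by (subst Bochner_Integration.integral_sum)
        (simp_all add: square_integrable_mult[OF that sq])
    finally show ?thesis .
  qed
  have S_S: "(\<integral>x. (S A x)\<^sup>2 \<partial>M) = (\<Sum>n\<in>A. (c n)\<^sup>2)" if "finite A" for A
    unfolding power2_eq_square S_g[OF S_sq] using that by (intro sum.cong) (auto simp: S_u)
  have "0 \<le> (\<integral>x. (f x - S {..<N} x)\<^sup>2 \<partial>M)" for N
    by (intro Bochner_Integration.integral_nonneg) auto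
  moreover have "(\<integral>x. (f x - S {..<N} x)\<^sup>2 \<partial>M) = (\<integral>x. (f x)\<^sup>2 \<partial>M) - (\<Sum>n<N. (c n)\<^sup>2)" for N
  proof -
    have "(\<integral>x. (f x - S {..<N} x)\<^sup>2 \<partial>M) =
        (\<integral>x. (f x)\<^sup>2 + (S {..<N} x)\<^sup>2 - 2 * (f x * S {..<N} x) \<partial>M)"
      by (simp add: power2_diff mult.assoc)
    also have "\<dots> = (\<integral>x. (f x)\<^sup>2 \<partial>M) + (\<integral>x. (S {..<N} x)\<^sup>2 \<partial>M) - 2 * (\<integral>x. f x * S {..<N} x \<partial>M)"
      using f S_sq[of "{..<N}"] square_integrable_mult[OF f S_sq[of "{..<N}"]]
      by (simp add: square_integrable_def)
    also have "(\<integral>x. f x * S {..<N} x \<partial>M) = (\<Sum>n<N. (c n)\<^sup>2)"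
      unfolding S_g[OF f] c_def[symmetric] by (simp add: power2_eq_square)
    finally show ?thesis by (simp add: S_S)
  qed
  ultimately have "(\<Sum>n<N. (c n)\<^sup>2) \<le> (\<integral>x. (f x)\<^sup>2 \<partial>M)" for N
    by simp
  then have "summable (\<lambda>n. (c n)\<^sup>2)"
    by (intro summableI_nonneg_bounded) auto
  \<comment> \<open>The blocks must beat the weight 4^k of \<open>sum_squared_le_weighted\<close>:
    4^k (1/8)^k = 2^(-k) is still summable.\<close>
  then obtain r where r: "mono r" "\<And>k. k \<le> r k"
      "\<And>k. \<bar>\<Sum>n\<in>{r k..<r (Suc k)}. (c n)\<^sup>2\<bar> \<le> (1 / 8) ^ k"
    by (rule summable_subseq_tail_le[of _ "\<lambda>k. (1 / 8) ^ k"]) auto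
  define v where "v k = S {r k..<r (Suc k)}" for k
  have v_int: "integrable M (\<lambda>x. 4 ^ k * (v k x)\<^sup>2)" for k
    unfolding v_def using S_sq by (simp add: square_integrable_def)
  have S_r: "S {..<r K} x = S {..<r 0} x + (\<Sum>k<K. v k x)" for K x
  proof (induction K)
    case (Suc K)
    have "S {..<r (Suc K)} x = S {..<r K} x + v K x"
      unfolding v_def S_def lessThan_atLeast0
      by (rule sum.atLeastLessThan_concat[symmetric]) (use monoD[OF r(1), of K "Suc K"] in auto)
    with Suc show ?case by simp
  qed simp
  have v_le: "(\<integral>x. 4 ^ k * (v k x)\<^sup>2 \<partial>M) \<le> (1 / 2) ^ k" for k
  proof -
    have "(\<integral>x. 4 ^ k * (v k x)\<^sup>2 \<partial>M) \<le> 4 ^ k * (1 / 8) ^ k"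
      using r(3)[of k] by (simp add: v_def S_S)
    also have "\<dots> = (1 / 2 :: real) ^ k"
      by (simp add: power_mult_distrib[symmetric])
    finally show ?thesis .
  qed
  define D where "D x = (\<Sum>k. 4 ^ k * (v k x)\<^sup>2)" for x
  have "summable (\<lambda>k. \<integral>x. 4 ^ k * (v k x)\<^sup>2 \<partial>M)"
  proof (rule summable_comparison_test')
    show "summable (\<lambda>k. (1 / 2 :: real) ^ k)"
      by (rule summable_geometric) simp
    fix k
    have "0 \<le> (\<integral>x. 4 ^ k * (v k x)\<^sup>2 \<partial>M)"
      by (intro Bochner_Integration.integral_nonneg) simp
    with v_le[of k] show "norm (\<integral>x. 4 ^ k * (v k x)\<^sup>2 \<partial>M) \<le> (1 / 2) ^ k"
      by (simp only: real_norm_def abs_of_nonneg)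
  qed
  then have AE_sum: "AE x in M. summable (\<lambda>k. 4 ^ k * (v k x)\<^sup>2)" and D_int: "integrable M D"
    using AE_summable_if_integrals_summable[OF v_int] unfolding D_def[abs_def] by auto
  \<comment> \<open>The partial sums diverge only on a null set, so the value that
    \<open>lim\<close> takes there is immaterial.\<close>
  define g where "g x = lim (\<lambda>k. S {..<r k} x)" for x
  \<comment> \<open>The initial block is kept apart; the later ones contribute at most sqrt(2 D) by
    the weighted inequality, uniformly in their number.\<close>
  define G where "G x = \<bar>S {..<r 0} x\<bar> + sqrt (2 * D x)" for x
  note [measurable] = borel_measurable_integrable[OF D_int]
  have g_meas [measurable]: "g \<in> borel_measurable M"
    unfolding g_def[abs_def] by measurable
  have G_meas [measurable]: "G \<in> borel_measurable M"
    unfolding G_def[abs_def] by measurable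
  have AE_conv: "AE x in M. (\<lambda>k. S {..<r k} x) \<longlonglongrightarrow> g x"
    using AE_sum
  proof eventually_elim
    case (elim x)
    have "summable (\<lambda>k. v k x)"
    proof (rule summable_comparison_test'[where N=0])
      show "summable (\<lambda>k. (1 / 4 :: real) ^ k + 4 ^ k * (v k x)\<^sup>2)"
        by (intro summable_add elim summable_geometric) auto
      fix k
      have "\<bar>(1 / 2) ^ k * (2 ^ k * v k x)\<bar> \<le> ((1 / 2) ^ k)\<^sup>2 + (2 ^ k * v k x)\<^sup>2"
        by (rule abs_mult_le_sum_squares)
      moreover have "(1 / 2) ^ k * (2 ^ k * v k x) = v k x"
        by (simp add: power_one_over)
      moreover have pow: "((1 / 2 :: real) ^ k)\<^sup>2 = (1 / 4) ^ k" "(2 ^ k :: real)\<^sup>2 = 4 ^ k"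
        by (simp_all only: power2_eq_square power_mult_distrib[symmetric]) simp_all
      ultimately show "norm (v k x) \<le> (1 / 4) ^ k + 4 ^ k * (v k x)\<^sup>2"
        by (simp only: real_norm_def power_mult_distrib pow)
    qed
    then have "convergent (\<lambda>K. S {..<r 0} x + (\<Sum>k<K. v k x))"
      by (intro convergent_add convergent_const) (simp add: summable_iff_convergent)
    then show ?case
      unfolding g_def S_r[symmetric] by (simp add: convergent_LIMSEQ_iff)
  qed
  have AE_bound: "AE x in M. \<forall>k. \<bar>S {..<r k} x\<bar> \<le> G x"
    using AE_sum
  proof eventually_elim
    case (elim x)
    show ?case
    proof
      fix K
      have "(\<Sum>k<K. v k x)\<^sup>2 \<le> 2 * (\<Sum>k<K. 4 ^ k * (v k x)\<^sup>2)"
        by (rule sum_squared_le_weighted)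
      also have "\<dots> \<le> 2 * D x"
        unfolding D_def using elim by (intro mult_left_mono sum_le_suminf) auto
      finally have "\<bar>\<Sum>k<K. v k x\<bar> \<le> sqrt (2 * D x)"
        by (simp add: real_le_rsqrt)
      then show "\<bar>S {..<r K} x\<bar> \<le> G x"
        using S_r[of K x] unfolding G_def by linarith
    qed
  qed
  have D_nonneg: "AE x in M. 0 \<le> D x"
    using AE_sum unfolding D_def by eventually_elim (auto intro!: suminf_nonneg)
  have G_sq: "square_integrable M G"
  proof -
    have "square_integrable M (\<lambda>x. sqrt (2 * D x))"
    proof -
      have "integrable M (\<lambda>x. (sqrt (2 * D x))\<^sup>2)"
      proof (rule integrable_cong_AE_imp)
        show "integrable M (\<lambda>x. 2 * D x)" using D_int by simp
        show "AE x in M. 2 * D x = (sqrt (2 * D x))\<^sup>2"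
          using D_nonneg by eventually_elim simp
      qed simp
      then show ?thesis by (simp add: square_integrable_def)
    qed
    moreover have "square_integrable M (\<lambda>x. \<bar>S {..<r 0} x\<bar>)"
      using S_sq[of "{..<r 0}"] by (simp add: square_integrable_def)
    ultimately show ?thesis
      unfolding G_def[abs_def] by (intro square_integrable_add)
  qed
  have g_bound: "AE x in M. \<bar>g x\<bar> \<le> G x"
    using AE_conv AE_bound
  proof eventually_elim
    case (elim x)
    then show ?case
      by (intro LIMSEQ_le_const2[OF tendsto_rabs]) auto
  qed
  have g_sq: "square_integrable M g"
    unfolding square_integrable_def
  proof (intro conjI g_meas)
    show "integrable M (\<lambda>x. (g x)\<^sup>2)"
    proof (rule Bochner_Integration.integrable_bound)
      show "integrable M (\<lambda>x. (G x)\<^sup>2)" using G_sq by (simp add: square_integrable_def)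
      show "AE x in M. norm ((g x)\<^sup>2) \<le> norm ((G x)\<^sup>2)"
        using g_bound by eventually_elim (simp add: abs_le_square_iff[symmetric])
    qed simp
  qed
  have fg: "square_integrable M (\<lambda>x. f x - g x)"
    by (intro square_integrable_diff f g_sq)
  have fG: "square_integrable M (\<lambda>x. \<bar>f x\<bar> + G x)"
    using f by (intro square_integrable_add G_sq) (simp add: square_integrable_def)
  have "(\<integral>x. (f x - g x)\<^sup>2 \<partial>M) = 0"
  proof (rule total[OF fg])
    fix n
    have "(\<lambda>k. \<integral>x. (f x - S {..<r k} x) * u n x \<partial>M) \<longlonglongrightarrow> (\<integral>x. (f x - g x) * u n x \<partial>M)"
    proof (rule integral_dominated_convergence[where w="\<lambda>x. \<bar>(\<bar>f x\<bar> + G x) * u n x\<bar>"])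
      show "integrable M (\<lambda>x. \<bar>(\<bar>f x\<bar> + G x) * u n x\<bar>)"
        by (intro integrable_abs square_integrable_mult fG sq)
      show "AE x in M. (\<lambda>k. (f x - S {..<r k} x) * u n x) \<longlonglongrightarrow> (f x - g x) * u n x"
        using AE_conv by eventually_elim (intro tendsto_intros)
      show "AE x in M. norm ((f x - S {..<r k} x) * u n x) \<le> \<bar>(\<bar>f x\<bar> + G x) * u n x\<bar>" for k
        using AE_bound
      proof eventually_elim
        case (elim x)
        have "\<bar>f x - S {..<r k} x\<bar> \<le> \<bar>\<bar>f x\<bar> + G x\<bar>"
          using abs_triangle_ineq4[of "f x" "S {..<r k} x"] spec[OF elim, of k] by linarith
        then show ?case
          by (simp add: abs_mult mult_right_mono)
      qed
    qed simp_all
    \<comment> \<open>As soon as \<open>r k\<close> exceeds \<open>n\<close>, the partial sum has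
      the same \<open>n\<close>-th coefficient as \<open>f\<close>.\<close>
    moreover have "\<forall>\<^sub>F k in sequentially. (\<integral>x. (f x - S {..<r k} x) * u n x \<partial>M) = 0"
      using eventually_ge_at_top[of "Suc n"]
    proof eventually_elim
      case (elim k)
      then have "n < r k" using r(2)[of k] by simp
      have "(\<integral>x. (f x - S {..<r k} x) * u n x \<partial>M) = (\<integral>x. f x * u n x \<partial>M) - (\<integral>x. S {..<r k} x * u n x \<partial>M)"
        by (simp add: left_diff_distrib square_integrable_mult[OF f sq] square_integrable_mult[OF S_sq sq])
      then show ?case
        using \<open>n < r k\<close> by (simp add: S_u c_def)
    qed
    then have "(\<lambda>k. \<integral>x. (f x - S {..<r k} x) * u n x \<partial>M) \<longlonglongrightarrow> 0"
      by (rule tendsto_eventually)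
    ultimately show "(\<integral>x. (f x - g x) * u n x \<partial>M) = 0"
      by (rule LIMSEQ_unique)
  qed
  moreover have "(\<lambda>k. \<integral>x. (f x - S {..<r k} x)\<^sup>2 \<partial>M) \<longlonglongrightarrow> (\<integral>x. (f x - g x)\<^sup>2 \<partial>M)"
  proof (rule integral_dominated_convergence[where w="\<lambda>x. (\<bar>f x\<bar> + G x)\<^sup>2"])
    show "integrable M (\<lambda>x. (\<bar>f x\<bar> + G x)\<^sup>2)"
      using fG by (simp add: square_integrable_def)
    show "AE x in M. (\<lambda>k. (f x - S {..<r k} x)\<^sup>2) \<longlonglongrightarrow> (f x - g x)\<^sup>2"
      using AE_conv by eventually_elim (intro tendsto_intros)
    show "AE x in M. norm ((f x - S {..<r k} x)\<^sup>2) \<le> (\<bar>f x\<bar> + G x)\<^sup>2" for k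
      using AE_bound
    proof eventually_elim
      case (elim x)
      have "\<bar>f x - S {..<r k} x\<bar> \<le> \<bar>\<bar>f x\<bar> + G x\<bar>"
        using abs_triangle_ineq4[of "f x" "S {..<r k} x"] spec[OF elim, of k] by linarith
      then show ?case
        by (simp add: abs_le_square_iff)
    qed
  qed simp_all
  ultimately have "\<forall>\<^sub>F k in sequentially. (\<integral>x. (f x - S {..<r k} x)\<^sup>2 \<partial>M) < \<epsilon>"
    using \<open>0 < \<epsilon>\<close> by (simp add: order_tendstoD(2))
  then obtain k where "(\<integral>x. (f x - S {..<r k} x)\<^sup>2 \<partial>M) < \<epsilon>"
    by (auto simp: eventually_sequentially)
  with that show thesis
    unfolding S_def by blast
qed

lemma L2_complete_set_if_total:
  fixes e :: "nat \<Rightarrow> 'a \<Rightarrow> real"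
  assumes sq: "\<And>n. square_integrable M (e n)" and inj: "inj e"
    and nz: "\<And>n. (\<integral>x. (e n x)\<^sup>2 \<partial>M) \<noteq> 0"
    and orth: "\<And>m n. m \<noteq> n \<Longrightarrow> (\<integral>x. e m x * e n x \<partial>M) = 0"
    and total: "\<And>g. square_integrable M g \<Longrightarrow> (\<And>n. (\<integral>x. g x * e n x \<partial>M) = 0) \<Longrightarrow> (\<integral>x. (g x)\<^sup>2 \<partial>M) = 0"
  shows "L2_complete_set M (range e)"
  unfolding L2_complete_set_def
proof (intro allI impI)
  fix f and \<epsilon> :: real assume f: "square_integrable M f" and "0 < \<epsilon>"
  define w where "w n = 1 / sqrt (\<integral>x. (e n x)\<^sup>2 \<partial>M)" for n
  have pos: "0 < (\<integral>x. (e n x)\<^sup>2 \<partial>M)" for n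
    using nz[of n] by (simp add: less_le Bochner_Integration.integral_nonneg)
  have w_pos: "0 < w n" and w_sq: "w n * w n * (\<integral>x. (e n x)\<^sup>2 \<partial>M) = 1" for n
    using pos[of n] by (simp_all add: w_def)
  define u where "u n x = w n * e n x" for n x
  have u_orth: "(\<integral>x. u m x * u n x \<partial>M) = (if m = n then 1 else 0)" for m n
  proof -
    have "(\<integral>x. u m x * u n x \<partial>M) = (\<integral>x. (w m * w n) * (e m x * e n x) \<partial>M)"
      by (simp add: u_def mult_ac)
    also have "\<dots> = w m * w n * (\<integral>x. e m x * e n x \<partial>M)"
      by (rule integral_mult_right_zero)
    finally show ?thesis
      using w_sq[of n] orth[of m n] by (cases "m = n") (simp_all add: power2_eq_square)
  qed
  have u_total: "(\<integral>x. (g x)\<^sup>2 \<partial>M) = 0" if "square_integrable M g" "\<And>n. (\<integral>x. g x * u n x \<partial>M) = 0" for g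
  proof (rule total[OF that(1)])
    fix n
    have "(\<integral>x. g x * u n x \<partial>M) = (\<integral>x. w n * (g x * e n x) \<partial>M)"
      by (simp add: u_def mult_ac)
    then show "(\<integral>x. g x * e n x \<partial>M) = 0"
      using that(2)[of n] w_pos[of n] by simp
  qed
  have u_sq: "square_integrable M (u n)" for n
    unfolding u_def[abs_def] by (intro square_integrable_cmult sq)
  have "0 < \<epsilon>\<^sup>2" using \<open>0 < \<epsilon>\<close> by simp
  then obtain c N where cN: "(\<integral>x. (f x - (\<Sum>n<N. c n * u n x))\<^sup>2 \<partial>M) < \<epsilon>\<^sup>2"
    using orthonormal_sequence_approximates[OF u_sq u_orth u_total f] by metis
  \<comment> \<open>\<open>L2_complete_set\<close> attaches coefficients to functions rather than
    indices; injectivity of \<open>e\<close> lets \<open>inv e\<close> recover the index, and the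
    normalisation \<open>w\<close> is absorbed into the coefficient.\<close>
  have "(\<Sum>g\<in>e ` {..<N}. (\<lambda>g. c (inv e g) * w (inv e g)) g * g x) = (\<Sum>n<N. c n * u n x)" for x
    using inj by (subst sum.reindex) (auto simp: u_def inj_on_def inv_f_f mult_ac)
  moreover have "sqrt (\<integral>x. (f x - (\<Sum>n<N. c n * u n x))\<^sup>2 \<partial>M) < \<epsilon>"
    using cN \<open>0 < \<epsilon>\<close> by (simp add: real_less_lsqrt)
  ultimately show "\<exists>T a. finite T \<and> T \<subseteq> range e \<and> sqrt (\<integral>x. (f x - (\<Sum>g\<in>T. a g * g x))\<^sup>2 \<partial>M) < \<epsilon>"
    by (intro exI[of _ "e ` {..<N}"] exI[of _ "\<lambda>g. c (inv e g) * w (inv e g)"]) auto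
qed

text \<open>
  With \<open>D H = d H' - (d' + 2yd) H\<close> one has \<open>Q\<^sub>n = D H\<^sub>n\<close>, \<open>D (d G) = d\<^sup>2 (G' - 2yG)\<close> and \<open>D y = 2 - d\<^sup>2\<close>, and every
  polynomial is a constant plus some \<open>G' - 2yG\<close>.
\<close>
lemma linear_functional_annihilates:
  fixes L :: "real poly \<Rightarrow> real"
  assumes add: "\<And>p q. L (p + q) = L p + L q" and smult: "\<And>c p. L (smult c p) = c * L p"
    and base: "\<And>k. L (base_poly k) = 0"
  shows "L ([:1, 0, 2:] * [:1, 0, 2:] * s) = 0"
proof -
  define D where "D H = [:1, 0, 2:] * pderiv H - [:0, 6, 0, 4:] * H" for H :: "real poly"
  have D_add: "D (G + H) = D G + D H" for G H
    by (simp only: D_def pderiv_add algebra_simps)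
  have D_smult: "D (smult c H) = smult c (D H)" for c H
    by (simp only: D_def pderiv_smult mult_smult_right smult_diff_right)
  have L_0: "L 0 = 0"
    using smult[of 0 0] by simp
  \<comment> \<open>Multiplication by y maps Hermite polynomials to combinations of Hermite
    polynomials. By induction on \<open>n\<close> the functional therefore kills D(y^n H_k) for all
    k, hence D of every polynomial.\<close>
  have x_hpoly: "[:0, 1:] * hpoly k = smult (1 / 2) (hpoly (Suc k)) + smult (real k) (hpoly (k - 1))" for k
    by (simp add: pderiv_hpoly smult_diff_right)
  have "L (D ([:0, 1:] ^ n * hpoly k)) = 0" for n k
  proof (induction n arbitrary: k)
    case 0
    show ?case using base[of "Suc k"] by (simp add: D_def)
  next
    case (Suc n)
    have "[:0, 1:] ^ Suc n * hpoly k = [:0, 1:] ^ n * ([:0, 1:] * hpoly k)"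
      by (simp only: power_Suc2 mult.assoc)
    also have "\<dots> = smult (1 / 2) ([:0, 1:] ^ n * hpoly (Suc k)) + smult (real k) ([:0, 1:] ^ n * hpoly (k - 1))"
      unfolding x_hpoly by (simp only: distrib_left mult_smult_right)
    finally show ?case
      by (simp only: D_add D_smult add smult Suc.IH)
  qed
  from this[of _ 0] have pow: "L (D ([:0, 1:] ^ n)) = 0" for n
    by (simp only: hpoly.simps mult_1_right)
  have "L (D ([:0, 1:] ^ n * H)) = 0" for n H
  proof (induction H arbitrary: n)
    case 0
    show ?case by (simp add: D_def L_0)
  next
    case (pCons a H)
    have "[:0, 1:] ^ n * pCons a H = smult a ([:0, 1:] ^ n) + [:0, 1:] ^ Suc n * H"
    proof -
      have "pCons a H = [:a:] + [:0, 1:] * H" by simp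
      then show ?thesis by (simp only: distrib_left power_Suc2 mult.assoc) simp
    qed
    then show ?case
      by (simp only: D_add D_smult add smult pow pCons.IH)
  qed
  from this[of 0] have D_0: "L (D H) = 0" for H
    by (simp only: power_0 mult_1_left)
  have DG: "D ([:1, 0, 2:] * G) = [:1, 0, 2:] * [:1, 0, 2:] * (pderiv G - [:0, 2:] * G)" for G
  proof -
    have "[:0, 6, 0, 4:] = [:0, 4:] + [:1, 0, 2:] * [:0, 2::real:]" "pderiv [:1, 0, 2:] = [:0, 4::real:]"
      by (simp_all add: pderiv_pCons)
    then show ?thesis
      unfolding D_def pderiv_mult by (simp only: algebra_simps)
  qed
  have L_DG: "L ([:1, 0, 2:] * [:1, 0, 2:] * (pderiv G - [:0, 2:] * G)) = 0" for G
    unfolding DG[symmetric] by (rule D_0)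
  \<comment> \<open>The choice G = y^(m+1) reduces degree m + 2 to degree m. The parities separate:
    degree 1 starts from G = 1, and degree 0 starts from d^2 = 2 - D y, the one place where the
    ground state enters.\<close>
  have mono: "L ([:1, 0, 2:] * [:1, 0, 2:] * [:0, 1:] ^ n) = 0" for n
  proof (induction n rule: less_induct)
    case (less n)
    consider "n = 0" | "n = 1" | m where "n = Suc (Suc m)"
      by (metis One_nat_def not0_implies_Suc)
    then show ?case
    proof cases
      case 1
      have "[:1, 0, 2:] * [:1, 0, 2:] = smult 2 1 + smult (- 1) (D [:0, 1:])"
        by (simp add: D_def pderiv_pCons one_pCons)
      then show ?thesis
        unfolding 1 using base[of 0] by (simp only: add smult D_0 power_0 mult_1_right base_poly.simps)
    next
      case 2
      have "[:0, 1:] ^ 1 = smult (- 1 / 2) (pderiv 1 - [:0, 2::real:] * 1)"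
        by simp
      then show ?thesis
        unfolding 2 by (simp only: mult_smult_right smult L_DG)
    next
      case 3
      have p: "pderiv ([:0, 1::real:] ^ Suc m) = smult (real (Suc m)) ([:0, 1:] ^ m)"
        by (subst pderiv_power_Suc) (simp add: pderiv_pCons)
      have "[:0, 1::real:] ^ Suc (Suc m) = smult (real (Suc m) / 2) ([:0, 1:] ^ m) +
          smult (- 1 / 2) (pderiv ([:0, 1:] ^ Suc m) - [:0, 2:] * [:0, 1:] ^ Suc m)"
        unfolding p by (simp add: smult_diff_right smult_add_left[symmetric])
      then show ?thesis
        unfolding 3 using less[of m] 3
        by (simp only: distrib_left mult_smult_right add smult L_DG)
    qed
  qed
  have "L ([:1, 0, 2:] * [:1, 0, 2:] * ([:0, 1:] ^ n * s)) = 0" for n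
  proof (induction s arbitrary: n)
    case 0
    show ?case by (simp add: L_0)
  next
    case (pCons a s)
    have "[:0, 1:] ^ n * pCons a s = smult a ([:0, 1:] ^ n) + [:0, 1:] ^ Suc n * s"
    proof -
      have "pCons a s = [:a:] + [:0, 1:] * s" by simp
      then show ?thesis by (simp only: distrib_left power_Suc2 mult.assoc) simp
    qed
    then show ?case
      by (simp only: distrib_left mult_smult_right add smult mono pCons.IH)
  qed
  from this[of 0] show ?thesis
    by (simp only: power_0 mult_1_left)
qed

section \<open>Orthogonality and completeness in L2(nu)\<close>

lemma nu_altdef: "nu = density lborel (\<lambda>y. ennreal (exp (- y\<^sup>2) / (2 * y\<^sup>2 + 1)\<^sup>2))"
proof -
  have "(exp (y\<^sup>2 / 2))\<^sup>2 = exp (y\<^sup>2)" for y :: real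
    by (simp add: exp_add[symmetric] power2_eq_square[of "exp _"])
  then have "1 / (seed y)\<^sup>2 = exp (- y\<^sup>2) / (2 * y\<^sup>2 + 1)\<^sup>2" for y
    unfolding seed_def power_mult_distrib exp_minus by (simp only:) (simp add: inverse_eq_divide)
  then show ?thesis
    unfolding nu_def by simp
qed

lemma seed_measurable [measurable]: "seed \<in> borel_measurable borel"
  unfolding seed_def[abs_def] by measurable

lemma sets_nu [simp, measurable_cong]: "sets nu = sets borel"
  by (simp add: nu_def)

lemma integral_nu:
  fixes f :: "real \<Rightarrow> real"
  assumes "f \<in> borel_measurable borel"
  shows "(\<integral>y. f y \<partial>nu) = (\<integral>y. f y / (seed y)\<^sup>2 \<partial>lborel)"
    and "integrable nu f \<longleftrightarrow> integrable lborel (\<lambda>y. f y / (seed y)\<^sup>2)"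
  using assms unfolding nu_def by (simp_all add: integral_density integrable_density)

text \<open>Enumerates the whole set as one sequence, with the same index shift as
  \<open>eigfun\<close>.\<close>

definition base_fun :: "nat \<Rightarrow> real \<Rightarrow> real" where
  "base_fun k y = poly (base_poly k) y"

lemma base_fun_measurable [measurable]: "base_fun k \<in> borel_measurable borel"
  unfolding base_fun_def[abs_def] by (intro borel_measurable_continuous_onI continuous_intros)

lemma base_fun_0: "base_fun 0 = (\<lambda>y. 1)" and base_fun_Suc: "base_fun (Suc n) = Q n"
  by (simp_all add: base_fun_def fun_eq_iff Q_poly del: base_poly.simps(2))

lemma range_base_fun: "range base_fun = {\<lambda>y. 1} \<union> range Q"
proof -
  have "(UNIV :: nat set) = insert 0 (range Suc)"
    by (auto simp: image_iff) (metis not0_implies_Suc)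
  then have "range base_fun = insert (base_fun 0) (base_fun ` range Suc)"
    by (metis image_insert)
  also have "base_fun ` range Suc = range Q"
    by (simp add: image_image base_fun_Suc)
  finally show ?thesis
    by (simp add: base_fun_0)
qed

lemma eigfun_base_fun: "eigfun k y = base_fun k y / seed y"
  by (simp add: eigfun_def base_fun_def)

lemma square_integrable_base_fun: "square_integrable nu (base_fun k)"
proof -
  have "integrable nu (\<lambda>y. (base_fun k y)\<^sup>2)"
    using integrable_eigfun_mult[of k k]
    by (subst integral_nu) (auto simp: eigfun_base_fun power2_eq_square)
  then show ?thesis by (simp add: square_integrable_def)
qed

text \<open>Division by \<open>seed\<close> is an isometry from L2(nu) into L2 of Lebesgue measure
  and takes \<open>base_fun\<close> to \<open>eigfun\<close>.\<close>

lemma integral_base_fun: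
  "(\<integral>y. base_fun j y * base_fun k y \<partial>nu) = (if j = k then norm2 k else 0)"
proof -
  have "(\<integral>y. base_fun j y * base_fun k y \<partial>nu) = (\<integral>y. eigfun j y * eigfun k y \<partial>lborel)"
    by (subst integral_nu) (auto simp: eigfun_base_fun power2_eq_square)
  then show ?thesis
    using integral_eigfun_orthogonal[of j k] integral_eigfun_sq[of k] by (auto simp: power2_eq_square)
qed

lemma integral_base_fun_sq: "(\<integral>y. (base_fun k y)\<^sup>2 \<partial>nu) = norm2 k"
  using integral_base_fun[of k k] by (simp add: power2_eq_square)

text \<open>Two equal members with different indices would be orthogonal to themselves, against the
  positive norm.\<close>

lemma inj_base_fun: "inj base_fun"
proof (rule injI)
  fix j k assume "base_fun j = base_fun k"
  then have "(\<integral>y. base_fun j y * base_fun k y \<partial>nu) = norm2 k"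
    using integral_base_fun[of k k] by simp
  then show "j = k"
    using integral_base_fun[of j k] norm2_pos[of k] by (auto split: if_splits)
qed

text \<open>The integrability hypothesis is shaped to admit square-integrable functions, for
  completeness, as well as the difference between an integrable density and the bounded spectral
  series, for uniqueness of the density.\<close>

lemma AE_eq_0_if_orthogonal_eigfun:
  fixes r :: "real \<Rightarrow> real"
  assumes [measurable]: "r \<in> borel_measurable borel"
    and int: "\<And>f b. gaussian_rational (1 / 2) f \<Longrightarrow> integrable lborel (\<lambda>y. r y * (f y * exp (b * \<bar>y\<bar>)))"
    and orth: "\<And>k. (\<integral>y. r y * eigfun k y \<partial>lborel) = 0"
  shows "AE y in lborel. r y = 0"
proof -
  define wt where "wt p y = poly p y * exp (- (1 / 2) * y\<^sup>2) / seed_poly y" for p y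
  have wt: "gaussian_rational (1 / 2) (wt p)" for p
    by (rule gaussian_rationalI[of _ p _ 1]) (simp add: wt_def)
  have int_wt: "integrable lborel (\<lambda>y. r y * wt p y)" for p
    using int[OF wt, of p 0] by simp
  define L where "L p = (\<integral>y. r y * wt p y \<partial>lborel)" for p
  have ann: "L ([:1, 0, 2:] * [:1, 0, 2:] * s) = 0" for s
  proof (rule linear_functional_annihilates)
    show "L (p + q) = L p + L q" for p q
    proof -
      have "r y * wt (p + q) y = r y * wt p y + r y * wt q y" for y
        by (simp add: wt_def field_simps)
      then show ?thesis
        unfolding L_def using int_wt by simp
    qed
    show "L (smult c p) = c * L p" for c p
    proof -
      have "r y * wt (smult c p) y = c * (r y * wt p y)" for y
        by (simp add: wt_def)
      then show ?thesis
        unfolding L_def by (simp only: integral_mult_right_zero)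
    qed
    show "L (base_poly k) = 0" for k
      unfolding L_def wt_def eigfun_altdef[symmetric] by (rule orth)
  qed
  \<comment> \<open>This is d^2 times the weight e^(-y^2/2)/d, so the moments of
    \<open>r y * gg y\<close> are exactly the values of \<open>L\<close> at d^2 y^n.\<close>
  define gg where "gg y = seed_poly y * exp (- (1 / 2) * y\<^sup>2)" for y
  have gg: "gaussian_rational (1 / 2) gg"
    by (rule gaussian_rationalI[of _ "[:1, 0, 2:]" _ 0]) (simp add: gg_def poly_seed_poly del: poly_pCons)
  have "AE y in lborel. r y * gg y = 0"
  proof (rule AE_eq_0_if_moments_eq_0)
    show "integrable lborel (\<lambda>y. r y * gg y * exp (b * \<bar>y\<bar>))" for b
      using int[OF gg, of b] by (simp add: mult.assoc)
    show "(\<integral>y. r y * gg y * y ^ n \<partial>lborel) = 0" for n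
    proof -
      have "wt ([:1, 0, 2:] * [:1, 0, 2:] * [:0, 1:] ^ n) y = gg y * y ^ n" for y
        unfolding wt_def gg_def poly_mult poly_power poly_seed_poly by simp
      then show ?thesis
        using ann[of "[:0, 1:] ^ n"] unfolding L_def by (simp only: mult.assoc)
    qed
  qed
  then show ?thesis
    by eventually_elim (auto simp: gg_def)
qed

lemma nu_total:
  assumes g: "square_integrable nu g" and orth: "\<And>k. (\<integral>y. g y * base_fun k y \<partial>nu) = 0"
  shows "(\<integral>y. (g y)\<^sup>2 \<partial>nu) = 0"
proof -
  have "g \<in> borel_measurable nu"
    using g by (simp add: square_integrable_def)
  then have [measurable]: "g \<in> borel_measurable borel"
    unfolding measurable_cong_sets[OF sets_nu refl] .
  define r where "r y = g y / seed y" for y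
  have [measurable]: "r \<in> borel_measurable borel"
    unfolding r_def[abs_def] by measurable
  have r2: "integrable lborel (\<lambda>y. (r y)\<^sup>2)"
    using g by (simp add: square_integrable_def integral_nu(2) r_def power_divide)
  have "AE y in lborel. r y = 0"
  proof (rule AE_eq_0_if_orthogonal_eigfun)
    fix f b assume f: "gaussian_rational (1 / 2) f"
    note [measurable] = gaussian_rational_measurable[OF f]
    have "(f y * exp (b * \<bar>y\<bar>))\<^sup>2 = f y * f y * exp (2 * b * \<bar>y\<bar>)" for y
      by (simp add: power2_eq_square mult_ac exp_add[symmetric])
    then have "integrable lborel (\<lambda>y. (f y * exp (b * \<bar>y\<bar>))\<^sup>2)"
      using gaussian_rational_integrable_exp[OF gaussian_rational_mult_half[OF f f], of "2 * b"] by simp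
    with r2 show "integrable lborel (\<lambda>y. r y * (f y * exp (b * \<bar>y\<bar>)))"
      by (intro square_integrable_mult) (auto simp: square_integrable_def)
  next
    show "(\<integral>y. r y * eigfun k y \<partial>lborel) = 0" for k
      using orth[of k] by (simp add: integral_nu r_def eigfun_base_fun power2_eq_square)
  qed simp
  then have "AE y in lborel. (g y)\<^sup>2 / (seed y)\<^sup>2 = 0"
    by eventually_elim (simp add: r_def)
  then show ?thesis
    by (simp add: integral_nu integral_eq_zero_AE)
qed

lemma orthogonal_nu: "L2_orthogonal_set nu ({\<lambda>y. 1} \<union> range Q)"
  unfolding range_base_fun[symmetric] L2_orthogonal_set_def
proof (intro conjI ballI impI)
  fix f g assume "f \<in> range base_fun"
  then obtain k where f: "f = base_fun k" by blast
  show "square_integrable nu f" "(\<integral>x. (f x)\<^sup>2 \<partial>nu) \<noteq> 0"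
    using norm2_pos[of k] by (simp_all add: f square_integrable_base_fun integral_base_fun_sq)
  assume "g \<in> range base_fun" "f \<noteq> g"
  then show "(\<integral>x. f x * g x \<partial>nu) = 0"
    by (auto simp: f integral_base_fun)
qed

lemma complete_nu: "L2_complete_set nu ({\<lambda>y. 1} \<union> range Q)"
  unfolding range_base_fun[symmetric]
proof (rule L2_complete_set_if_total)
  show "(\<integral>x. (base_fun n x)\<^sup>2 \<partial>nu) \<noteq> 0" for n
    using norm2_pos[of n] by (simp add: integral_base_fun_sq)
qed (simp_all add: square_integrable_base_fun inj_base_fun integral_base_fun nu_total)

section \<open>The spectral series\<close>

definition kernel :: "real \<Rightarrow> real \<Rightarrow> real \<Rightarrow> real" where
  "kernel t x y = (\<Sum>k. exp (- eigval k * t) * (eigfun k x * eigfun k y / norm2 k))"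

lemma summable_kernel_bound:
  fixes t :: real assumes "0 < t"
  shows "summable (\<lambda>k. exp (- eigval k * t) * (1 + 2 * eigval k))"
proof (subst summable_Suc_iff[symmetric], rule summable_comparison_test')
  have "norm (exp (- t)) < 1" using assms by simp
  \<comment> \<open>The eigenvalue n + 11/2 gives 1 + 2 eigval = 2 n + 12, which is at most 12 (n +
    1); this explains the constant 12.\<close>
  from geometric_deriv_sums[OF this]
  show "summable (\<lambda>n. 12 * (of_nat (Suc n) * exp (- t) ^ n))"
    by (intro summable_mult) (rule sums_summable)
  fix n
  have "exp (- eigval (Suc n) * t) \<le> exp (- t) ^ n"
    using assms by (simp add: eigval_def exp_of_nat_mult[symmetric] field_simps)
  moreover have "1 + 2 * eigval (Suc n) \<le> 12 * real (Suc n)"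
    by (simp add: eigval_def)
  ultimately have "exp (- eigval (Suc n) * t) * (1 + 2 * eigval (Suc n)) \<le> exp (- t) ^ n * (12 * real (Suc n))"
    using eigval_pos[of "Suc n"] by (intro mult_mono) auto
  then show "norm (exp (- eigval (Suc n) * t) * (1 + 2 * eigval (Suc n))) \<le> 12 * (of_nat (Suc n) * exp (- t) ^ n)"
    using eigval_pos[of "Suc n"] by (simp add: mult_ac del: of_nat_Suc)
qed

text \<open>The uniform bound on eigenfunctions makes \<open>norm2\<close> cancel and leaves linear
  growth in the eigenvalue, independent of x and y; hence the series converges uniformly and its sum
  is bounded and continuous.\<close>

lemma kernel_term_le:
  "\<bar>exp (- eigval k * t) * (eigfun k x * eigfun k y / norm2 k)\<bar> \<le> exp (- eigval k * t) * (1 + 2 * eigval k)"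
proof -
  have *: "\<bar>eigfun k z\<bar> \<le> sqrt ((1 + 2 * eigval k) * norm2 k)" for z
    using eigfun_sq_le[of k z] by (simp add: real_le_rsqrt)
  have "\<bar>eigfun k x\<bar> * \<bar>eigfun k y\<bar> \<le> sqrt ((1 + 2 * eigval k) * norm2 k) * sqrt ((1 + 2 * eigval k) * norm2 k)"
    by (rule mult_mono[OF * *]) (use eigval_pos[of k] norm2_pos[of k] in auto)
  also have "\<dots> = (1 + 2 * eigval k) * norm2 k"
    using eigval_pos[of k] norm2_pos[of k] by simp
  finally have "\<bar>eigfun k x * eigfun k y / norm2 k\<bar> \<le> 1 + 2 * eigval k"
    using norm2_pos[of k] by (simp add: abs_mult divide_le_eq)
  then show ?thesis
    unfolding abs_mult[of "exp _"] abs_exp_cancel by (rule mult_left_mono) simp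
qed

lemma summable_kernel:
  assumes "0 < t"
  shows "summable (\<lambda>k. exp (- eigval k * t) * (eigfun k x * eigfun k y / norm2 k))"
  by (rule summable_comparison_test'[OF summable_kernel_bound[OF assms], of 0]) (use kernel_term_le in auto)

lemma abs_kernel_partial_le:
  assumes "0 < t"
  shows "\<bar>\<Sum>k<N. exp (- eigval k * t) * (eigfun k x * eigfun k y / norm2 k)\<bar> \<le>
    (\<Sum>k. exp (- eigval k * t) * (1 + 2 * eigval k))"
proof -
  have "\<bar>\<Sum>k<N. exp (- eigval k * t) * (eigfun k x * eigfun k y / norm2 k)\<bar> \<le>
      (\<Sum>k<N. exp (- eigval k * t) * (1 + 2 * eigval k))"
    by (rule order_trans[OF sum_abs]) (intro sum_mono kernel_term_le)
  also have "\<dots> \<le> (\<Sum>k. exp (- eigval k * t) * (1 + 2 * eigval k))"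
  proof (intro sum_le_suminf summable_kernel_bound[OF assms])
    show "0 \<le> exp (- eigval k * t) * (1 + 2 * eigval k)" for k
      using eigval_pos[of k] by simp
  qed simp
  finally show ?thesis .
qed

lemma kernel_LIMSEQ:
  assumes "0 < t"
  shows "(\<lambda>N. \<Sum>k<N. exp (- eigval k * t) * (eigfun k x * eigfun k y / norm2 k)) \<longlonglongrightarrow> kernel t x y"
  unfolding kernel_def using summable_LIMSEQ[OF summable_kernel[OF assms]] .

lemma abs_kernel_le:
  assumes "0 < t"
  shows "\<bar>kernel t x y\<bar> \<le> (\<Sum>k. exp (- eigval k * t) * (1 + 2 * eigval k))"
  by (rule LIMSEQ_le_const2[OF tendsto_rabs[OF kernel_LIMSEQ[OF assms]]])
    (use abs_kernel_partial_le[OF assms] in auto)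

lemma continuous_on_kernel:
  assumes "0 < t"
  shows "continuous_on UNIV (kernel t x)"
proof -
  have "uniform_limit UNIV (\<lambda>N y. \<Sum>k<N. exp (- eigval k * t) * (eigfun k x * eigfun k y / norm2 k))
      (kernel t x) sequentially"
    unfolding kernel_def[abs_def]
    by (rule Weierstrass_m_test[OF _ summable_kernel_bound[OF assms]]) (use kernel_term_le in auto)
  then show ?thesis
    by (rule uniform_limit_theorem[rotated])
      (auto intro!: always_eventually continuous_intros gaussian_rational_continuous[OF gaussian_rational_eigfun]
        simp: norm2_pos[THEN less_imp_neq, symmetric])
qed

lemma integral_kernel_eigfun:
  assumes "0 < t"
  shows "(\<integral>y. kernel t x y * eigfun j y \<partial>lborel) = exp (- eigval j * t) * eigfun j x"
proof -
  let ?S = "\<lambda>N y. (\<Sum>k<N. exp (- eigval k * t) * (eigfun k x * eigfun k y / norm2 k)) * eigfun j y"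
  define B where "B = (\<Sum>k. exp (- eigval k * t) * (1 + 2 * eigval k))"
  note [measurable] = gaussian_rational_measurable[OF gaussian_rational_eigfun]
    borel_measurable_continuous_onI[OF continuous_on_kernel[OF assms]]
  have "(\<lambda>N. \<integral>y. ?S N y \<partial>lborel) \<longlonglongrightarrow> (\<integral>y. kernel t x y * eigfun j y \<partial>lborel)"
  proof (rule integral_dominated_convergence[where w="\<lambda>y. B * \<bar>eigfun j y\<bar>"])
    show "integrable lborel (\<lambda>y. B * \<bar>eigfun j y\<bar>)"
      using gaussian_rational_integrable[OF gaussian_rational_eigfun] by simp
    show "AE y in lborel. (\<lambda>N. ?S N y) \<longlonglongrightarrow> kernel t x y * eigfun j y"
      by (intro AE_I2 tendsto_mult kernel_LIMSEQ assms tendsto_const)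
    show "AE y in lborel. norm (?S N y) \<le> B * \<bar>eigfun j y\<bar>" for N
      unfolding real_norm_def abs_mult[of "sum _ _"] B_def
      by (intro AE_I2 mult_right_mono abs_kernel_partial_le assms) simp
  qed measurable
  moreover have "(\<integral>y. ?S N y \<partial>lborel) = exp (- eigval j * t) * eigfun j x" if "j < N" for N
  proof -
    have "(\<integral>y. ?S N y \<partial>lborel) =
        (\<integral>y. (\<Sum>k<N. exp (- eigval k * t) * eigfun k x / norm2 k * (eigfun k y * eigfun j y)) \<partial>lborel)"
      unfolding sum_distrib_right by (intro Bochner_Integration.integral_cong sum.cong refl) simp
    also have "\<dots> = (\<Sum>k<N. exp (- eigval k * t) * eigfun k x / norm2 k * (if k = j then norm2 j else 0))"
      using integral_eigfun_orthogonal integral_eigfun_sq[of j]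
      by (subst Bochner_Integration.integral_sum)
        (auto intro!: sum.cong integrable_mult_right integrable_eigfun_mult simp: power2_eq_square)
    also have "\<dots> = exp (- eigval j * t) * eigfun j x"
      using that norm2_pos[of j] by (simp add: if_distrib sum.delta cong: if_cong)
    finally show ?thesis .
  qed
  then have "(\<lambda>N. \<integral>y. ?S N y \<partial>lborel) \<longlonglongrightarrow> exp (- eigval j * t) * eigfun j x"
    by (intro tendsto_eventually eventually_sequentiallyI[of "Suc j"]) auto
  ultimately show ?thesis
    by (rule LIMSEQ_unique)
qed

text \<open>The two functions are integrable against f(y) e^(b|y|) for opposite reasons:
  \<open>k\<close> is integrable and the test factor bounded, while the series is bounded and the
  test factor integrable.\<close>

lemma AE_eq_kernel:
  fixes k :: "real \<Rightarrow> real"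
  assumes "0 < t" and k: "integrable lborel k"
    and eig: "\<And>j. (\<integral>y. k y * eigfun j y \<partial>lborel) = exp (- eigval j * t) * eigfun j x"
  shows "AE y in lborel. k y = kernel t x y"
proof -
  note [measurable] = gaussian_rational_measurable[OF gaussian_rational_eigfun]
    borel_measurable_continuous_onI[OF continuous_on_kernel[OF assms(1)]]
    borel_measurable_integrable[OF k, simplified]
  define B where "B = (\<Sum>k. exp (- eigval k * t) * (1 + 2 * eigval k))"
  have k_int: "integrable lborel (\<lambda>y. k y * (f y * exp (b * \<bar>y\<bar>)))"
    and kernel_int: "integrable lborel (\<lambda>y. kernel t x y * (f y * exp (b * \<bar>y\<bar>)))"
    if f: "gaussian_rational (1 / 2) f" for f b
  proof -
    note [measurable] = gaussian_rational_measurable[OF f]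
    obtain C where C: "0 \<le> C" "\<And>y. \<bar>f y\<bar> * exp (b * \<bar>y\<bar>) \<le> C * exp (- (1 / 2 / 2) * y\<^sup>2)"
      using gaussian_rational_le[OF f] by (metis half_gt_zero zero_less_one)
    have "C * exp (- (1 / 2 / 2) * y\<^sup>2) \<le> C" for y
      using C(1) by (intro mult_left_le) auto
    then have C': "\<bar>f y\<bar> * exp (b * \<bar>y\<bar>) \<le> C" for y
      using C(2)[of y] by (rule order_trans[rotated])
    show "integrable lborel (\<lambda>y. k y * (f y * exp (b * \<bar>y\<bar>)))"
    proof (rule Bochner_Integration.integrable_bound[OF integrable_mult_left[OF k, of C]])
      show "AE y in lborel. norm (k y * (f y * exp (b * \<bar>y\<bar>))) \<le> norm (k y * C)"
        using C(1) C' by (intro AE_I2) (simp add: abs_mult mult_left_mono)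
    qed measurable
    show "integrable lborel (\<lambda>y. kernel t x y * (f y * exp (b * \<bar>y\<bar>)))"
    proof (rule Bochner_Integration.integrable_bound)
      show "integrable lborel (\<lambda>y. B * (f y * exp (b * \<bar>y\<bar>)))"
        using gaussian_rational_integrable_exp[OF f, of b] by simp
      show "AE y in lborel. norm (kernel t x y * (f y * exp (b * \<bar>y\<bar>))) \<le> norm (B * (f y * exp (b * \<bar>y\<bar>)))"
        using abs_kernel_le[OF assms(1), of x] unfolding B_def[symmetric]
        by (intro AE_I2) (simp add: abs_mult mult_right_mono order_trans[OF _ abs_ge_self])
    qed measurable
  qed
  have "AE y in lborel. k y - kernel t x y = 0"
  proof (rule AE_eq_0_if_orthogonal_eigfun)
    show "integrable lborel (\<lambda>y. (k y - kernel t x y) * (f y * exp (b * \<bar>y\<bar>)))"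
      if "gaussian_rational (1 / 2) f" for f b
      using k_int[OF that, of b] kernel_int[OF that, of b] by (simp add: left_diff_distrib)
    show "(\<integral>y. (k y - kernel t x y) * eigfun j y \<partial>lborel) = 0" for j
      using k_int[OF gaussian_rational_eigfun, of j 0] kernel_int[OF gaussian_rational_eigfun, of j 0]
      by (simp add: left_diff_distrib eig integral_kernel_eigfun[OF assms(1)])
  qed measurable
  then show ?thesis
    by eventually_elim simp
qed

text \<open>A nonempty open exceptional set would contain an interval of positive length.\<close>

lemma AE_lborel_imp_all:
  fixes P :: "real \<Rightarrow> bool"
  assumes "open {y. \<not> P y}" "AE y in lborel. P y"
  shows "P y"
proof (rule ccontr)
  assume "\<not> P y"
  with assms(1) obtain e where e: "0 < e" "\<And>z. dist z y < e \<Longrightarrow> \<not> P z"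
    by (auto simp: open_dist)
  from assms(2) have "AE z in lborel. z \<notin> {y - e<..<y + e}"
    by eventually_elim (use e(2) in \<open>auto simp: dist_real_def abs_less_iff\<close>)
  then have "emeasure lborel {y - e<..<y + e} = 0"
    by (subst (asm) AE_iff_null_sets[symmetric]) (auto simp: null_sets_def)
  then show False using e(1) by simp
qed

lemma kernel_altdef:
  assumes "0 < t"
  shows "summable (\<lambda>n. exp (- (real n + 11 / 2) * t) * (Q n x * Q n y / (2 ^ (n + 1) * fact n * (real n + 3))))"
    and "kernel t x y = 1 / sqrt pi * (exp (- (1 / 2) * (x\<^sup>2 + y\<^sup>2)) / ((2 * x\<^sup>2 + 1) * (2 * y\<^sup>2 + 1))) *
          (2 * exp (- (5 / 2) * t) +
           (\<Sum>n. exp (- (real n + 11 / 2) * t) *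
              (Q n x * Q n y / (2 ^ (n + 1) * fact n * (real n + 3)))))"
proof -
  let ?c = "1 / (sqrt pi * seed x * seed y)"
  let ?q = "\<lambda>n. exp (- (real n + 11 / 2) * t) * (Q n x * Q n y / (2 ^ (n + 1) * fact n * (real n + 3)))"
  let ?T = "\<lambda>k. exp (- eigval k * t) * (eigfun k x * eigfun k y / norm2 k)"
  have c: "?c \<noteq> 0" using seed_pos[of x] seed_pos[of y] by simp
  have T: "?T (Suc n) = ?c * ?q n" for n
  proof -
    have "eigval (Suc n) = real n + 11 / 2" by (simp add: eigval_def)
    \<comment> \<open>The gap 2 (n + 3) supplies the factor n + 3 and raises 2^n to 2^(n+1).
      Likewise the ground state norm sqrt(pi)/2 produces the coefficient 2 of the first
      term.\<close>
    moreover have "norm2 (Suc n) = sqrt pi * (2 ^ (n + 1) * fact n * (real n + 3))"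
      by (simp add: algebra_simps)
    ultimately show ?thesis
      by (simp only: eigfun_base_fun base_fun_Suc) (simp add: divide_simps)
  qed
  have T0: "?T 0 = ?c * (2 * exp (- (5 / 2) * t))"
    by (simp add: eigval_def eigfun_base_fun base_fun_0 mult_ac)
  have summ: "summable (\<lambda>n. ?c * ?q n)"
    using summable_kernel[OF assms, of x y] unfolding T[symmetric] by (subst summable_Suc_iff)
  then show q: "summable ?q"
    using c by (subst (asm) summable_cmult_iff) auto
  have "kernel t x y = (\<Sum>n. ?T (Suc n)) + ?T 0"
    unfolding kernel_def using suminf_split_head[OF summable_kernel[OF assms, of x y]] by simp
  also have "\<dots> = ?c * (2 * exp (- (5 / 2) * t) + (\<Sum>n. ?q n))"
    unfolding T T0 suminf_mult[OF q] by (simp only: distrib_left add.commute)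
  also have "?c = 1 / sqrt pi * (exp (- (1 / 2) * (x\<^sup>2 + y\<^sup>2)) / ((2 * x\<^sup>2 + 1) * (2 * y\<^sup>2 + 1)))"
  proof -
    have "exp (- (1 / 2) * (x\<^sup>2 + y\<^sup>2)) = exp (- (x\<^sup>2 / 2)) * exp (- (y\<^sup>2 / 2))"
      unfolding exp_add[symmetric] by (rule arg_cong[where f=exp]) (simp add: field_simps)
    then show ?thesis
      unfolding exp_minus seed_def by (simp only: divide_inverse inverse_mult_distrib mult_1_left mult_ac)
  qed
  finally show "kernel t x y = 1 / sqrt pi * (exp (- (1 / 2) * (x\<^sup>2 + y\<^sup>2)) / ((2 * x\<^sup>2 + 1) * (2 * y\<^sup>2 + 1))) *
          (2 * exp (- (5 / 2) * t) + (\<Sum>n. ?q n))" .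
qed

section \<open>Trotter steps\<close>

text \<open>The killing factor is evaluated at the starting point of the step, so that iterates
  correspond to left-endpoint Riemann sums of the killing rate along the path.\<close>

definition killed_step :: "(real \<Rightarrow> real) \<Rightarrow> real \<Rightarrow> (real \<Rightarrow> real) \<Rightarrow> real \<Rightarrow> real" where
  "killed_step c \<delta> g x = exp (- c x * \<delta>) * (\<integral>z. normal_density 0 (sqrt \<delta>) z * g (x + z) \<partial>lborel)"

lemma integrable_normal_density_mult:
  assumes "0 < \<sigma>" and [measurable]: "g \<in> borel_measurable borel" and B: "\<And>z. \<bar>g z\<bar> \<le> B"
  shows "integrable lborel (\<lambda>z. normal_density 0 \<sigma> z * g (x + z))"
proof (rule Bochner_Integration.integrable_bound)
  show "integrable lborel (\<lambda>z. normal_density 0 \<sigma> z * B)"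
    using assms(1) by simp
  show "AE z in lborel. norm (normal_density 0 \<sigma> z * g (x + z)) \<le> norm (normal_density 0 \<sigma> z * B)"
    using B by (intro AE_I2) (simp add: abs_mult mult_left_mono order_trans[OF _ abs_ge_self])
qed measurable

lemma abs_normal_density_mult_le:
  assumes "0 < \<sigma>" and [measurable]: "g \<in> borel_measurable borel" and B: "\<And>z. \<bar>g z\<bar> \<le> B"
  shows "\<bar>\<integral>z. normal_density 0 \<sigma> z * g (x + z) \<partial>lborel\<bar> \<le> B"
proof -
  have "\<bar>\<integral>z. normal_density 0 \<sigma> z * g (x + z) \<partial>lborel\<bar> \<le> (\<integral>z. \<bar>normal_density 0 \<sigma> z * g (x + z)\<bar> \<partial>lborel)"
    by (rule integral_abs_bound)
  also have "\<dots> \<le> (\<integral>z. normal_density 0 \<sigma> z * B \<partial>lborel)"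
    using assms(1) B
    by (intro integral_mono integrable_abs integrable_normal_density_mult[OF assms])
      (auto simp: abs_mult intro!: mult_left_mono)
  also have "\<dots> = B" using assms(1) by simp
  finally show ?thesis .
qed

text \<open>The first moment vanishes, the second is \<open>\<delta>\<close>, and the third absolute
  moment is of order \<open>\<delta>\<close> to the power 3/2. The constants 1/6, 2 and sqrt(2/pi)
  are together at most 1.\<close>

lemma gaussian_taylor:
  assumes "0 < \<delta>"
    and [measurable]: "f \<in> borel_measurable borel" and B: "\<And>z. \<bar>f z\<bar> \<le> B"
    and f1: "\<And>y. (f has_real_derivative f1 y) (at y)"
    and f2: "\<And>y. (f1 has_real_derivative f2 y) (at y)"
    and f3: "\<And>y. (f2 has_real_derivative f3 y) (at y)"
    and B3: "\<And>y. \<bar>f3 y\<bar> \<le> B3"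
  shows "\<bar>(\<integral>z. normal_density 0 (sqrt \<delta>) z * f (x + z) \<partial>lborel) - f x - \<delta> / 2 * f2 x\<bar> \<le> B3 * sqrt \<delta> ^ 3"
proof -
  define N where "N = normal_density 0 (sqrt \<delta>)"
  have \<sigma>: "0 < sqrt \<delta>" using assms by simp
  have N_nonneg: "0 \<le> N z" for z by (simp add: N_def)
  have m0: "has_bochner_integral lborel N 1"
    using \<sigma> by (simp add: N_def has_bochner_integral_iff)
  have m1: "has_bochner_integral lborel (\<lambda>z. N z * z) 0"
    using normal_moment_odd[OF \<sigma>, of 0 0] by (simp add: N_def)
  have m2: "has_bochner_integral lborel (\<lambda>z. N z * z\<^sup>2) \<delta>"
    using normal_moment_even[OF \<sigma>, of 0 1] assms(1) by (simp add: N_def numeral_2_eq_2)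
  have m3: "has_bochner_integral lborel (\<lambda>z. N z * \<bar>z\<bar> ^ 3) (2 * sqrt \<delta> ^ 3 * sqrt (2 / pi))"
    using normal_moment_abs_odd[OF \<sigma>, of 0 1] by (simp add: N_def numeral_3_eq_3)
  have B3_nonneg: "0 \<le> B3" using B3[of 0] by linarith
  have taylor: "\<bar>f (x + z) - (f x + f1 x * z + f2 x / 2 * z\<^sup>2)\<bar> \<le> B3 / 6 * \<bar>z\<bar> ^ 3" for z
  proof -
    define d where "d m = (\<lambda>z. (if m = 0 then f else if m = 1 then f1 else if m = 2 then f2 else f3) (x + z))" for m :: nat
    have "\<exists>t. \<bar>t\<bar> \<le> \<bar>z\<bar> \<and> d 0 z = (\<Sum>m<3. d m 0 / fact m * z ^ m) + d 3 t / fact 3 * z ^ 3"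
    proof (rule Maclaurin_bi_le[OF refl], intro allI impI)
      fix m :: nat and t assume "m < 3 \<and> \<bar>t\<bar> \<le> \<bar>z\<bar>"
      then have "m = 0 \<or> m = 1 \<or> m = 2" by auto
      then show "(d m has_real_derivative d (Suc m) t) (at t)"
        using f1[of "t + x", unfolded DERIV_shift] f2[of "t + x", unfolded DERIV_shift]
          f3[of "t + x", unfolded DERIV_shift]
        unfolding d_def by (auto simp: add.commute)
    qed
    then obtain t where "d 0 z = (\<Sum>m<3. d m 0 / fact m * z ^ m) + d 3 t / fact 3 * z ^ 3"
      by blast
    then have "f (x + z) = f x + f1 x * z + f2 x / 2 * z\<^sup>2 + f3 (x + t) / 6 * z ^ 3"
      by (simp add: d_def numeral_3_eq_3 numeral_2_eq_2 lessThan_Suc)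
    then have "f (x + z) - (f x + f1 x * z + f2 x / 2 * z\<^sup>2) = f3 (x + t) / 6 * z ^ 3"
      by simp
    also have "\<bar>\<dots>\<bar> \<le> B3 / 6 * \<bar>z\<bar> ^ 3"
      unfolding abs_mult power_abs[symmetric] using B3 by (intro mult_right_mono) auto
    finally show ?thesis .
  qed
  have int: "integrable lborel (\<lambda>z. N z * f (x + z))"
    unfolding N_def by (rule integrable_normal_density_mult[OF \<sigma> _ B]) simp
  have poly: "has_bochner_integral lborel (\<lambda>z. N z * (f x + f1 x * z + f2 x / 2 * z\<^sup>2)) (f x + \<delta> / 2 * f2 x)"
  proof -
    have "has_bochner_integral lborel (\<lambda>z. f x * N z + f1 x * (N z * z) + f2 x / 2 * (N z * z\<^sup>2))
        (f x * 1 + f1 x * 0 + f2 x / 2 * \<delta>)"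
      by (intro has_bochner_integral_add has_bochner_integral_mult_right m0 m1 m2)
    then show ?thesis by (simp add: algebra_simps)
  qed
  have diff: "(\<integral>z. N z * f (x + z) \<partial>lborel) - (f x + \<delta> / 2 * f2 x) =
      (\<integral>z. N z * f (x + z) - N z * (f x + f1 x * z + f2 x / 2 * z\<^sup>2) \<partial>lborel)"
    using int poly by (simp add: has_bochner_integral_iff)
  have "\<bar>(\<integral>z. N z * f (x + z) \<partial>lborel) - (f x + \<delta> / 2 * f2 x)\<bar> \<le>
      (\<integral>z. \<bar>N z * f (x + z) - N z * (f x + f1 x * z + f2 x / 2 * z\<^sup>2)\<bar> \<partial>lborel)"
    unfolding diff by (rule integral_abs_bound)
  also have "\<dots> \<le> (\<integral>z. B3 / 6 * (N z * \<bar>z\<bar> ^ 3) \<partial>lborel)"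
  proof (rule integral_mono)
    show "integrable lborel (\<lambda>z. \<bar>N z * f (x + z) - N z * (f x + f1 x * z + f2 x / 2 * z\<^sup>2)\<bar>)"
      by (intro integrable_abs Bochner_Integration.integrable_diff int integrable.intros[OF poly])
    show "integrable lborel (\<lambda>z. B3 / 6 * (N z * \<bar>z\<bar> ^ 3))"
      by (intro integrable_mult_right integrable.intros[OF m3])
    fix z
    have "\<bar>N z * f (x + z) - N z * (f x + f1 x * z + f2 x / 2 * z\<^sup>2)\<bar> =
        N z * \<bar>f (x + z) - (f x + f1 x * z + f2 x / 2 * z\<^sup>2)\<bar>"
      using N_nonneg[of z] by (simp only: right_diff_distrib[symmetric] abs_mult[of "N z"] abs_of_nonneg)
    also have "\<dots> \<le> N z * (B3 / 6 * \<bar>z\<bar> ^ 3)"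
      by (rule mult_left_mono[OF taylor N_nonneg])
    finally show "\<bar>N z * f (x + z) - N z * (f x + f1 x * z + f2 x / 2 * z\<^sup>2)\<bar> \<le> B3 / 6 * (N z * \<bar>z\<bar> ^ 3)"
      by (simp only: mult.left_commute)
  qed
  also have "\<dots> = B3 / 6 * (2 * sqrt \<delta> ^ 3 * sqrt (2 / pi))"
    using m3 by (simp add: has_bochner_integral_iff)
  also have "\<dots> \<le> B3 / 6 * (2 * sqrt \<delta> ^ 3 * 1)"
  proof (intro mult_left_mono)
    show "sqrt (2 / pi) \<le> 1"
      using pi_gt3 by (simp add: real_sqrt_le_1_iff)
  qed (use B3_nonneg assms(1) in auto)
  also have "\<dots> \<le> B3 * sqrt \<delta> ^ 3"
    using B3_nonneg assms(1) by simp
  finally show ?thesis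
    unfolding N_def by (simp add: algebra_simps)
qed

lemma abs_exp_minus_le:
  fixes u :: real assumes "0 \<le> u"
  shows "\<bar>exp (- u) - 1\<bar> \<le> u" "\<bar>exp (- u) - 1 + u\<bar> \<le> u\<^sup>2 / 2"
proof -
  have lower: "1 - u \<le> exp (- u)"
    using exp_ge_add_one_self[of "- u"] by simp
  moreover have "exp (- u) \<le> 1"
    using assms by simp
  ultimately show "\<bar>exp (- u) - 1\<bar> \<le> u"
    by linarith
  have "exp (- u) \<le> 1 - u + u\<^sup>2 / 2"
  proof -
    have "\<exists>s. \<bar>s\<bar> \<le> \<bar>- u\<bar> \<and> exp (- u) = (\<Sum>m<3. (- u) ^ m / fact m) + exp s / fact 3 * (- u) ^ 3"
      by (rule Maclaurin_exp_le)
    then obtain s where "exp (- u) = (\<Sum>m<3. (- u) ^ m / fact m) + exp s / fact 3 * (- u) ^ 3"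
      by blast
    then have "exp (- u) = 1 - u + u\<^sup>2 / 2 - exp s / 6 * u ^ 3"
      by (simp add: numeral_3_eq_3 numeral_2_eq_2 lessThan_Suc)
    moreover have "0 \<le> exp s / 6 * u ^ 3"
      using assms by simp
    ultimately show ?thesis by linarith
  qed
  with lower show "\<bar>exp (- u) - 1 + u\<bar> \<le> u\<^sup>2 / 2"
    by linarith
qed

text \<open>To first order the step acts as (1 - c \<open>\<delta>\<close>)(f +
  \<open>\<delta>\<close> (c - l) f), where c f cancels and (1 - l \<open>\<delta>\<close>) f
  remains. The rate c itself may be unbounded; what is controlled is c times c f and c times f''.
  The assumption \<open>\<delta> \<le> 1\<close> lets second-order terms be absorbed into the power
  3/2.\<close>

lemma killed_step_consistent:
  assumes \<delta>: "0 < \<delta>" "\<delta> \<le> 1" and c: "\<And>y. 0 \<le> c y" and "0 \<le> l"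
    and [measurable]: "f \<in> borel_measurable borel" and B: "\<And>z. \<bar>f z\<bar> \<le> B"
    and f1: "\<And>y. (f has_real_derivative f1 y) (at y)"
    and f2: "\<And>y. (f1 has_real_derivative 2 * (c y - l) * f y) (at y)"
    and f3: "\<And>y. ((\<lambda>y. 2 * (c y - l) * f y) has_real_derivative f3 y) (at y)"
    and B3: "\<And>y. \<bar>f3 y\<bar> \<le> B3"
    and Bc: "\<And>y. \<bar>c y * (c y * f y)\<bar> \<le> Bc"
    and Bf2: "\<And>y. \<bar>c y * (2 * (c y - l) * f y)\<bar> \<le> Bf2"
  shows "\<bar>killed_step c \<delta> f x - exp (- l * \<delta>) * f x\<bar> \<le> (B3 + Bc + Bf2 + l\<^sup>2 * B) * sqrt \<delta> ^ 3"
proof -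
  define G where "G = (\<integral>z. normal_density 0 (sqrt \<delta>) z * f (x + z) \<partial>lborel)"
  define g2 where "g2 = 2 * (c x - l) * f x"
  have \<delta>2: "\<delta>\<^sup>2 \<le> sqrt \<delta> ^ 3"
  proof -
    have "\<delta>\<^sup>2 = sqrt \<delta> ^ 3 * sqrt \<delta>"
      using \<delta> by (simp add: power2_eq_square power3_eq_cube algebra_simps)
    also have "\<dots> \<le> sqrt \<delta> ^ 3 * 1"
      using \<delta> by (intro mult_left_mono) auto
    finally show ?thesis by simp
  qed
  have "0 \<le> B" "0 \<le> Bc" "0 \<le> Bf2"
    using B[of 0] Bc[of 0] Bf2[of 0] by linarith+
  have "\<bar>exp (- c x * \<delta>) * (G - f x - \<delta> / 2 * g2)\<bar> \<le> 1 * (B3 * sqrt \<delta> ^ 3)"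
    unfolding abs_mult
  proof (rule mult_mono)
    show "\<bar>G - f x - \<delta> / 2 * g2\<bar> \<le> B3 * sqrt \<delta> ^ 3"
      unfolding G_def g2_def by (rule gaussian_taylor[OF \<delta>(1) _ B f1 f2 f3 B3]) simp
  qed (use c[of x] \<delta> in auto)
  then have 1: "\<bar>exp (- c x * \<delta>) * (G - f x - \<delta> / 2 * g2)\<bar> \<le> B3 * sqrt \<delta> ^ 3"
    by simp
  have u: "0 \<le> c x * \<delta>" "0 \<le> l * \<delta>"
    using c[of x] \<delta> \<open>0 \<le> l\<close> by simp_all
  have 2: "\<bar>(exp (- (c x * \<delta>)) - 1 + c x * \<delta>) * f x\<bar> \<le> Bc * sqrt \<delta> ^ 3"
  proof -
    have "\<bar>(exp (- (c x * \<delta>)) - 1 + c x * \<delta>) * f x\<bar> \<le> (c x * \<delta>)\<^sup>2 / 2 * \<bar>f x\<bar>"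
      unfolding abs_mult by (intro mult_right_mono abs_exp_minus_le(2) u) simp
    also have "\<dots> = \<delta>\<^sup>2 / 2 * \<bar>c x * (c x * f x)\<bar>"
      by (simp add: power_mult_distrib abs_mult power2_eq_square c)
    also have "\<dots> \<le> \<delta>\<^sup>2 / 2 * Bc"
      by (intro mult_left_mono Bc) simp
    also have "\<dots> \<le> sqrt \<delta> ^ 3 * Bc"
      using \<open>0 \<le> Bc\<close> \<delta>2 zero_le_power2[of \<delta>] by (intro mult_right_mono) linarith+
    finally show ?thesis by (simp only: mult_ac)
  qed
  have 3: "\<bar>(exp (- (c x * \<delta>)) - 1) * (\<delta> / 2 * g2)\<bar> \<le> Bf2 * sqrt \<delta> ^ 3"
  proof -
    have "\<bar>(exp (- (c x * \<delta>)) - 1) * (\<delta> / 2 * g2)\<bar> \<le> c x * \<delta> * \<bar>\<delta> / 2 * g2\<bar>"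
      unfolding abs_mult[of "exp _ - 1"] by (intro mult_right_mono abs_exp_minus_le(1) u) simp
    also have "\<dots> = \<delta>\<^sup>2 / 2 * \<bar>c x * g2\<bar>"
      using c[of x] \<delta> by (simp add: power2_eq_square abs_mult)
    also have "\<dots> \<le> \<delta>\<^sup>2 / 2 * Bf2"
      unfolding g2_def by (intro mult_left_mono Bf2) simp
    also have "\<dots> \<le> sqrt \<delta> ^ 3 * Bf2"
      using \<open>0 \<le> Bf2\<close> \<delta>2 zero_le_power2[of \<delta>] by (intro mult_right_mono) linarith+
    finally show ?thesis by (simp only: mult_ac)
  qed
  have 4: "\<bar>(exp (- (l * \<delta>)) - 1 + l * \<delta>) * f x\<bar> \<le> l\<^sup>2 * B * sqrt \<delta> ^ 3"
  proof -
    have "\<bar>(exp (- (l * \<delta>)) - 1 + l * \<delta>) * f x\<bar> \<le> (l * \<delta>)\<^sup>2 / 2 * B"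
      unfolding abs_mult by (intro mult_mono abs_exp_minus_le(2) u B) simp_all
    also have "\<dots> = l\<^sup>2 * B * (\<delta>\<^sup>2 / 2)"
      by (simp add: power_mult_distrib)
    also have "\<dots> \<le> l\<^sup>2 * B * sqrt \<delta> ^ 3"
      using \<open>0 \<le> B\<close> \<delta>2 zero_le_power2[of \<delta>] by (intro mult_left_mono) (linarith, simp)
    finally show ?thesis .
  qed
  \<comment> \<open>The four summands are the Taylor error, two errors from linearising the killing
    factor, and one from linearising the exponential decay; the first-order terms cancel since
    \<open>g2\<close> is 2 (c - l) f.\<close>
  have "killed_step c \<delta> f x - exp (- l * \<delta>) * f x = exp (- c x * \<delta>) * (G - f x - \<delta> / 2 * g2)
      + (exp (- (c x * \<delta>)) - 1 + c x * \<delta>) * f x + (exp (- (c x * \<delta>)) - 1) * (\<delta> / 2 * g2)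
      - (exp (- (l * \<delta>)) - 1 + l * \<delta>) * f x"
    unfolding killed_step_def G_def[symmetric] g2_def by (simp add: field_simps)
  with 1 2 3 4 show ?thesis
    unfolding distrib_right by linarith
qed

lemma killed_step_measurable:
  assumes [measurable]: "c \<in> borel_measurable borel" "g \<in> borel_measurable borel"
  shows "killed_step c \<delta> g \<in> borel_measurable borel"
  unfolding killed_step_def[abs_def] by measurable

lemma abs_killed_step_le:
  assumes "0 < \<delta>" "\<And>y. 0 \<le> c y" "g \<in> borel_measurable borel" "\<And>z. \<bar>g z\<bar> \<le> B"
  shows "\<bar>killed_step c \<delta> g x\<bar> \<le> B"
proof -
  have "\<bar>killed_step c \<delta> g x\<bar> \<le> 1 * B"
    unfolding killed_step_def abs_mult
    using assms by (intro mult_mono abs_normal_density_mult_le) auto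
  then show ?thesis by simp
qed

text \<open>A step is linear and contracts the sup norm, so an error once made is not amplified, and
  the one-step errors merely add up.\<close>

lemma killed_step_iterate:
  assumes "0 < \<delta>" and c: "\<And>y. 0 \<le> c y" "c \<in> borel_measurable borel" and "0 \<le> l"
    and f: "f \<in> borel_measurable borel" and B: "\<And>z. \<bar>f z\<bar> \<le> B"
    and E: "\<And>x. \<bar>killed_step c \<delta> f x - exp (- l * \<delta>) * f x\<bar> \<le> E"
  shows "\<bar>(killed_step c \<delta> ^^ n) f x - exp (- l * (real n * \<delta>)) * f x\<bar> \<le> real n * E"
proof (induction n arbitrary: x)
  case (Suc n)
  let ?T = "killed_step c \<delta>"
  define g where "g = (?T ^^ n) f"
  have g: "g \<in> borel_measurable borel \<and> (\<forall>x. \<bar>g x\<bar> \<le> B)"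
    unfolding g_def
  proof (induction n)
    case (Suc n)
    then show ?case
      using killed_step_measurable[OF c(2), of "(?T ^^ n) f"] abs_killed_step_le[OF assms(1) c(1), of "(?T ^^ n) f" B]
      by simp
  qed (simp add: f B)
  define e where "e = exp (- l * (real n * \<delta>))"
  have e: "0 \<le> e" "e \<le> 1"
    unfolding e_def using assms by simp_all
  have T_diff: "?T g x - e * ?T f x = ?T (\<lambda>y. g y - e * f y) x"
  proof -
    have "(\<integral>z. normal_density 0 (sqrt \<delta>) z * (g (x + z) - e * f (x + z)) \<partial>lborel) =
        (\<integral>z. normal_density 0 (sqrt \<delta>) z * g (x + z) - e * (normal_density 0 (sqrt \<delta>) z * f (x + z)) \<partial>lborel)"
      by (simp add: algebra_simps)
    also have "\<dots> = (\<integral>z. normal_density 0 (sqrt \<delta>) z * g (x + z) \<partial>lborel) -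
        e * (\<integral>z. normal_density 0 (sqrt \<delta>) z * f (x + z) \<partial>lborel)"
      using g f B assms(1) integrable_normal_density_mult[of "sqrt \<delta>" g B x]
        integrable_normal_density_mult[of "sqrt \<delta>" f B x] by simp
    finally show ?thesis
      unfolding killed_step_def by (simp only: right_diff_distrib mult.left_commute)
  qed
  have "\<bar>?T (\<lambda>y. g y - e * f y) x\<bar> \<le> real n * E"
    using Suc.IH g f unfolding g_def[symmetric] e_def[symmetric]
    by (intro abs_killed_step_le assms(1) c(1)) auto
  moreover have "\<bar>e * (?T f x - exp (- l * \<delta>) * f x)\<bar> \<le> 1 * E"
    unfolding abs_mult using e E[of x] by (intro mult_mono) auto
  moreover have "exp (- l * (real (Suc n) * \<delta>)) = e * exp (- l * \<delta>)"
    unfolding e_def exp_add[symmetric] by (simp add: algebra_simps)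
  then have "(?T ^^ Suc n) f x - exp (- l * (real (Suc n) * \<delta>)) * f x =
      ?T (\<lambda>y. g y - e * f y) x + e * (?T f x - exp (- l * \<delta>) * f x)"
    unfolding T_diff[symmetric] by (simp add: g_def algebra_simps)
  ultimately show ?case
    by (simp add: algebra_simps)
qed simp

text \<open>With n + 1 steps of length \<open>\<delta>\<close> and total time t, errors of order
  \<open>\<delta>\<close> to the 3/2 add up to order t sqrt(\<open>\<delta>\<close>), which tends to
  0.\<close>

lemma killed_step_eigfun_LIMSEQ:
  assumes "0 < t"
  shows "(\<lambda>n. (killed_step ctilde (t / real (Suc n)) ^^ Suc n) (eigfun k) x) \<longlonglongrightarrow> exp (- eigval k * t) * eigfun k x"
proof -
  define f2 where "f2 y = 2 * (ctilde y - eigval k) * eigfun k y" for y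
  have gr2: "gaussian_rational (1 / 2) f2"
    using gaussian_rational_eigfun''[of k] by (simp only: f2_def[abs_def])
  obtain f3 where f3: "gaussian_rational (1 / 2) f3" "\<And>y. (f2 has_real_derivative f3 y) (at y)"
    using gaussian_rational_has_derivative[OF gr2] by blast
  have bdd: "\<exists>B\<ge>0. \<forall>y. \<bar>f y\<bar> \<le> B" if "gaussian_rational (1 / 2) f" for f
    using gaussian_rational_bounded[OF that] by (metis half_gt_zero zero_less_one)
  obtain B where B: "0 \<le> B" "\<And>y. \<bar>eigfun k y\<bar> \<le> B"
    using bdd[OF gaussian_rational_eigfun] by blast
  obtain B3 where B3: "0 \<le> B3" "\<And>y. \<bar>f3 y\<bar> \<le> B3"
    using bdd[OF f3(1)] by blast
  obtain Bc where Bc: "0 \<le> Bc" "\<And>y. \<bar>ctilde y * (ctilde y * eigfun k y)\<bar> \<le> Bc"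
    using bdd[OF gaussian_rational_ctilde_mult[OF gaussian_rational_ctilde_mult[OF gaussian_rational_eigfun]]] by blast
  obtain Bf2 where Bf2: "0 \<le> Bf2" "\<And>y. \<bar>ctilde y * f2 y\<bar> \<le> Bf2"
    using bdd[OF gaussian_rational_ctilde_mult[OF gr2]] by blast
  define C where "C = B3 + Bc + Bf2 + (eigval k)\<^sup>2 * B"
  have meas: "eigfun k \<in> borel_measurable borel"
    by (rule gaussian_rational_measurable[OF gaussian_rational_eigfun])
  have cmeas: "ctilde \<in> borel_measurable borel"
    by (rule borel_measurable_continuous_onI[OF continuous_on_ctilde])
  have eig: "0 \<le> eigval k" using eigval_pos[of k] by simp
  have bound: "\<bar>(killed_step ctilde (t / real (Suc n)) ^^ Suc n) (eigfun k) x - exp (- eigval k * t) * eigfun k x\<bar>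
      \<le> C * (t * sqrt (t / real (Suc n)))" if "t \<le> real (Suc n)" for n
  proof -
    let ?d = "t / real (Suc n)"
    have d: "0 < ?d" "?d \<le> 1" using assms that by simp_all
    have "\<bar>killed_step ctilde ?d (eigfun k) y - exp (- eigval k * ?d) * eigfun k y\<bar> \<le> C * sqrt ?d ^ 3" for y
      unfolding C_def
      by (rule killed_step_consistent[OF d ctilde_nonneg eig meas B(2) DERIV_eigfun DERIV_eigfun'
            f3(2)[unfolded f2_def[abs_def]] B3(2) Bc(2) Bf2(2)[unfolded f2_def]])
    then have "\<bar>(killed_step ctilde ?d ^^ Suc n) (eigfun k) x - exp (- eigval k * (real (Suc n) * ?d)) * eigfun k x\<bar>
        \<le> real (Suc n) * (C * sqrt ?d ^ 3)"
      by (rule killed_step_iterate[OF d(1) ctilde_nonneg cmeas eig meas B(2)])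
    also have "real (Suc n) * (C * sqrt ?d ^ 3) = C * (real (Suc n) * ?d * sqrt ?d)"
      using d assms by (simp add: power3_eq_cube del: of_nat_Suc)
    also have "real (Suc n) * ?d = t"
      by simp
    finally show ?thesis .
  qed
  have "(\<lambda>n. C * (t * sqrt (t * inverse (real (Suc n))))) \<longlonglongrightarrow> C * (t * sqrt (t * 0))"
    by (intro tendsto_intros LIMSEQ_inverse_real_of_nat)
  then have lim: "(\<lambda>n. C * (t * sqrt (t / real (Suc n)))) \<longlonglongrightarrow> 0"
    by (simp add: divide_inverse)
  obtain N :: nat where "t \<le> real N" using real_arch_simple by blast
  then have "\<forall>\<^sub>F n in sequentially. norm ((killed_step ctilde (t / real (Suc n)) ^^ Suc n) (eigfun k) x -
      exp (- eigval k * t) * eigfun k x) \<le> C * (t * sqrt (t / real (Suc n)))"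
    unfolding real_norm_def by (intro eventually_sequentiallyI[of N] bound) simp
  from Lim_null_comparison[OF this lim] show ?thesis
    by (rule LIM_zero_cancel)
qed

text \<open>On each piece the increment of an antiderivative is, by the mean value theorem, the
  length times a value of f, which is close to the left-endpoint value by uniform continuity. The
  tolerance e/(2 t) on values adds up to e/2.\<close>

lemma riemann_sum_LIMSEQ:
  fixes f :: "real \<Rightarrow> real"
  assumes "0 < t" and cont: "continuous_on {0..t} f"
  shows "(\<lambda>n. t / real (Suc n) * (\<Sum>i<Suc n. f (real i * (t / real (Suc n))))) \<longlonglongrightarrow> (LINT s:{0..t}|lborel. f s)"
proof (rule LIMSEQ_I)
  fix e :: real assume "0 < e"
  obtain F where F: "\<And>s. s \<in> {0..t} \<Longrightarrow> (F has_vector_derivative f s) (at s within {0..t})"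
    using antiderivative_continuous[OF cont] by blast
  have I: "(LINT s:{0..t}|lborel. f s) = F t - F 0"
    unfolding set_lebesgue_integral_def
    using assms by (intro integral_FTC_Icc F cont) auto
  have "uniformly_continuous_on {0..t} f"
    using cont by (intro compact_uniformly_continuous) auto
  then obtain d where d: "0 < d" "\<And>r s. r \<in> {0..t} \<Longrightarrow> s \<in> {0..t} \<Longrightarrow> dist s r < d \<Longrightarrow> dist (f s) (f r) < e / (2 * t)"
    unfolding uniformly_continuous_on_def using \<open>0 < e\<close> assms(1) by (metis divide_pos_pos mult_pos_pos zero_less_numeral)
  obtain N :: nat where N: "t / d < real N" using reals_Archimedean2 by blast
  have "norm (t / real (Suc n) * (\<Sum>i<Suc n. f (real i * (t / real (Suc n)))) - (LINT s:{0..t}|lborel. f s)) < e"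
    if "N \<le> n" for n
  proof -
    define D where "D = t / real (Suc n)"
    have D: "0 < D" "real (Suc n) * D = t" using assms(1) by (simp_all add: D_def)
    have "D < d"
    proof -
      have "t / d < real (Suc n)" using N that by linarith
      then show ?thesis using d(1) by (simp add: D_def field_simps)
    qed
    have le_t: "real i * D \<le> t" if "i \<le> Suc n" for i
      unfolding D(2)[symmetric] using that D(1) by (intro mult_right_mono) auto
    have piece: "\<bar>D * f (real i * D) - (F (real (Suc i) * D) - F (real i * D))\<bar> \<le> D * (e / (2 * t))"
      if "i < Suc n" for i
    proof -
      have sub: "{real i * D..real (Suc i) * D} \<subseteq> {0..t}"
        using le_t[of "Suc i"] that D(1) by auto
      have "\<exists>s\<in>{real i * D..real (Suc i) * D}. F (real (Suc i) * D) - F (real i * D) =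
          (real (Suc i) * D - real i * D) *\<^sub>R f s"
      proof (rule mvt_very_simple)
        show "real i * D \<le> real (Suc i) * D"
          using D(1) by simp
        show "(F has_derivative (\<lambda>h. h *\<^sub>R f s)) (at s within {real i * D..real (Suc i) * D})"
          if "real i * D \<le> s" "s \<le> real (Suc i) * D" for s
          using that sub by (intro has_derivative_subset[OF F[unfolded has_vector_derivative_def] sub]) auto
      qed
      then obtain s where s: "s \<in> {real i * D..real (Suc i) * D}"
          "F (real (Suc i) * D) - F (real i * D) = D * f s"
        by (auto simp: algebra_simps)
      have "dist (f (real i * D)) (f s) < e / (2 * t)"
      proof (rule d(2))
        show "s \<in> {0..t}" using s(1) sub by blast
        show "real i * D \<in> {0..t}" using sub D(1) by (auto simp: algebra_simps)
        show "dist (real i * D) s < d"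
          using s(1) \<open>D < d\<close> by (simp add: dist_real_def algebra_simps)
      qed
      then have "D * \<bar>f (real i * D) - f s\<bar> \<le> D * (e / (2 * t))"
        using D(1) by (intro mult_left_mono) (simp_all add: dist_real_def)
      then show ?thesis
        unfolding s(2) right_diff_distrib[symmetric] abs_mult using D(1) by simp
    qed
    have tel: "(\<Sum>i<Suc n. F (real (Suc i) * D) - F (real i * D)) = F t - F 0"
      using sum_lessThan_telescope[of "\<lambda>i. F (real i * D)" "Suc n"] D(2) by simp
    have diff: "D * (\<Sum>i<Suc n. f (real i * D)) - (F t - F 0) =
        (\<Sum>i<Suc n. D * f (real i * D) - (F (real (Suc i) * D) - F (real i * D)))"
      by (simp only: sum_subtractf[of "\<lambda>i. D * f (real i * D)" "\<lambda>i. F (real (Suc i) * D) - F (real i * D)"]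
          tel sum_distrib_left)
    have "\<bar>D * (\<Sum>i<Suc n. f (real i * D)) - (F t - F 0)\<bar> \<le> (\<Sum>i<Suc n. D * (e / (2 * t)))"
      unfolding diff by (rule order_trans[OF sum_abs]) (intro sum_mono piece, simp)
    also have "\<dots> = (real (Suc n) * D) * (e / (2 * t))"
      by simp
    also have "\<dots> < e"
      unfolding D(2) using assms(1) \<open>0 < e\<close> by simp
    finally show ?thesis
      unfolding I D_def[symmetric] by simp
  qed
  then show "\<exists>N. \<forall>n\<ge>N. norm (t / real (Suc n) * (\<Sum>i<Suc n. f (real i * (t / real (Suc n)))) - (LINT s:{0..t}|lborel. f s)) < e"
    by blast
qed

section \<open>Killed Brownian motion\<close>

text \<open>Fubini for the product law: the first variable is frozen while the second is integrated
  out.\<close>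

lemma (in prob_space) expectation_indep_var:
  fixes f :: "'b \<times> 'b \<Rightarrow> real"
  assumes ind: "indep_var S X T Y" and [measurable]: "f \<in> borel_measurable (S \<Otimes>\<^sub>M T)"
    and B: "\<And>p. \<bar>f p\<bar> \<le> B"
  shows "expectation (\<lambda>\<omega>. f (X \<omega>, Y \<omega>)) = expectation (\<lambda>\<omega>. \<integral>z. f (X \<omega>, z) \<partial>distr M T Y)"
proof -
  have [measurable]: "random_variable S X" "random_variable T Y"
    and eq: "distr M S X \<Otimes>\<^sub>M distr M T Y = distr M (S \<Otimes>\<^sub>M T) (\<lambda>x. (X x, Y x))"
    using ind unfolding indep_var_distribution_eq by auto
  interpret X: prob_space "distr M S X" by (rule prob_space_distr) simp
  interpret Y: prob_space "distr M T Y" by (rule prob_space_distr) simp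
  interpret XY: pair_prob_space "distr M S X" "distr M T Y" ..
  have "expectation (\<lambda>\<omega>. f (X \<omega>, Y \<omega>)) = (\<integral>p. f p \<partial>(distr M S X \<Otimes>\<^sub>M distr M T Y))"
    unfolding eq by (subst integral_distr) auto
  also have "\<dots> = (\<integral>x. (\<integral>z. f (x, z) \<partial>distr M T Y) \<partial>distr M S X)"
    using B by (intro XY.integral_fst'[symmetric] XY.integrable_const_bound[where B=B]) auto
  also have "\<dots> = expectation (\<lambda>\<omega>. \<integral>z. f (X \<omega>, z) \<partial>distr M T Y)"
    by (subst integral_distr) auto
  finally show ?thesis .
qed

locale killed_brownian_motion =
  fixes M :: "'a measure" and W :: "real \<Rightarrow> 'a \<Rightarrow> real" and c :: "real \<Rightarrow> real" and x t :: real
  assumes bm: "brownian_motion M W" and c_cont: "continuous_on UNIV c" and c_nonneg: "\<And>y. 0 \<le> c y"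
    and t_pos: "0 < t"
begin

sublocale prob_space M
  using bm by (simp add: brownian_motion_def)

lemma W_measurable: "0 \<le> s \<Longrightarrow> W s \<in> borel_measurable M"
  using bm by (simp add: brownian_motion_def)

lemma AE_W_0: "AE \<omega> in M. W 0 \<omega> = 0"
  using bm by (simp add: brownian_motion_def)

lemma distributed_increment:
  "0 \<le> s \<Longrightarrow> s < u \<Longrightarrow> distributed M lborel (\<lambda>\<omega>. W u \<omega> - W s \<omega>) (normal_density 0 (sqrt (u - s)))"
  using bm by (simp add: brownian_motion_def)

lemma W_continuous: "\<omega> \<in> space M \<Longrightarrow> continuous_on {0..} (\<lambda>s. W s \<omega>)"
  using bm by (simp add: brownian_motion_def)

lemma c_measurable [measurable]: "c \<in> borel_measurable borel"
  by (rule borel_measurable_continuous_onI[OF c_cont])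

definition weight :: "'a \<Rightarrow> real" where
  "weight \<omega> = exp (- (LINT s:{0..t}|lborel. c (x + W s \<omega>)))"

definition mesh :: "nat \<Rightarrow> real" where
  "mesh n = t / real (Suc n)"

text \<open>The sum runs over \<open>i < Suc n\<close>, the left endpoints of the
  \<open>Suc n\<close> steps, and omits the terminal position, exactly as in iterates of
  \<open>killed_step\<close>.\<close>

definition discrete_weight :: "nat \<Rightarrow> 'a \<Rightarrow> real" where
  "discrete_weight n \<omega> = exp (- (mesh n * (\<Sum>i<Suc n. c (x + W (real i * mesh n) \<omega>))))"

lemma mesh_pos: "0 < mesh n" and mesh_Suc: "real (Suc n) * mesh n = t"
  using t_pos by (simp_all add: mesh_def)

lemma discrete_weight_measurable [measurable]: "discrete_weight n \<in> borel_measurable M"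
proof -
  have [measurable]: "W (real i * mesh n) \<in> borel_measurable M" for i
    using mesh_pos[of n] by (intro W_measurable) simp
  show ?thesis
    unfolding discrete_weight_def[abs_def] by measurable
qed

lemma discrete_weight_bounds: "0 \<le> discrete_weight n \<omega>" "discrete_weight n \<omega> \<le> 1"
proof -
  have "0 \<le> mesh n * (\<Sum>i<Suc n. c (x + W (real i * mesh n) \<omega>))"
    using mesh_pos[of n] by (intro mult_nonneg_nonneg sum_nonneg c_nonneg less_imp_le)
  then show "0 \<le> discrete_weight n \<omega>" "discrete_weight n \<omega> \<le> 1"
    by (simp_all add: discrete_weight_def del: sum.lessThan_Suc)
qed

lemma discrete_weight_LIMSEQ:
  assumes "\<omega> \<in> space M" shows "(\<lambda>n. discrete_weight n \<omega>) \<longlonglongrightarrow> weight \<omega>"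
proof -
  have "continuous_on {0..t} (\<lambda>s. c (x + W s \<omega>))"
    by (intro continuous_on_compose2[OF c_cont] continuous_intros
        continuous_on_subset[OF W_continuous[OF assms]]) auto
  from riemann_sum_LIMSEQ[OF t_pos this] show ?thesis
    unfolding discrete_weight_def weight_def mesh_def by (intro tendsto_intros)
qed

text \<open>Every path is continuous, so the Riemann sums converge at each point of the space and
  measurability passes to the limit without exceptional sets.\<close>

lemma weight_measurable [measurable]: "weight \<in> borel_measurable M"
  using discrete_weight_LIMSEQ discrete_weight_measurable by (rule borel_measurable_LIMSEQ_real)

lemma weight_bounds: "\<omega> \<in> space M \<Longrightarrow> 0 \<le> weight \<omega>" "\<omega> \<in> space M \<Longrightarrow> weight \<omega> \<le> 1"
  using discrete_weight_LIMSEQ discrete_weight_bounds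
  by (blast intro: LIMSEQ_le_const LIMSEQ_le_const2)+

text \<open>Conditioning step by step, from the last increment backwards: integrating it out
  replaces g by \<open>killed_step c D g\<close> and leaves one step fewer. Left endpoints matter
  here, as the last killing factor depends on the earlier increments only.\<close>

lemma expectation_discrete:
  assumes "g \<in> borel_measurable borel" "\<And>y. \<bar>g y\<bar> \<le> B"
  shows "expectation (\<lambda>\<omega>. discrete_weight n \<omega> * g (x + W t \<omega>)) = (killed_step c (mesh n) ^^ Suc n) g x"
proof -
  define D where "D = mesh n"
  have D: "0 < D" unfolding D_def by (rule mesh_pos)
  define \<xi> where "\<xi> i \<omega> = W (real (Suc i) * D) \<omega> - W (real i * D) \<omega>" for i \<omega>
  have [measurable]: "W (real i * D) \<in> borel_measurable M" for i
    using D by (intro W_measurable) simp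
  have \<xi>_meas [measurable]: "\<xi> i \<in> borel_measurable M" for i
    unfolding \<xi>_def[abs_def] by measurable
  have indep: "indep_vars (\<lambda>_. borel) \<xi> {..<k}" for k
  proof -
    have *: "0 \<le> r 0 \<and> (\<forall>i<m. r i \<le> r (Suc i)) \<Longrightarrow>
        indep_vars (\<lambda>_. borel) (\<lambda>i \<omega>. W (r (Suc i)) \<omega> - W (r i) \<omega>) {..<m}" for m and r :: "nat \<Rightarrow> real"
      using bm unfolding brownian_motion_def by blast
    show ?thesis
      unfolding \<xi>_def[abs_def] using D by (intro *) simp
  qed
  have distr_\<xi>: "distr M borel (\<xi> i) = density lborel (normal_density 0 (sqrt D))" for i
  proof -
    have "distributed M lborel (\<xi> i) (normal_density 0 (sqrt (real (Suc i) * D - real i * D)))"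
      unfolding \<xi>_def[abs_def] using D by (intro distributed_increment) simp_all
    then have "distr M lborel (\<xi> i) = density lborel (normal_density 0 (sqrt D))"
      by (simp add: distributed_distr_eq_density algebra_simps)
    moreover have "distr M borel (\<xi> i) = distr M lborel (\<xi> i)"
      by (rule distr_cong) auto
    ultimately show ?thesis by simp
  qed
  \<comment> \<open>The walk is a function of the increments and starts exactly at x; it agrees with
    x + W along the grid only where W 0 = 0, hence almost surely.\<close>
  define X where "X v k = x + (\<Sum>j<k. v j)" for v :: "nat \<Rightarrow> real" and k
  have step: "expectation (\<lambda>\<omega>. exp (- (D * (\<Sum>i<k. c (X (\<lambda>j. \<xi> j \<omega>) i)))) * g (X (\<lambda>j. \<xi> j \<omega>) k)) =
      (killed_step c D ^^ k) g x"
    if "g \<in> borel_measurable borel" "\<And>y. \<bar>g y\<bar> \<le> B" for g k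
    using that
  proof (induction k arbitrary: g)
    case 0
    show ?case by (simp add: X_def prob_space)
  next
    case (Suc k)
    note [measurable] = Suc.prems(1)
    define P where "P = PiM {..<k} (\<lambda>_. borel :: real measure)"
    define V where "V \<omega> = restrict (\<lambda>i. \<xi> i \<omega>) {..<k}" for \<omega>
    have proj: "(\<lambda>v. v j) \<in> borel_measurable P" if "j < k" for j
      unfolding P_def using that by (intro measurable_component_singleton) simp
    have X_meas: "(\<lambda>v. X v i) \<in> borel_measurable P" if "i \<le> k" for i
      unfolding X_def using that by (intro borel_measurable_add borel_measurable_const borel_measurable_sum proj) simp
    define w where "w v = exp (- (D * (\<Sum>i<Suc k. c (X v i))))" for v
    have w_meas [measurable]: "w \<in> borel_measurable P"
    proof -
      have "(\<lambda>v. c (X v i)) \<in> borel_measurable P" if "i \<in> {..<Suc k}" for i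
        using that by (intro measurable_compose[OF X_meas c_measurable]) simp
      then have [measurable]: "(\<lambda>v. \<Sum>i<Suc k. c (X v i)) \<in> borel_measurable P"
        by (rule borel_measurable_sum)
      show ?thesis
        unfolding w_def[abs_def] by measurable
    qed
    have [measurable]: "(\<lambda>v. X v k) \<in> borel_measurable P"
      by (rule X_meas) simp
    define T where "T = PiM {k} (\<lambda>_. borel :: real measure)"
    \<comment> \<open>\<open>indep_var\<close> compares variables of one value type, so the last
      increment is kept as a function on the singleton \<open>{k}\<close>, alongside the vector
      \<open>V\<close> of the earlier ones.\<close>
    define Y where "Y \<omega> = restrict (\<lambda>i. \<xi> i \<omega>) {k}" for \<omega>
    have ind: "indep_var P V T Y"
      unfolding P_def V_def T_def Y_def by (rule indep_var_restrict[OF indep[of "Suc k"]]) auto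
    have Y_meas [measurable]: "Y \<in> measurable M T"
      using ind by (rule indep_var_rv2)
    have T_meas [measurable]: "(\<lambda>z. z k) \<in> borel_measurable T"
      unfolding T_def by (intro measurable_component_singleton) simp
    have XV: "X (\<lambda>j. \<xi> j \<omega>) i = X (V \<omega>) i" if "i \<le> k" for i \<omega>
      using that unfolding X_def V_def by (intro arg_cong2[where f="(+)"] sum.cong) auto
    have "expectation (\<lambda>\<omega>. exp (- (D * (\<Sum>i<Suc k. c (X (\<lambda>j. \<xi> j \<omega>) i)))) * g (X (\<lambda>j. \<xi> j \<omega>) (Suc k))) =
        expectation (\<lambda>\<omega>. (\<lambda>(v, z). w v * g (X v k + z k)) (V \<omega>, Y \<omega>))"
    proof (rule Bochner_Integration.integral_cong[OF refl])
      fix \<omega>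
      have "(\<Sum>i<Suc k. c (X (\<lambda>j. \<xi> j \<omega>) i)) = (\<Sum>i<Suc k. c (X (V \<omega>) i))"
        by (intro sum.cong refl arg_cong[where f=c] XV) simp
      moreover have "X (\<lambda>j. \<xi> j \<omega>) (Suc k) = X (V \<omega>) k + \<xi> k \<omega>"
        using XV[of k \<omega>] by (simp add: X_def)
      ultimately show "exp (- (D * (\<Sum>i<Suc k. c (X (\<lambda>j. \<xi> j \<omega>) i)))) * g (X (\<lambda>j. \<xi> j \<omega>) (Suc k)) =
          (\<lambda>(v, z). w v * g (X v k + z k)) (V \<omega>, Y \<omega>)"
        by (simp add: w_def Y_def)
    qed
    also have "\<dots> = expectation (\<lambda>\<omega>. \<integral>z. (\<lambda>(v, z). w v * g (X v k + z k)) (V \<omega>, z) \<partial>distr M T Y)"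
    proof (rule expectation_indep_var[OF ind])
      show "(\<lambda>(v, z). w v * g (X v k + z k)) \<in> borel_measurable (P \<Otimes>\<^sub>M T)"
        by measurable
      have "0 \<le> D * (\<Sum>i<Suc k. c (X v i))" for v
        using D by (intro mult_nonneg_nonneg sum_nonneg c_nonneg less_imp_le)
      then have "\<bar>w v * g y\<bar> \<le> 1 * B" for v y
        unfolding abs_mult w_def using Suc.prems(2) by (intro mult_mono) (simp_all del: sum.lessThan_Suc)
      then show "\<bar>case p of (v, z) \<Rightarrow> w v * g (X v k + z k)\<bar> \<le> 1 * B" for p
        by (simp add: case_prod_beta)
    qed
    also have "\<dots> = expectation (\<lambda>\<omega>. exp (- (D * (\<Sum>i<k. c (X (\<lambda>j. \<xi> j \<omega>) i)))) * killed_step c D g (X (\<lambda>j. \<xi> j \<omega>) k))"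
    proof (rule Bochner_Integration.integral_cong[OF refl])
      fix \<omega>
      have "(\<Sum>i<k. c (X (V \<omega>) i)) = (\<Sum>i<k. c (X (\<lambda>j. \<xi> j \<omega>) i))"
        by (intro sum.cong refl arg_cong[where f=c] XV[symmetric]) simp
      \<comment> \<open>The factor of the last grid point X(k) is split off; it is the one that
        \<open>killed_step\<close> carries.\<close>
      then have w_V: "w (V \<omega>) =
          exp (- (D * (\<Sum>i<k. c (X (\<lambda>j. \<xi> j \<omega>) i)))) * exp (- c (X (V \<omega>) k) * D)"
        unfolding w_def exp_add[symmetric] by (simp add: algebra_simps)
      have "(\<integral>z. w (V \<omega>) * g (X (V \<omega>) k + z k) \<partial>distr M T Y) =
          (\<integral>z. w (V \<omega>) * g (X (V \<omega>) k + z) \<partial>distr M borel (\<xi> k))"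
        by (simp add: integral_distr Y_def[symmetric]) (simp add: Y_def)
      also have "\<dots> =
          (\<integral>z. normal_density 0 (sqrt D) z * (w (V \<omega>) * g (X (V \<omega>) k + z)) \<partial>lborel)"
        unfolding distr_\<xi> by (subst integral_density) auto
      also have "\<dots> = w (V \<omega>) * (\<integral>z. normal_density 0 (sqrt D) z * g (X (V \<omega>) k + z) \<partial>lborel)"
        by (simp only: mult.left_commute[of _ "w (V \<omega>)"] integral_mult_right_zero)
      finally show "(\<integral>z. (\<lambda>(v, z). w v * g (X v k + z k)) (V \<omega>, z) \<partial>distr M T Y) =
          exp (- (D * (\<Sum>i<k. c (X (\<lambda>j. \<xi> j \<omega>) i)))) * killed_step c D g (X (\<lambda>j. \<xi> j \<omega>) k)"
        by (simp only: killed_step_def XV[OF order_refl] prod.case w_V mult.assoc)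
    qed
    also have "\<dots> = (killed_step c D ^^ k) (killed_step c D g) x"
      using D c_nonneg Suc.prems
      by (intro Suc.IH killed_step_measurable abs_killed_step_le) auto
    finally show ?case
      by (simp only: funpow_Suc_right comp_def)
  qed
  have "expectation (\<lambda>\<omega>. discrete_weight n \<omega> * g (x + W t \<omega>)) =
      expectation (\<lambda>\<omega>. exp (- (D * (\<Sum>i<Suc n. c (X (\<lambda>j. \<xi> j \<omega>) i)))) * g (X (\<lambda>j. \<xi> j \<omega>) (Suc n)))"
  proof (rule integral_cong_AE)
    note [measurable] = assms(1)
    have [measurable]: "W t \<in> borel_measurable M"
      using t_pos by (intro W_measurable) simp
    show "(\<lambda>\<omega>. discrete_weight n \<omega> * g (x + W t \<omega>)) \<in> borel_measurable M"
      by measurable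
    show "(\<lambda>\<omega>. exp (- (D * (\<Sum>i<Suc n. c (X (\<lambda>j. \<xi> j \<omega>) i)))) * g (X (\<lambda>j. \<xi> j \<omega>) (Suc n))) \<in> borel_measurable M"
      unfolding X_def by measurable
    show "AE \<omega> in M. discrete_weight n \<omega> * g (x + W t \<omega>) =
        exp (- (D * (\<Sum>i<Suc n. c (X (\<lambda>j. \<xi> j \<omega>) i)))) * g (X (\<lambda>j. \<xi> j \<omega>) (Suc n))"
      using AE_W_0
    proof eventually_elim
      case (elim \<omega>)
      have "X (\<lambda>j. \<xi> j \<omega>) i = x + W (real i * D) \<omega>" for i
        using sum_lessThan_telescope[of "\<lambda>i. W (real i * D) \<omega>" i] elim by (simp add: X_def \<xi>_def)
      then show ?case
        using mesh_Suc[of n] by (simp only: discrete_weight_def D_def)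
    qed
  qed
  also have "\<dots> = (killed_step c D ^^ Suc n) g x"
    by (rule step[OF assms])
  finally show ?thesis
    unfolding D_def .
qed

lemma killed_expectation_weight: "killed_expectation M W c x t f = expectation (\<lambda>\<omega>. weight \<omega> * f (x + W t \<omega>))"
  by (simp add: killed_expectation_def weight_def)

text \<open>The weights lie between 0 and 1, so the Trotter limit is dominated convergence along the
  paths, for every bounded measurable g and not just for eigenfunctions.\<close>

lemma killed_step_LIMSEQ:
  assumes [measurable]: "g \<in> borel_measurable borel" and B: "\<And>y. \<bar>g y\<bar> \<le> B"
  shows "(\<lambda>n. (killed_step c (t / real (Suc n)) ^^ Suc n) g x) \<longlonglongrightarrow> killed_expectation M W c x t g"
proof -
  have [measurable]: "W t \<in> borel_measurable M"
    using t_pos by (intro W_measurable) simp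
  have "(\<lambda>n. expectation (\<lambda>\<omega>. discrete_weight n \<omega> * g (x + W t \<omega>))) \<longlonglongrightarrow>
      expectation (\<lambda>\<omega>. weight \<omega> * g (x + W t \<omega>))"
  proof (rule integral_dominated_convergence[where w="\<lambda>_. B"])
    show "AE \<omega> in M. (\<lambda>n. discrete_weight n \<omega> * g (x + W t \<omega>)) \<longlonglongrightarrow> weight \<omega> * g (x + W t \<omega>)"
      by (intro AE_I2 tendsto_mult discrete_weight_LIMSEQ tendsto_const)
    show "AE \<omega> in M. norm (discrete_weight n \<omega> * g (x + W t \<omega>)) \<le> B" for n
    proof (rule AE_I2)
      fix \<omega>
      have "\<bar>discrete_weight n \<omega> * g (x + W t \<omega>)\<bar> \<le> 1 * B"
        unfolding abs_mult using discrete_weight_bounds[of n \<omega>] B by (intro mult_mono) auto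
      then show "norm (discrete_weight n \<omega> * g (x + W t \<omega>)) \<le> B" by simp
    qed
  qed measurable
  then show ?thesis
    unfolding expectation_discrete[OF assms] killed_expectation_weight mesh_def .
qed

text \<open>The unkilled position is Gaussian, being an increment from time 0 up to a null event.
  Weighting by the survival factor creates no new charged sets, so the killed law is absolutely
  continuous too.\<close>

lemma AE_not_in_null_set:
  assumes "B \<in> null_sets lborel" shows "AE \<omega> in M. x + W t \<omega> \<notin> B"
proof -
  have [measurable]: "W t \<in> borel_measurable M" "W 0 \<in> borel_measurable M"
    using t_pos by (auto intro: W_measurable)
  have [measurable]: "B \<in> sets borel" using assms by auto
  have \<sigma>: "0 < sqrt (t - 0)" using t_pos by simp
  from normal_density_affine[OF distributed_increment[OF order_refl t_pos] \<sigma>, of 1 x]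
  have "distributed M lborel (\<lambda>\<omega>. x + 1 * (W t \<omega> - W 0 \<omega>)) (normal_density x (sqrt t))"
    by simp
  then have "distr M lborel (\<lambda>\<omega>. x + (W t \<omega> - W 0 \<omega>)) = density lborel (normal_density x (sqrt t))"
    by (simp add: distributed_distr_eq_density)
  moreover have "B \<in> null_sets (density lborel (normal_density x (sqrt t)))"
    using absolutely_continuousI_density[of "\<lambda>y. ennreal (normal_density x (sqrt t) y)" lborel] assms
    unfolding absolutely_continuous_def by auto
  ultimately have "B \<in> null_sets (distr M lborel (\<lambda>\<omega>. x + (W t \<omega> - W 0 \<omega>)))"
    by simp
  then have "AE y in distr M lborel (\<lambda>\<omega>. x + (W t \<omega> - W 0 \<omega>)). y \<notin> B"
    by (rule AE_not_in)
  then have "AE \<omega> in M. x + (W t \<omega> - W 0 \<omega>) \<notin> B"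
    by (subst (asm) AE_distr_iff) auto
  then show ?thesis
    using AE_W_0 by eventually_elim simp
qed

text \<open>\<open>N\<close> below is the sub-probability law of the surviving process at time t.
  Its Radon-Nikodym density comes with no regularity beyond integrability and sign.\<close>

lemma killed_expectation_density:
  obtains k where "integrable lborel k" "\<And>y. 0 \<le> k y"
    "\<And>f B. f \<in> borel_measurable borel \<Longrightarrow> (\<And>y. \<bar>f y\<bar> \<le> B) \<Longrightarrow>
      killed_expectation M W c x t f = (\<integral>y. f y * k y \<partial>lborel)"
proof -
  have [measurable]: "W t \<in> borel_measurable M"
    using t_pos by (intro W_measurable) simp
  define N where "N = distr (density M (\<lambda>\<omega>. ennreal (weight \<omega>))) borel (\<lambda>\<omega>. x + W t \<omega>)"
  have emeasure_N: "emeasure N A = (\<integral>\<^sup>+\<omega>. ennreal (weight \<omega>) * indicator A (x + W t \<omega>) \<partial>M)"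
    if "A \<in> sets borel" for A :: "real set"
    unfolding N_def using that
    by (subst emeasure_distr) (auto simp: emeasure_density intro!: nn_integral_cong split: split_indicator)
  have "finite_measure N"
  proof (rule finite_measureI)
    have "emeasure N (space N) = (\<integral>\<^sup>+\<omega>. ennreal (weight \<omega>) \<partial>M)"
      using emeasure_N[of UNIV] by (simp add: N_def)
    also have "\<dots> \<le> (\<integral>\<^sup>+\<omega>. 1 \<partial>M)"
      using weight_bounds by (intro nn_integral_mono) simp
    also have "\<dots> < \<infinity>" by (simp add: emeasure_space_1)
    finally show "emeasure N (space N) \<noteq> \<infinity>" by simp
  qed
  moreover have "absolutely_continuous lborel N"
    unfolding absolutely_continuous_def
  proof
    fix A :: "real set" assume A: "A \<in> null_sets lborel"
    then have "A \<in> sets borel" by auto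
    from AE_not_in_null_set[OF A]
    have "AE \<omega> in M. ennreal (weight \<omega>) * indicator A (x + W t \<omega>) = 0"
      by eventually_elim simp
    then have "(\<integral>\<^sup>+\<omega>. ennreal (weight \<omega>) * indicator A (x + W t \<omega>) \<partial>M) = (\<integral>\<^sup>+\<omega>. 0 \<partial>M)"
      by (rule nn_integral_cong_AE)
    then show "A \<in> null_sets N"
      using \<open>A \<in> sets borel\<close> by (intro null_setsI) (auto simp: emeasure_N, simp add: N_def)
  qed
  moreover have sets_N: "sets N = sets lborel"
    by (simp add: N_def)
  ultimately obtain k where k [measurable]: "k \<in> borel_measurable lborel"
      and RN: "AE y in lborel. RN_deriv lborel N y = ennreal (k y)" and nonneg: "\<And>y. 0 \<le> k y"
    using sigma_finite_measure.real_RN_deriv[OF sigma_finite_lborel] by metis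
  have "density lborel (\<lambda>y. ennreal (k y)) = density lborel (RN_deriv lborel N)"
    using RN by (intro density_cong) auto
  also have "\<dots> = N"
    by (rule sigma_finite_measure.density_RN_deriv[OF sigma_finite_lborel]) fact+
  finally have N: "density lborel (\<lambda>y. ennreal (k y)) = N" .
  show thesis
  proof
    show "0 \<le> k y" for y by (rule nonneg)
    have "(\<integral>\<^sup>+y. ennreal (k y) \<partial>lborel) = emeasure N UNIV"
      unfolding N[symmetric] by (simp add: emeasure_density)
    also have "\<dots> < \<infinity>"
      using finite_measure.emeasure_finite[OF \<open>finite_measure N\<close>, of UNIV] by (simp add: top.not_eq_extremum)
    finally show "integrable lborel k"
      using nonneg by (intro integrableI_nonneg) auto
    fix f :: "real \<Rightarrow> real" and B
    assume [measurable]: "f \<in> borel_measurable borel"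
    have "(\<integral>y. f y * k y \<partial>lborel) = (\<integral>y. f y \<partial>N)"
      unfolding N[symmetric] using nonneg by (subst integral_density) (auto simp: mult.commute)
    also have "\<dots> = expectation (\<lambda>\<omega>. weight \<omega> * f (x + W t \<omega>))"
      unfolding N_def using weight_bounds by (subst integral_distr) (auto simp: integral_density)
    finally show "killed_expectation M W c x t f = (\<integral>y. f y * k y \<partial>lborel)"
      by (simp add: killed_expectation_weight)
  qed
qed

end

section \<open>Identification of the transition density\<close>

lemma killed_expectation_kernel:
  fixes M :: "'a measure"
  assumes "brownian_motion M W" "0 < t"
  shows "0 \<le> kernel t x y" "integrable lborel (kernel t x)"
    and "f \<in> borel_measurable borel \<Longrightarrow> bounded (range f) \<Longrightarrow>
      killed_expectation M W ctilde x t f = (\<integral>y. f y * kernel t x y \<partial>lborel)"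
proof -
  interpret killed_brownian_motion M W ctilde x t
    by unfold_locales (use assms continuous_on_ctilde ctilde_nonneg in auto)
  have K_meas [measurable]: "kernel t x \<in> borel_measurable borel"
    by (rule borel_measurable_continuous_onI[OF continuous_on_kernel[OF assms(2)]])
  obtain k where k: "integrable lborel k" "\<And>y. 0 \<le> k y"
    and kE: "\<And>f B. f \<in> borel_measurable borel \<Longrightarrow> (\<And>y. \<bar>f y\<bar> \<le> B) \<Longrightarrow>
      killed_expectation M W ctilde x t f = (\<integral>y. f y * k y \<partial>lborel)"
    using killed_expectation_density by blast
  have [measurable]: "k \<in> borel_measurable borel"
    using borel_measurable_integrable[OF k(1)] by simp
  have AE_k: "AE y in lborel. k y = kernel t x y"
  proof (rule AE_eq_kernel[OF assms(2) k(1)])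
    fix j
    note meas = gaussian_rational_measurable[OF gaussian_rational_eigfun[of j]]
    obtain B where B: "\<And>y. \<bar>eigfun j y\<bar> \<le> B"
      using gaussian_rational_bounded[OF gaussian_rational_eigfun[of j]] by (metis half_gt_zero zero_less_one)
    \<comment> \<open>The same iterates have two limits: the path expectation, and the exponentially
      decaying eigenfunction.\<close>
    have "killed_expectation M W ctilde x t (eigfun j) = exp (- eigval j * t) * eigfun j x"
      by (rule LIMSEQ_unique[OF killed_step_LIMSEQ[OF meas B] killed_step_eigfun_LIMSEQ[OF assms(2)]])
    then show "(\<integral>y. k y * eigfun j y \<partial>lborel) = exp (- eigval j * t) * eigfun j x"
      unfolding kE[OF meas B] by (simp only: mult.commute)
  qed
  \<comment> \<open>The sign is not visible in the series; it is inherited from the Radon-Nikodym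
    density almost everywhere and extended by continuity.\<close>
  show "0 \<le> kernel t x y"
  proof (rule AE_lborel_imp_all[where P="\<lambda>y. 0 \<le> kernel t x y"])
    show "open {y. \<not> 0 \<le> kernel t x y}"
      using continuous_on_kernel[OF assms(2), of x]
      by (simp add: not_le) (intro open_Collect_less continuous_on_const, simp)
    show "AE y in lborel. 0 \<le> kernel t x y"
      using AE_k by eventually_elim (use k(2) in metis)
  qed
  show "integrable lborel (kernel t x)"
    using integrable_cong_AE[of k lborel "kernel t x"] AE_k k(1) by simp
  assume f [measurable]: "f \<in> borel_measurable borel" and "bounded (range f)"
  then obtain B where "\<And>y. \<bar>f y\<bar> \<le> B"
    by (auto simp: bounded_iff)
  then have "killed_expectation M W ctilde x t f = (\<integral>y. f y * k y \<partial>lborel)"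
    by (intro kE f)
  also have "\<dots> = (\<integral>y. f y * kernel t x y \<partial>lborel)"
    using AE_k by (intro integral_cong_AE) (auto elim: eventually_mono)
  finally show "killed_expectation M W ctilde x t f = (\<integral>y. f y * kernel t x y \<partial>lborel)" .
qed

text \<open>The forward direction is uniqueness: indicators as test functions determine a density
  almost everywhere, and continuity of both versions removes the null set. The backward direction is
  existence.\<close>

lemma killed_transition_density_kernel_iff:
  assumes "brownian_motion M W"
  shows "killed_transition_density M W ctilde p \<longleftrightarrow> (\<forall>t>0. \<forall>x y. p t x y = kernel t x y)"
proof
  assume p: "killed_transition_density M W ctilde p"
  show "\<forall>t>0. \<forall>x y. p t x y = kernel t x y"
  proof (intro allI impI)
    fix t x y :: real assume t: "0 < t"
    have cont: "continuous_on UNIV (p t x)" and int: "integrable lborel (p t x)"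
      and E: "\<And>f. f \<in> borel_measurable borel \<Longrightarrow> bounded (range f) \<Longrightarrow>
        killed_expectation M W ctilde x t f = (\<integral>y. f y * p t x y \<partial>lborel)"
      using p t unfolding killed_transition_density_def by auto
    show "p t x y = kernel t x y"
    proof (rule AE_lborel_imp_all[where P="\<lambda>y. p t x y = kernel t x y"])
      have "open {y. p t x y \<noteq> kernel t x y}"
        by (intro open_Collect_neq cont continuous_on_kernel[OF t])
      then show "open {y. \<not> p t x y = kernel t x y}" .
      show "AE y in lborel. p t x y = kernel t x y"
      proof (rule density_unique_real[OF int killed_expectation_kernel(2)[OF assms t]])
        fix A :: "real set" assume "A \<in> sets lborel"
        then have ind: "indicator A \<in> borel_measurable (borel :: real measure)" by simp
        have "bounded (range (indicator A :: real \<Rightarrow> real))"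
          unfolding bounded_iff by (intro exI[of _ 1]) (auto simp: indicator_def)
        from E[OF ind this] killed_expectation_kernel(3)[OF assms t ind this, of x]
        show "(LINT y:A|lborel. p t x y) = (LINT y:A|lborel. kernel t x y)"
          by (simp add: set_lebesgue_integral_def)
      qed
    qed
  qed
next
  assume p: "\<forall>t>0. \<forall>x y. p t x y = kernel t x y"
  show "killed_transition_density M W ctilde p"
    unfolding killed_transition_density_def
  proof (intro allI impI)
    fix t x :: real assume t: "0 < t"
    then have "p t x = kernel t x" using p by auto
    then show "(\<forall>y. 0 \<le> p t x y) \<and> continuous_on UNIV (p t x) \<and> integrable lborel (p t x) \<and>
        (\<forall>f. f \<in> borel_measurable borel \<and> bounded (range f) \<longrightarrow>
           killed_expectation M W ctilde x t f = (\<integral>y. f y * p t x y \<partial>lborel))"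
      using killed_expectation_kernel[OF assms t] continuous_on_kernel[OF t] by simp
  qed
qed

text \<open>Orthogonality of a set cannot detect repetitions in an enumeration, so injectivity of
  \<open>Q\<close> and the distinctness from 1 are recorded as well. Summability is recorded because
  the value of an infinite sum is meaningful only for a convergent series.\<close>

theorem proposition5p4:
  fixes M :: "'a measure" and W :: "real \<Rightarrow> 'a \<Rightarrow> real"
    and p :: "real \<Rightarrow> real \<Rightarrow> real \<Rightarrow> real"
  shows "nu = density lborel (\<lambda>y. ennreal (exp (- y\<^sup>2) / (2 * y\<^sup>2 + 1)\<^sup>2)) \<and>
    (\<forall>g \<in> {\<lambda>y. 1} \<union> range Q. \<exists>q :: real poly. \<forall>y. g y = poly q y) \<and>
    inj Q \<and> (\<lambda>y. 1) \<notin> range Q \<and>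
    L2_orthogonal_set nu ({\<lambda>y. 1} \<union> range Q) \<and>
    L2_complete_set nu ({\<lambda>y. 1} \<union> range Q) \<and>
    (\<forall>t>0. \<forall>x y. summable (\<lambda>n. exp (- (real n + 11 / 2) * t) *
       (Q n x * Q n y / (2 ^ (n + 1) * fact n * (real n + 3))))) \<and>
    (brownian_motion M W \<longrightarrow>
      (killed_transition_density M W ctilde p \<longleftrightarrow>
       (\<forall>t>0. \<forall>x y. p t x y =
          1 / sqrt pi * (exp (- (1 / 2) * (x\<^sup>2 + y\<^sup>2)) / ((2 * x\<^sup>2 + 1) * (2 * y\<^sup>2 + 1))) *
          (2 * exp (- (5 / 2) * t) +
           (\<Sum>n. exp (- (real n + 11 / 2) * t) *
              (Q n x * Q n y / (2 ^ (n + 1) * fact n * (real n + 3))))))))"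
proof (intro conjI allI impI)
  show "nu = density lborel (\<lambda>y. ennreal (exp (- y\<^sup>2) / (2 * y\<^sup>2 + 1)\<^sup>2))"
    by (rule nu_altdef)
  show "\<forall>g \<in> {\<lambda>y. 1} \<union> range Q. \<exists>q :: real poly. \<forall>y. g y = poly q y"
    unfolding range_base_fun[symmetric] by (auto simp: base_fun_def)
  show "inj Q"
    using inj_base_fun unfolding inj_def base_fun_Suc[symmetric] by blast
  show "(\<lambda>y. 1) \<notin> range Q"
  proof
    assume "(\<lambda>y. 1) \<in> range Q"
    then obtain n where "base_fun 0 = base_fun (Suc n)"
      by (auto simp: base_fun_0 base_fun_Suc)
    then show False
      using inj_base_fun by (simp add: inj_eq)
  qed
  show "L2_orthogonal_set nu ({\<lambda>y. 1} \<union> range Q)"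
    by (rule orthogonal_nu)
  show "L2_complete_set nu ({\<lambda>y. 1} \<union> range Q)"
    by (rule complete_nu)
  show "summable (\<lambda>n. exp (- (real n + 11 / 2) * t) * (Q n x * Q n y / (2 ^ (n + 1) * fact n * (real n + 3))))"
    if "0 < t" for t x y :: real
    by (rule kernel_altdef(1)[OF that])
  show "killed_transition_density M W ctilde p \<longleftrightarrow>
       (\<forall>t>0. \<forall>x y. p t x y =
          1 / sqrt pi * (exp (- (1 / 2) * (x\<^sup>2 + y\<^sup>2)) / ((2 * x\<^sup>2 + 1) * (2 * y\<^sup>2 + 1))) *
          (2 * exp (- (5 / 2) * t) +
           (\<Sum>n. exp (- (real n + 11 / 2) * t) *
              (Q n x * Q n y / (2 ^ (n + 1) * fact n * (real n + 3))))))"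
    if "brownian_motion M W"
    using killed_transition_density_kernel_iff[OF that, of p] kernel_altdef(2) by simp
qed

end
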